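(* For every $n\in\mathbf N$ with $n\ge2$, $F_n(z_1,w_1,\dots,z_n,w_n)$ is a rational function in the variables $z_1,\dots,z_n,w_1,\dots,w_n$. It is, moreover, a (finite) sum of terms of the form $$\frac{z_{i_1}\cdots z_{i_k}\,w_{j_1}\cdots w_{j_k}}{(1-u_1)\cdots(1-u_\ell)}$$ for some $\ell\in\{2,\dots,n\}$, $k\in\{0,1,\dots,\ell-1\}$, $i_1,\dots,i_k,j_1,\dots,j_k\in\{1,\dots,n\}$, and for $u_1,\dots,u_\ell$ of the form $$u_p=\sum_{i=1}^n z_iw_{\sigma_p(i)}$$ for distinct permutations $\sigma_1,\dots,\sigma_\ell$ of $\{1,\dots,n\}$.
   Context: **The operator $T$.** $T$ is the quasi-nilpotent $\mathrm{DT}(\delta_0,1)$-operator, and $\tau$ is the unique normalized trace on the von Neumann algebra generated by $T$. It is realized as the limit in $*$-moments of strictly upper triangular random matrices with i.i.d. complex Gaussian entries: for every word $p(T^*,T)$ in $T^*$ and $T$, $$\tau(p(T^*,T))=\lim_{d\to\infty}\mathbb E\Big[\tfrac1d\operatorname{Tr}\,p(T_d^*,T_d)\Big],$$ where $T_d$ is the random $d\times d$ matrix that is zero on and below the diagonal and whose entries strictly above the diagonal are i.i.d. complex Gaussian with mean $0$ and $\mathbb E|t|^2=1/d$ (real and imaginary parts independent, each of variance $1/(2d)$). **The numbers $N$.** For $n\in\mathbf N=\{1,2,\dots\}$ and $k_1,\dots,k_n,\ell_1,\dots,\ell_n\in\mathbf N\cup\{0\}$: if $k_1+\dots+k_n\neq\ell_1+\dots+\ell_n$,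 put $N(k_1,\ell_1,\dots,k_n,\ell_n)=0$; if $m:=k_1+\dots+k_n=\ell_1+\dots+\ell_n$, put $$N(k_1,\ell_1,\dots,k_n,\ell_n)=(m+1)!\,\tau\big((T^* )^{k_1}T^{\ell_1}\cdots(T^* )^{k_n}T^{\ell_n}\big).$$ **Generating functions.** For $n\in\mathbf N$, $$F_n(z_1,w_1,\dots,z_n,w_n)=\sum_{\substack{k_1,\dots,k_n\ge0\\ \ell_1,\dots,\ell_n\ge0}}N(k_1,\ell_1,\dots,k_n,\ell_n)\,z_1^{k_1}w_1^{\ell_1}\cdots z_n^{k_n}w_n^{\ell_n},$$ a formal power series in commuting variables. Rational functions with denominators $\prod(1-u_p)$ are identified with their power series expansions at the origin. When $k=0$ the numerator is $1$. *)

theory Defs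
  imports
    "HOL-Probability.Probability"
    "HOL-Library.Poly_Mapping"
    "HOL-Combinatorics.Permutations"
    "Jordan_Normal_Form.Schur_Decomposition"
begin

section \<open>Words in an element and its adjoint\<close>

datatype letter = Adj | Opr

type_synonym word = "letter list"

section \<open>Strictly upper triangular Gaussian random matrices\<close>

text \<open>The law of a centred complex Gaussian with second absolute moment \<open>v\<close>: independent real and
  imaginary parts of variance \<open>v / 2\<close> each.\<close>

definition complex_gaussian :: "real \<Rightarrow> complex measure" where
  "complex_gaussian v =
     (let N = density lborel (\<lambda>x. ennreal (normal_density 0 (sqrt (v / 2)) x))
      in distr (N \<Otimes>\<^sub>M N) borel (\<lambda>(x, y). Complex x y))"

definition entries_law :: "nat \<Rightarrow> (nat \<times> nat \<Rightarrow> complex) measure" where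
  "entries_law d = PiM {(i, j). i < j \<and> j < d} (\<lambda>_. complex_gaussian (1 / real d))"

definition triangular_mat :: "nat \<Rightarrow> (nat \<times> nat \<Rightarrow> complex) \<Rightarrow> complex mat" where
  "triangular_mat d t = mat d d (\<lambda>(i, j). if i < j then t (i, j) else 0)"

primrec mat_word :: "nat \<Rightarrow> complex mat \<Rightarrow> word \<Rightarrow> complex mat" where
  "mat_word d A [] = 1\<^sub>m d"
| "mat_word d A (x # xs) = (case x of Adj \<Rightarrow> mat_adjoint A | Opr \<Rightarrow> A) * mat_word d A xs"

definition mat_trace :: "complex mat \<Rightarrow> complex" where
  "mat_trace A = (\<Sum>i<dim_row A. A $$ (i, i))"

definition expected_moment :: "nat \<Rightarrow> word \<Rightarrow> complex" where
  "expected_moment d p =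
     (LINT t|entries_law d. mat_trace (mat_word d (triangular_mat d t) p) / of_nat d)"

section \<open>Operators on a complex Hilbert space\<close>

text \<open>A complex Hilbert space is a real Hilbert space with an isometric complex structure \<open>J\<close>
  (multiplication by the imaginary unit). The real inner product is the real part of the complex one,
  so for complex-linear operators the real Hilbert space adjoint, given by \<^const>\<open>adjoint\<close>, is the
  complex one.\<close>

definition complex_structure :: "('h::{real_inner, complete_space} \<Rightarrow> 'h) \<Rightarrow> bool" where
  "complex_structure J \<longleftrightarrow> linear J \<and> (\<forall>x. J (J x) = - x) \<and> (\<forall>x. norm (J x) = norm x)"

definition bounded_ops :: "('h::{real_inner, complete_space} \<Rightarrow> 'h) \<Rightarrow> ('h \<Rightarrow> 'h) set" where
  "bounded_ops J = {A. bounded_linear A \<and> A \<circ> J = J \<circ> A}"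

definition op_scale ::
  "('h::{real_inner, complete_space} \<Rightarrow> 'h) \<Rightarrow> complex \<Rightarrow> ('h \<Rightarrow> 'h) \<Rightarrow> 'h \<Rightarrow> 'h" where
  "op_scale J c A = (\<lambda>x. Re c *\<^sub>R A x + Im c *\<^sub>R J (A x))"

definition commutant ::
  "('h::{real_inner, complete_space} \<Rightarrow> 'h) \<Rightarrow> ('h \<Rightarrow> 'h) set \<Rightarrow> ('h \<Rightarrow> 'h) set" where
  "commutant J S = {A \<in> bounded_ops J. \<forall>B\<in>S. A \<circ> B = B \<circ> A}"

definition vN_generated ::
  "('h::{real_inner, complete_space} \<Rightarrow> 'h) \<Rightarrow> ('h \<Rightarrow> 'h) \<Rightarrow> ('h \<Rightarrow> 'h) set" where
  "vN_generated J T = commutant J (commutant J {T, adjoint T})"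

definition op_le :: "('h::{real_inner, complete_space} \<Rightarrow> 'h) \<Rightarrow> ('h \<Rightarrow> 'h) \<Rightarrow> bool" where
  "op_le A B \<longleftrightarrow> (\<forall>x. inner (A x) x \<le> inner (B x) x)"

definition self_adjoints :: "('h::{real_inner, complete_space} \<Rightarrow> 'h) set \<Rightarrow> ('h \<Rightarrow> 'h) set" where
  "self_adjoints M = {A \<in> M. adjoint A = A}"

definition op_lub ::
  "('h::{real_inner, complete_space} \<Rightarrow> 'h) set \<Rightarrow> ('h \<Rightarrow> 'h) set \<Rightarrow> ('h \<Rightarrow> 'h) \<Rightarrow> bool" where
  "op_lub M D S \<longleftrightarrow> S \<in> self_adjoints M \<and> (\<forall>A\<in>D. op_le A S) \<and>
     (\<forall>S'\<in>self_adjoints M. (\<forall>A\<in>D. op_le A S') \<longrightarrow> op_le S S')"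

text \<open>Normality is the usual one: preservation of least upper bounds of upward directed families of
  self-adjoint elements.\<close>

definition normal_functional ::
  "('h::{real_inner, complete_space} \<Rightarrow> 'h) set \<Rightarrow> (('h \<Rightarrow> 'h) \<Rightarrow> complex) \<Rightarrow> bool" where
  "normal_functional M \<tau> \<longleftrightarrow>
     (\<forall>D S. D \<noteq> {} \<and> D \<subseteq> self_adjoints M \<and>
        (\<forall>A\<in>D. \<forall>B\<in>D. \<exists>C\<in>D. op_le A C \<and> op_le B C) \<and> op_lub M D S \<longrightarrow>
        (\<forall>A\<in>D. Re (\<tau> A) \<le> Re (\<tau> S)) \<and>
        (\<forall>c. (\<forall>A\<in>D. Re (\<tau> A) \<le> c) \<longrightarrow> Re (\<tau> S) \<le> c))"

definition normalized_trace ::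
  "('h::{real_inner, complete_space} \<Rightarrow> 'h) \<Rightarrow> ('h \<Rightarrow> 'h) set \<Rightarrow> (('h \<Rightarrow> 'h) \<Rightarrow> complex) \<Rightarrow> bool" where
  "normalized_trace J M \<tau> \<longleftrightarrow>
     (\<forall>A\<in>M. \<forall>B\<in>M. \<tau> (\<lambda>x. A x + B x) = \<tau> A + \<tau> B) \<and>
     (\<forall>c. \<forall>A\<in>M. \<tau> (op_scale J c A) = c * \<tau> A) \<and>
     \<tau> id = 1 \<and>
     (\<forall>A\<in>M. \<forall>B\<in>M. \<tau> (A \<circ> B) = \<tau> (B \<circ> A)) \<and>
     (\<forall>A\<in>M. Im (\<tau> (adjoint A \<circ> A)) = 0 \<and> Re (\<tau> (adjoint A \<circ> A)) \<ge> 0) \<and>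
     (\<forall>A\<in>M. \<tau> (adjoint A \<circ> A) = 0 \<longrightarrow> A = (\<lambda>x. 0)) \<and>
     normal_functional M \<tau>"

primrec op_word :: "('h::{real_inner, complete_space} \<Rightarrow> 'h) \<Rightarrow> word \<Rightarrow> 'h \<Rightarrow> 'h" where
  "op_word T [] = id"
| "op_word T (x # xs) = (case x of Adj \<Rightarrow> adjoint T | Opr \<Rightarrow> T) \<circ> op_word T xs"

text \<open>The quasi-nilpotent DT-operator (together with the trace on the von Neumann algebra it
  generates) is determined, up to trace-preserving isomorphism, by its *-moments, which are
  prescribed as limits of random matrix moments.\<close>

definition quasinilpotent_DT ::
  "('h::{real_inner, complete_space} \<Rightarrow> 'h) \<Rightarrow> ('h \<Rightarrow> 'h) \<Rightarrow> (('h \<Rightarrow> 'h) \<Rightarrow> complex) \<Rightarrow> bool" where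
  "quasinilpotent_DT J T \<tau> \<longleftrightarrow>
     complex_structure J \<and> T \<in> bounded_ops J \<and> normalized_trace J (vN_generated J T) \<tau> \<and>
     (\<forall>p. (\<lambda>d. expected_moment d p) \<longlonglongrightarrow> \<tau> (op_word T p))"

section \<open>The numbers N\<close>

text \<open>The argument list \<open>[(k\<^sub>1, l\<^sub>1), \<dots>, (k\<^sub>n, l\<^sub>n)]\<close> carries the exponents in the order in which they
  occur in the word.\<close>

definition alternating_word :: "(nat \<times> nat) list \<Rightarrow> word" where
  "alternating_word kls = concat (map (\<lambda>(k, l). replicate k Adj @ replicate l Opr) kls)"

definition N_num ::
  "(('h::{real_inner, complete_space} \<Rightarrow> 'h) \<Rightarrow> complex) \<Rightarrow> ('h \<Rightarrow> 'h) \<Rightarrow> (nat \<times> nat) list \<Rightarrow> complex"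
  where
  "N_num \<tau> T kls =
     (let m = sum_list (map fst kls)
      in if m = sum_list (map snd kls) then fact (m + 1) * \<tau> (op_word T (alternating_word kls)) else 0)"

section \<open>Polynomials and formal power series\<close>

text \<open>A monomial is a finitely supported exponent function. Polynomials are finitely supported
  coefficient functions on monomials, formal power series are arbitrary ones; \<^const>\<open>prod_fun\<close>
  is the Cauchy product in both cases.\<close>

datatype var = Z nat | W nat

type_synonym monomial = "var \<Rightarrow>\<^sub>0 nat"
type_synonym polynomial = "monomial \<Rightarrow>\<^sub>0 complex"
type_synonym series = "monomial \<Rightarrow> complex"

definition vars_upto :: "nat \<Rightarrow> var set" where
  "vars_upto n = Z ` {1..n} \<union> W ` {1..n}"

definition poly_vars :: "polynomial \<Rightarrow> var set" where
  "poly_vars P = (\<Union>m\<in>Poly_Mapping.keys P. Poly_Mapping.keys m)"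

definition var_poly :: "var \<Rightarrow> polynomial" where
  "var_poly v = Poly_Mapping.single (Poly_Mapping.single v 1) 1"

definition is_expansion :: "polynomial \<Rightarrow> polynomial \<Rightarrow> series \<Rightarrow> bool" where
  "is_expansion P Q G \<longleftrightarrow> Poly_Mapping.lookup Q 0 \<noteq> 0 \<and> prod_fun (Poly_Mapping.lookup Q) G = Poly_Mapping.lookup P"

lemma prod_fun_lookup:
  fixes Q :: polynomial and G :: series
  shows "prod_fun (Poly_Mapping.lookup Q) G k =
    (\<Sum>a\<in>Poly_Mapping.keys Q. Poly_Mapping.lookup Q a * (if \<exists>b. k = a + b then G (k - a) else 0))"
proof -
  have inner: "(\<Sum>q. (G q when k = a + q)) = (if \<exists>b. k = a + b then G (k - a) else 0)" for a
  proof (cases "\<exists>b. k = a + b")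
    case True
    then obtain b where b: "k = a + b" by blast
    have "(\<lambda>q. (G q when k = a + q)) = (\<lambda>q. (G q when b = q))"
      using b by auto
    then show ?thesis using b by simp
  next
    case False
    then have "(\<lambda>q. (G q when k = a + q)) = (\<lambda>q. 0)" by auto
    then show ?thesis using False by simp
  qed
  show ?thesis
    unfolding prod_fun_def inner
    by (rule Sum_any.expand_superset) (auto simp: in_keys_iff)
qed

definition total_degree :: "monomial \<Rightarrow> nat" where
  "total_degree m = (\<Sum>v\<in>Poly_Mapping.keys m. Poly_Mapping.lookup m v)"

lemma total_degree_add: "total_degree (a + b) = total_degree a + total_degree b"
proof -
  let ?V = "Poly_Mapping.keys a \<union> Poly_Mapping.keys b"
  have "total_degree c = (\<Sum>v\<in>?V. Poly_Mapping.lookup c v)" if "Poly_Mapping.keys c \<subseteq> ?V" for c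
    unfolding total_degree_def using that
    by (intro sum.mono_neutral_left) (auto simp: in_keys_iff)
  moreover have "Poly_Mapping.keys (a + b) \<subseteq> ?V" by (rule keys_add)
  ultimately show ?thesis by (simp add: lookup_add sum.distrib)
qed

lemma total_degree_pos: "a \<noteq> 0 \<Longrightarrow> total_degree a > 0"
  unfolding total_degree_def
  by (intro sum_pos) (auto simp: in_keys_iff)

text \<open>If \<open>Q\<close> has a non-zero constant term then \<open>P / Q\<close> has exactly one power series expansion.\<close>

lemma is_expansion_iff_rec:
  assumes "Poly_Mapping.lookup Q 0 \<noteq> 0"
  shows "is_expansion P Q G \<longleftrightarrow> (\<forall>k. G k =
    (Poly_Mapping.lookup P k - (\<Sum>a\<in>Poly_Mapping.keys Q - {0}.
       Poly_Mapping.lookup Q a * (if \<exists>b. k = a + b then G (k - a) else 0))) / Poly_Mapping.lookup Q 0)"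
proof -
  have "prod_fun (Poly_Mapping.lookup Q) G k = Poly_Mapping.lookup Q 0 * G k +
    (\<Sum>a\<in>Poly_Mapping.keys Q - {0}.
       Poly_Mapping.lookup Q a * (if \<exists>b. k = a + b then G (k - a) else 0))" for k
    unfolding prod_fun_lookup using assms
    by (subst sum.remove[of _ 0]) (auto simp: in_keys_iff)
  then show ?thesis using assms unfolding is_expansion_def fun_eq_iff
    by (auto simp: field_simps)
qed

lemma is_expansion_ex1:
  assumes "Poly_Mapping.lookup Q 0 \<noteq> 0"
  shows "\<exists>!G. is_expansion P Q G"
proof (rule ex_ex1I)
  let ?r = "inv_image less_than total_degree"
  let ?H = "\<lambda>G k. (Poly_Mapping.lookup P k - (\<Sum>a\<in>Poly_Mapping.keys Q - {0}.
       Poly_Mapping.lookup Q a * (if \<exists>b. k = a + b then G (k - a) else 0))) / Poly_Mapping.lookup Q 0"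
  have lt: "total_degree (k - a) < total_degree k" if "k = a + b" "a \<noteq> 0" for a b k
    using that total_degree_pos[of a] by (simp add: total_degree_add)
  have H_cong: "?H G k = ?H G' k" if "\<And>m. total_degree m < total_degree k \<Longrightarrow> G m = G' m" for G G' k
  proof -
    have "(\<Sum>a\<in>Poly_Mapping.keys Q - {0}.
             Poly_Mapping.lookup Q a * (if \<exists>b. k = a + b then G (k - a) else 0)) =
          (\<Sum>a\<in>Poly_Mapping.keys Q - {0}.
             Poly_Mapping.lookup Q a * (if \<exists>b. k = a + b then G' (k - a) else 0))"
    proof (intro sum.cong refl)
      fix a assume "a \<in> Poly_Mapping.keys Q - {0}"
      then have "G (k - a) = G' (k - a)" if "k = a + b" for b
        using lt[OF that] \<open>\<And>m. total_degree m < total_degree k \<Longrightarrow> G m = G' m\<close> by blast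
      then show "Poly_Mapping.lookup Q a * (if \<exists>b. k = a + b then G (k - a) else 0) =
          Poly_Mapping.lookup Q a * (if \<exists>b. k = a + b then G' (k - a) else 0)"
        by auto
    qed
    then show ?thesis by simp
  qed
  have "adm_wf ?r ?H"
    unfolding adm_wf_def by (intro allI impI H_cong) auto
  then have "wfrec ?r ?H k = ?H (wfrec ?r ?H) k" for k
    by (intro wfrec_fixpoint[THEN fun_cong]) auto
  then show "\<exists>G. is_expansion P Q G"
    unfolding is_expansion_iff_rec[OF assms] by blast
  fix G G'
  assume "is_expansion P Q G" "is_expansion P Q G'"
  then have G: "G k = ?H G k" and G': "G' k = ?H G' k" for k
    unfolding is_expansion_iff_rec[OF assms] by blast+
  have "G k = G' k" for k
  proof (induction "total_degree k" arbitrary: k rule: less_induct)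
    case less
    then have "?H G k = ?H G' k" by (intro H_cong)
    then show ?case using G[of k] G'[of k] by metis
  qed
  then show "G = G'" by blast
qed

definition expansion :: "polynomial \<Rightarrow> polynomial \<Rightarrow> series" where
  "expansion P Q = (THE G. is_expansion P Q G)"

definition is_rational :: "nat \<Rightarrow> series \<Rightarrow> bool" where
  "is_rational n F \<longleftrightarrow>
     (\<exists>P Q. poly_vars P \<subseteq> vars_upto n \<and> poly_vars Q \<subseteq> vars_upto n \<and> is_expansion P Q F)"

definition F_series ::
  "(('h::{real_inner, complete_space} \<Rightarrow> 'h) \<Rightarrow> complex) \<Rightarrow> ('h \<Rightarrow> 'h) \<Rightarrow> nat \<Rightarrow> series" where
  "F_series \<tau> T n = (\<lambda>m.
     if Poly_Mapping.keys m \<subseteq> vars_upto n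
     then N_num \<tau> T (map (\<lambda>i. (Poly_Mapping.lookup m (Z i), Poly_Mapping.lookup m (W i))) [1..<Suc n])
     else 0)"

section \<open>The terms\<close>

text \<open>A term is given by the index lists \<open>i\<^sub>1, \<dots>, i\<^sub>k\<close> and \<open>j\<^sub>1, \<dots>, j\<^sub>k\<close> (repetitions allowed) and the
  list of permutations.\<close>

type_synonym ratterm = "nat list \<times> nat list \<times> (nat \<Rightarrow> nat) list"

definition admissible :: "nat \<Rightarrow> ratterm \<Rightarrow> bool" where
  "admissible n = (\<lambda>(is, js, \<sigma>s).
     length \<sigma>s \<in> {2..n} \<and> length is \<in> {0..length \<sigma>s - 1} \<and> length js = length is \<and>
     set is \<subseteq> {1..n} \<and> set js \<subseteq> {1..n} \<and>
     (\<forall>\<sigma>\<in>set \<sigma>s. \<sigma> permutes {1..n}) \<and> distinct \<sigma>s)"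

definition u_poly :: "nat \<Rightarrow> (nat \<Rightarrow> nat) \<Rightarrow> polynomial" where
  "u_poly n \<sigma> = (\<Sum>i=1..n. var_poly (Z i) * var_poly (W (\<sigma> i)))"

definition numerator :: "ratterm \<Rightarrow> polynomial" where
  "numerator = (\<lambda>(is, js, \<sigma>s).
     prod_list (map (\<lambda>i. var_poly (Z i)) is) * prod_list (map (\<lambda>j. var_poly (W j)) js))"

definition denominator :: "nat \<Rightarrow> ratterm \<Rightarrow> polynomial" where
  "denominator n = (\<lambda>(is, js, \<sigma>s). prod_list (map (\<lambda>\<sigma>. 1 - u_poly n \<sigma>) \<sigma>s))"

definition term_series :: "nat \<Rightarrow> ratterm \<Rightarrow> series" where
  "term_series n t = expansion (numerator t) (denominator n t)"

end

theory Submission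
  imports
    Defs
    "HOL-Real_Asymp.Real_Asymp"
    "HOL-Computational_Algebra.Formal_Power_Series"
begin

text \<open>
  A strictly upper triangular matrix \<open>X\<close> of size \<open>d + 1\<close> arises from one of size \<open>d\<close> by adding a zero
  row and a Gaussian column \<open>v\<close> independent of the rest. The trace of a word in \<open>X\<close> and its adjoint
  is a sum over closed index paths. A path that visits the new index is cut by its visits into
  excursions, and each excursion spelling a word \<open>q\<close> in the old indices contributes the quadratic
  form \<open>v* q v\<close> (lemma \<open>tr_Suc\<close>). Integrating out \<open>v\<close> replaces, in leading order, each of these forms by
  the trace of \<open>q\<close>, and expectations of products of traces factorize (\<open>joint_growth\<close>). Summation over
  the dimension shows that the moments converge to numbers \<open>mu p\<close> satisfying
  \<open>(m + 1) mu p = (\<Sum>qs. \<Prod>q. mu q)\<close> for words \<open>p\<close> of length \<open>2 m\<close>, where the sum is over all decompositions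
  \<open>qs\<close> of the cyclic word \<open>p\<close> into excursions (\<open>mu_cuts\<close>, \<open>quasinilpotent_DT_moment\<close>).

  An excursion leaves the new index by the adjoint and returns by the operator itself. In an
  alternating word with variables \<open>z\<^sub>i, w\<^sub>i\<close> it therefore covers a cyclic interval of indices, a block,
  and extracts the variable \<open>z\<close> of the first and \<open>w\<close> of the last index of the block. If a word of
  length \<open>2 m\<close> is weighted by \<open>s ^ (m + 1)\<close>, the recursion becomes a differential equation in \<open>s\<close> for the
  generating function \<open>G\<close> of a list of indices: its derivative is the sum, over all families of disjoint
  blocks, of the products of \<open>z w G\<close> over the blocks (\<open>moment_gf_deriv\<close>). A single index that is a block
  or is skipped contributes the factor \<open>1 + z w G = exp (z w s)\<close> (\<open>loop_gf_single\<close>). The families that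
  consist of one block containing all indices contribute \<open>u G\<close>, where \<open>u = (\<Sum>i. z\<^sub>i w\<^sub>i\<^sub>-\<^sub>1)\<close>, with cyclic
  indices, belongs to an \<open>n\<close>-cycle. All other families are products over at least two blocks.

  Hence \<open>G\<close> is obtained by convolving these products with \<open>exp (u s)\<close>. By induction \<open>G\<close> is a sum of terms,
  each a product of \<open>k\<close> variables \<open>z\<close> and \<open>k\<close> variables \<open>w\<close> with an iterated convolution of exponentials
  \<open>exp (u\<^sub>p s)\<close> for \<open>l = k + 2 \<le> n\<close> distinct permutations (\<open>spanned_moment_gf\<close>). Products of such
  convolutions over disjoint blocks are again sums of such convolutions, indexed by lattice paths
  (\<open>exp_conv_mult\<close>), and the permutations stay distinct since those in the products preserve a block,
  whereas the \<open>n\<close>-cycle does not. The factor \<open>(m + 1)!\<close> in the numbers \<open>N\<close> is the Laplace transform of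
  \<open>s ^ (m + 1)\<close>, which takes the convolution to the product of the \<open>1 / (1 - u\<^sub>p)\<close>.
\<close>

section \<open>Moments of the complex Gaussian distribution\<close>

definition gauss :: "real \<Rightarrow> real measure" where
  "gauss \<sigma> = density lborel (\<lambda>x. ennreal (normal_density 0 \<sigma> x))"

lemma gauss_moment:
  assumes "\<sigma> > 0"
  shows "integrable (gauss \<sigma>) (\<lambda>x. x ^ k)"
    and "(\<integral>x. x ^ k \<partial>gauss \<sigma>) = (if even k then fact k / ((2 / \<sigma>\<^sup>2) ^ (k div 2) * fact (k div 2)) else 0)"
proof -
  have "has_bochner_integral lborel (\<lambda>x. normal_density 0 \<sigma> x * x ^ k)
      (if even k then fact k / ((2 / \<sigma>\<^sup>2) ^ (k div 2) * fact (k div 2)) else 0)"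
  proof (cases "even k")
    case True
    then obtain j where "k = 2 * j" by auto
    then show ?thesis using normal_moment_even[OF assms, of 0 j] by simp
  next
    case False
    then obtain j where "k = 2 * j + 1" using oddE by blast
    then show ?thesis using normal_moment_odd[OF assms, of 0 j] by simp
  qed
  then have *: "has_bochner_integral lborel (\<lambda>x. normal_density 0 \<sigma> x *\<^sub>R x ^ k)
      (if even k then fact k / ((2 / \<sigma>\<^sup>2) ^ (k div 2) * fact (k div 2)) else 0)" by simp
  show "integrable (gauss \<sigma>) (\<lambda>x. x ^ k)"
    unfolding gauss_def
    using * by (subst integrable_density) (auto simp: has_bochner_integral_iff)
  show "(\<integral>x. x ^ k \<partial>gauss \<sigma>) = (if even k then fact k / ((2 / \<sigma>\<^sup>2) ^ (k div 2) * fact (k div 2)) else 0)"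
    unfolding gauss_def
    using * by (subst integral_density) (auto simp: has_bochner_integral_iff)
qed

text \<open>Integration by parts against a centred Gaussian density, read on monomials.\<close>

lemma gauss_moment_rec:
  assumes "\<sigma> > 0"
  shows "(\<integral>x. x ^ Suc k \<partial>gauss \<sigma>) = \<sigma>\<^sup>2 * (real k * (\<integral>x. x ^ (k - 1) \<partial>gauss \<sigma>))"
proof (cases "odd k")
  case True
  then obtain j where k: "k = 2 * j + 1" using oddE by blast
  have f: "fact (Suc (Suc (2 * j))) = 2 * (real j + 1) * ((2 * real j + 1) * fact (2 * j))"
    by (simp add: algebra_simps)
  have "(\<integral>x. x ^ Suc k \<partial>gauss \<sigma>) =
      2 * (real j + 1) * ((2 * real j + 1) * fact (2 * j)) / ((2 / \<sigma>\<^sup>2) ^ Suc j * ((real j + 1) * fact j))"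
    unfolding gauss_moment(2)[OF assms] k by (simp add: f add.commute)
  also have "\<dots> = \<sigma>\<^sup>2 * ((2 * real j + 1) * (fact (2 * j) / ((2 / \<sigma>\<^sup>2) ^ j * fact j)))"
  proof -
    define c where "c = (2 / \<sigma>\<^sup>2) ^ j"
    have "c \<noteq> 0" "real j + 1 \<noteq> 0" using assms by (auto simp: c_def)
    then show ?thesis
      using assms unfolding power_Suc c_def[symmetric] by (simp add: divide_simps)
  qed
  also have "\<dots> = \<sigma>\<^sup>2 * (real k * (\<integral>x. x ^ (k - 1) \<partial>gauss \<sigma>))"
    unfolding gauss_moment(2)[OF assms] k by simp
  finally show ?thesis .
next
  case False
  then show ?thesis
    unfolding gauss_moment(2)[OF assms] by (cases k) auto
qed

lemma prob_space_gauss: "\<sigma> > 0 \<Longrightarrow> prob_space (gauss \<sigma>)"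
  unfolding gauss_def by (rule prob_space_normal_density)

lemma sets_gauss [measurable_cong]: "sets (gauss \<sigma>) = sets borel"
  by (simp add: gauss_def)

lemma gauss_pair_moment:
  assumes "\<sigma> > 0"
  shows "integrable (gauss \<sigma> \<Otimes>\<^sub>M gauss \<sigma>) (\<lambda>(x, y). x ^ p * y ^ q)"
    and "(\<integral>(x, y). x ^ p * y ^ q \<partial>(gauss \<sigma> \<Otimes>\<^sub>M gauss \<sigma>)) = (\<integral>x. x ^ p \<partial>gauss \<sigma>) * (\<integral>x. x ^ q \<partial>gauss \<sigma>)"
proof -
  interpret prob_space "gauss \<sigma>" by (rule prob_space_gauss[OF assms])
  interpret pair_prob_space "gauss \<sigma>" "gauss \<sigma>" by unfold_locales
  show int: "integrable (gauss \<sigma> \<Otimes>\<^sub>M gauss \<sigma>) (\<lambda>(x, y). x ^ p * y ^ q)"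
  proof (rule Fubini_integrable)
    show "(\<lambda>(x, y). x ^ p * y ^ q) \<in> borel_measurable (gauss \<sigma> \<Otimes>\<^sub>M gauss \<sigma>)" by measurable
    have "integrable (gauss \<sigma>) (\<lambda>x. norm (x ^ p) * (\<integral>y. norm (y ^ q) \<partial>gauss \<sigma>))"
      by (intro integrable_mult_left integrable_norm gauss_moment(1) assms)
    then show "integrable (gauss \<sigma>) (\<lambda>x. \<integral>y. norm (case (x, y) of (x, y) \<Rightarrow> x ^ p * y ^ q) \<partial>gauss \<sigma>)"
      by (simp add: abs_mult)
    show "AE x in gauss \<sigma>. integrable (gauss \<sigma>) (\<lambda>y. case (x, y) of (x, y) \<Rightarrow> x ^ p * y ^ q)"
      using gauss_moment(1)[OF assms] by simp
  qed
  have "(\<integral>(x, y). x ^ p * y ^ q \<partial>(gauss \<sigma> \<Otimes>\<^sub>M gauss \<sigma>)) = (\<integral>x. (\<integral>y. x ^ p * y ^ q \<partial>gauss \<sigma>) \<partial>gauss \<sigma>)"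
    using integral_fst[OF int] by simp
  then show "(\<integral>(x, y). x ^ p * y ^ q \<partial>(gauss \<sigma> \<Otimes>\<^sub>M gauss \<sigma>)) = (\<integral>x. x ^ p \<partial>gauss \<sigma>) * (\<integral>x. x ^ q \<partial>gauss \<sigma>)"
    by simp
qed

text \<open>Powers of the real coordinates are carried along with powers of the complex variable and of its
  conjugate, because integration by parts takes place in the real coordinates and has to be stated
  for all products at once to be provable by induction on the number of complex factors.\<close>

definition mixed_mono :: "nat \<Rightarrow> nat \<Rightarrow> nat \<Rightarrow> nat \<Rightarrow> real \<times> real \<Rightarrow> complex" where
  "mixed_mono p q a b = (\<lambda>(x, y). of_real (x ^ p * y ^ q) * Complex x y ^ a * cnj (Complex x y) ^ b)"

lemma mixed_mono_step:
  "mixed_mono p q (Suc a) b = (\<lambda>w. mixed_mono (Suc p) q a b w + \<i> * mixed_mono p (Suc q) a b w)"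
  "mixed_mono p q a (Suc b) = (\<lambda>w. mixed_mono (Suc p) q a b w - \<i> * mixed_mono p (Suc q) a b w)"
  unfolding mixed_mono_def by (auto simp: fun_eq_iff Complex_eq algebra_simps)

text \<open>The linear algebra of the inductive step below and of the passage from the real to the complex
  form of integration by parts, isolated from the integrals.\<close>

lemma combine_parts:
  fixes X :: "'a::comm_ring_1"
  assumes "i * i = -1"
  shows "a * X = a * (Y + i * Q) \<Longrightarrow> S * ((1 + p) * X + a * Y + b * B) + i * (S * (p * P + a * Q + b * B'))
      = S * (p * X + i * (p * P) + (1 + a) * X + b * (B + i * B'))"
    and "a * X = a * (Y + i * Q) \<Longrightarrow> S * (p * P + i * a * Y - i * b * B) + i * (S * ((1 + p) * X
        + i * a * Q - i * b * B'))
      = S * (p * P + i * (p * X) + i * (1 + a) * X - i * b * (B + i * B'))"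
    and "b * X = b * (Y - i * Q) \<Longrightarrow> S * ((1 + p) * X + 0 * V + b * Y) - i * (S * (p * P + 0 * V' + b * Q))
      = S * (p * X - i * (p * P) + 0 * U + (1 + b) * X)"
    and "b * X = b * (Y - i * Q) \<Longrightarrow> S * (p * P + i * 0 * V - i * b * Y) - i * (S * ((1 + p) * X
        + i * 0 * V' - i * b * Q))
      = S * (p * P - i * (p * X) + i * 0 * U - i * (1 + b) * X)"
    and "S * (0 * U + a * X + b * Y) + i * (S * (0 * V + i * a * X - i * b * Y)) = 2 * S * b * Y"
    and "S * (0 * U + a * X + b * Y) - i * (S * (0 * V + i * a * X - i * b * Y)) = 2 * S * a * X"
proof -
  have i: "i * (i * z) = - z" for z :: 'a using assms by (simp flip: mult.assoc)
  show "S * (0 * U + a * X + b * Y) + i * (S * (0 * V + i * a * X - i * b * Y)) = 2 * S * b * Y"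
    and "S * (0 * U + a * X + b * Y) - i * (S * (0 * V + i * a * X - i * b * Y)) = 2 * S * a * X"
    by (simp_all add: algebra_simps i assms)
  { assume h: "a * X = a * (Y + i * Q)"
    show "S * ((1 + p) * X + a * Y + b * B) + i * (S * (p * P + a * Q + b * B'))
      = S * (p * X + i * (p * P) + (1 + a) * X + b * (B + i * B'))"
      using arg_cong[OF h, of "\<lambda>x. S * x"] by (simp add: algebra_simps i assms)
    show "S * (p * P + i * a * Y - i * b * B) + i * (S * ((1 + p) * X + i * a * Q - i * b * B'))
      = S * (p * P + i * (p * X) + i * (1 + a) * X - i * b * (B + i * B'))"
      using arg_cong[OF h, of "\<lambda>x. i * (S * x)"] by (simp add: algebra_simps i assms) }
  { assume h: "b * X = b * (Y - i * Q)"
    show "S * ((1 + p) * X + 0 * V + b * Y) - i * (S * (p * P + 0 * V' + b * Q))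
      = S * (p * X - i * (p * P) + 0 * U + (1 + b) * X)"
      using arg_cong[OF h, of "\<lambda>x. S * x"] by (simp add: algebra_simps i assms)
    show "S * (p * P + i * 0 * V - i * b * Y) - i * (S * ((1 + p) * X + i * 0 * V' - i * b * Q))
      = S * (p * P - i * (p * X) + i * 0 * U - i * (1 + b) * X)"
      using arg_cong[OF h, of "\<lambda>x. i * (S * x)"] by (simp add: algebra_simps i assms) }
qed

context
  fixes \<sigma> :: real
  assumes \<sigma>: "\<sigma> > 0"
begin

lemma integrable_mixed_mono: "integrable (gauss \<sigma> \<Otimes>\<^sub>M gauss \<sigma>) (mixed_mono p q a b)"
proof (induction "a + b" arbitrary: p q a b)
  case 0
  then have eq: "mixed_mono p q a b = (\<lambda>w. of_real (case w of (x, y) \<Rightarrow> x ^ p * y ^ q))"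
    by (auto simp: mixed_mono_def)
  show ?case unfolding eq
    by (rule integrable_of_real) (rule gauss_pair_moment(1)[OF \<sigma>])
next
  case (Suc n)
  show ?case
  proof (cases a)
    case (Suc a')
    then show ?thesis using Suc.hyps
      by (simp add: mixed_mono_step)
  next
    case 0
    then obtain b' where "b = Suc b'" using Suc.hyps by (cases b) auto
    then show ?thesis using Suc.hyps
      by (simp add: mixed_mono_step)
  qed
qed

definition mixed_moment :: "nat \<Rightarrow> nat \<Rightarrow> nat \<Rightarrow> nat \<Rightarrow> complex" where
  "mixed_moment p q a b = (\<integral>w. mixed_mono p q a b w \<partial>(gauss \<sigma> \<Otimes>\<^sub>M gauss \<sigma>))"

lemma mixed_moment_step:
  "mixed_moment p q (Suc a) b = mixed_moment (Suc p) q a b + \<i> * mixed_moment p (Suc q) a b"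
  "mixed_moment p q a (Suc b) = mixed_moment (Suc p) q a b - \<i> * mixed_moment p (Suc q) a b"
  unfolding mixed_moment_def mixed_mono_step using integrable_mixed_mono by simp_all

lemma mixed_moment_real:
  "mixed_moment p q 0 0 = of_real ((\<integral>x. x ^ p \<partial>gauss \<sigma>) * (\<integral>x. x ^ q \<partial>gauss \<sigma>))"
proof -
  have eq: "mixed_mono p q 0 0 = (\<lambda>w. of_real (case w of (x, y) \<Rightarrow> x ^ p * y ^ q))"
    by (auto simp: mixed_mono_def)
  show ?thesis
    unfolding mixed_moment_def eq using gauss_pair_moment(2)[OF \<sigma>, of p q] by (simp only: integral_complex_of_real)
qed

text \<open>Gaussian integration by parts in the real coordinate \<open>x\<close>, by which all three kinds of factors
  \<open>x\<close>, \<open>x + \<i> y\<close> and \<open>x - \<i> y\<close> may be differentiated; \<open>parts_right\<close> below is the same for \<open>y\<close>.\<close>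

definition parts_left :: "nat \<Rightarrow> nat \<Rightarrow> nat \<Rightarrow> nat \<Rightarrow> bool" where
  "parts_left p q a b \<longleftrightarrow> mixed_moment (Suc p) q a b = of_real (\<sigma>\<^sup>2) * (of_nat p * mixed_moment (p - 1) q a b
     + of_nat a * mixed_moment p q (a - 1) b + of_nat b * mixed_moment p q a (b - 1))"

definition parts_right :: "nat \<Rightarrow> nat \<Rightarrow> nat \<Rightarrow> nat \<Rightarrow> bool" where
  "parts_right p q a b \<longleftrightarrow> mixed_moment p (Suc q) a b = of_real (\<sigma>\<^sup>2) * (of_nat q * mixed_moment p (q - 1) a b
     + \<i> * of_nat a * mixed_moment p q (a - 1) b - \<i> * of_nat b * mixed_moment p q a (b - 1))"

text \<open>Trading one complex factor for its real and imaginary part reduces the claim to fewer complex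
  factors; without complex factors it is the one-dimensional moment recursion.\<close>

lemma mixed_moment_parts: "parts_left p q a b \<and> parts_right p q a b"
proof (induction "a + b" arbitrary: p q a b)
  case 0
  then show ?case
    by (simp add: parts_left_def parts_right_def mixed_moment_real
        gauss_moment_rec[OF \<sigma>, of p, simplified] gauss_moment_rec[OF \<sigma>, of q, simplified])
next
  case (Suc n)
  note parts1 = Suc.hyps(1)[THEN conjunct1, unfolded parts_left_def]
  note parts2 = Suc.hyps(1)[THEN conjunct2, unfolded parts_right_def]
  have lower_a: "of_nat a * mixed_moment p q a b = of_nat a * (mixed_moment (Suc p) q (a - 1) b
      + \<i> * mixed_moment p (Suc q) (a - 1) b)"
    for p q a b by (cases a) (simp_all add: mixed_moment_step)
  have lower_b: "of_nat b * mixed_moment p q a b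
      = of_nat b * (mixed_moment (Suc p) q a (b - 1) - \<i> * mixed_moment p (Suc q) a (b - 1))"
    for p q a b by (cases b) (simp_all add: mixed_moment_step)
  have lower_p: "of_nat p * mixed_moment (Suc (p - 1)) q a b = of_nat p * mixed_moment p q a b"
    for p q a b by (cases p) simp_all
  have lower_q: "of_nat q * mixed_moment p (Suc (q - 1)) a b = of_nat q * mixed_moment p q a b"
    for p q a b by (cases q) simp_all
  show ?case
  proof (cases a)
    case (Suc a')
    then have n: "n = a' + b" using Suc.hyps(2) by simp
    have ea: "of_nat a' * mixed_moment p q a' b = of_nat a' * (mixed_moment (Suc p) q (a' - 1) b
        + \<i> * mixed_moment p (Suc q) (a' - 1) b)"
      using lower_a[of a'] by simp
    have eb: "mixed_moment p q a (b - 1) = (mixed_moment (Suc p) q a' (b - 1) + \<i> * mixed_moment p (Suc q) a' (b - 1))"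
      unfolding Suc by (simp add: mixed_moment_step)
    have ep: "of_nat p * mixed_moment (p - 1) q a b = of_nat p * mixed_moment p q a' b
        + \<i> * (of_nat p * mixed_moment (p - 1) (Suc q) a' b)"
      unfolding Suc by (simp add: mixed_moment_step algebra_simps flip: lower_p)
    have eq: "of_nat q * mixed_moment p (q - 1) a b = of_nat q * mixed_moment (Suc p) (q - 1) a' b
        + \<i> * (of_nat q * mixed_moment p q a' b)"
      unfolding Suc by (simp add: mixed_moment_step algebra_simps flip: lower_q)
    have ii: "\<i> * \<i> = -1" by simp
    show ?thesis
    proof
      show "parts_left p q a b"
        unfolding parts_left_def
        unfolding ep eb unfolding Suc mixed_moment_step(1)
        unfolding parts1[OF n, of "Suc p" q] parts1[OF n, of p "Suc q"]
        unfolding of_nat_Suc diff_Suc_1 by (rule combine_parts(1)[OF ii ea])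
      show "parts_right p q a b"
        unfolding parts_right_def
        unfolding eq eb unfolding Suc mixed_moment_step(1)
        unfolding parts2[OF n, of "Suc p" q] parts2[OF n, of p "Suc q"]
        unfolding of_nat_Suc diff_Suc_1 by (rule combine_parts(2)[OF ii ea])
    qed
  next
    case 0
    then obtain b' where b: "b = Suc b'" and n: "n = a + b'" using Suc.hyps(2) by (cases b) auto
    have eb: "of_nat b' * mixed_moment p q a b'
        = of_nat b' * (mixed_moment (Suc p) q a (b' - 1) - \<i> * mixed_moment p (Suc q) a (b' - 1))"
      using lower_b[of b'] by simp
    have ep: "of_nat p * mixed_moment (p - 1) q a b
        = of_nat p * mixed_moment p q a b' - \<i> * (of_nat p * mixed_moment (p - 1) (Suc q) a b')"
      unfolding b by (simp add: mixed_moment_step algebra_simps flip: lower_p)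
    have eq: "of_nat q * mixed_moment p (q - 1) a b
        = of_nat q * mixed_moment (Suc p) (q - 1) a b' - \<i> * (of_nat q * mixed_moment p q a b')"
      unfolding b by (simp add: mixed_moment_step algebra_simps flip: lower_q)
    have ii: "\<i> * \<i> = -1" by simp
    show ?thesis
    proof
      show "parts_left p q a b"
        unfolding parts_left_def
        unfolding ep unfolding b mixed_moment_step(2)
        unfolding parts1[OF n, of "Suc p" q] parts1[OF n, of p "Suc q"]
        unfolding of_nat_Suc diff_Suc_1 0 of_nat_0 by (rule combine_parts(3)[OF ii eb[unfolded 0]])
      show "parts_right p q a b"
        unfolding parts_right_def
        unfolding eq unfolding b mixed_moment_step(2)
        unfolding parts2[OF n, of "Suc p" q] parts2[OF n, of p "Suc q"]
        unfolding of_nat_Suc diff_Suc_1 0 of_nat_0 by (rule combine_parts(4)[OF ii eb[unfolded 0]])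
    qed
  qed
qed

text \<open>Adding \<open>\<i>\<close> times the formula for \<open>y\<close> to the one for \<open>x\<close> makes the derivative of the holomorphic
  factors cancel: multiplication by the variable is dual to differentiation in the conjugate.\<close>

lemma mixed_moment_Suc_left:
  "mixed_moment 0 0 (Suc a) b = 2 * of_real (\<sigma>\<^sup>2) * of_nat b * mixed_moment 0 0 a (b - 1)"
proof -
  have ii: "\<i> * \<i> = -1" by simp
  show ?thesis
    unfolding mixed_moment_step(1) mixed_moment_parts[of 0 0 a b, THEN conjunct1, unfolded parts_left_def]
        mixed_moment_parts[of 0 0 a b, THEN conjunct2, unfolded parts_right_def] of_nat_0
    by (rule combine_parts(5)[OF ii])
qed

lemma mixed_moment_Suc_right:
  "mixed_moment 0 0 a (Suc b) = 2 * of_real (\<sigma>\<^sup>2) * of_nat a * mixed_moment 0 0 (a - 1) b"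
proof -
  have ii: "\<i> * \<i> = -1" by simp
  show ?thesis
    unfolding mixed_moment_step(2) mixed_moment_parts[of 0 0 a b, THEN conjunct1, unfolded parts_left_def]
        mixed_moment_parts[of 0 0 a b, THEN conjunct2, unfolded parts_right_def] of_nat_0
    by (rule combine_parts(6)[OF ii])
qed

lemma mixed_moment_eq:
  "mixed_moment 0 0 a b = (if a = b then fact a * (2 * of_real (\<sigma>\<^sup>2)) ^ a else 0)"
proof (induction a arbitrary: b)
  case 0
  interpret prob_space "gauss \<sigma>" by (rule prob_space_gauss[OF \<sigma>])
  have "mixed_moment 0 0 0 0 = 1" using prob_space by (simp add: mixed_moment_real)
  then show ?case by (cases b) (simp_all add: mixed_moment_Suc_right)
next
  case (Suc a)
  then show ?case by (cases b) (simp_all add: mixed_moment_Suc_left algebra_simps)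
qed

end

lemma complex_gaussian_gauss:
  "complex_gaussian v = distr (gauss (sqrt (v / 2)) \<Otimes>\<^sub>M gauss (sqrt (v / 2))) borel (\<lambda>(x, y). Complex x y)"
  by (simp add: complex_gaussian_def gauss_def Let_def)

lemma borel_measurable_Complex_pair [measurable]:
  "(\<lambda>(x, y). Complex x y) \<in> borel_measurable (gauss \<sigma> \<Otimes>\<^sub>M gauss \<sigma>)"
proof -
  have "(\<lambda>w. complex_of_real (fst w) + \<i> * complex_of_real (snd w)) \<in> borel_measurable (gauss \<sigma> \<Otimes>\<^sub>M gauss \<sigma>)"
    by measurable
  then show ?thesis by (simp add: Complex_eq case_prod_beta)
qed

lemma prob_space_complex_gaussian: "v > 0 \<Longrightarrow> prob_space (complex_gaussian v)"
proof -
  assume "v > 0"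
  then have "sqrt (v / 2) > 0" by simp
  then interpret prob_space "gauss (sqrt (v / 2))" by (rule prob_space_gauss)
  interpret pair_prob_space "gauss (sqrt (v / 2))" "gauss (sqrt (v / 2))" by unfold_locales
  show ?thesis unfolding complex_gaussian_gauss by (rule P.prob_space_distr) measurable
qed

lemma sets_complex_gaussian [measurable_cong]: "sets (complex_gaussian v) = sets borel"
  by (simp add: complex_gaussian_gauss)

lemma complex_gaussian_moment:
  assumes "v > 0"
  shows "integrable (complex_gaussian v) (\<lambda>z. z ^ a * cnj z ^ b)"
    and "(\<integral>z. z ^ a * cnj z ^ b \<partial>complex_gaussian v) = (if a = b then fact a * of_real v ^ a else 0)"
proof -
  let ?s = "sqrt (v / 2)"
  have s: "?s > 0" using assms by simp
  have m: "mixed_mono 0 0 a b = (\<lambda>w. (case w of (x, y) \<Rightarrow> Complex x y) ^ a * cnj (case w of (x, y) \<Rightarrow> Complex x y) ^ b)"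
    by (auto simp: mixed_mono_def)
  have meas: "(\<lambda>z::complex. z ^ a * cnj z ^ b) \<in> borel_measurable borel"
    by (intro borel_measurable_continuous_onI continuous_intros)
  show "integrable (complex_gaussian v) (\<lambda>z. z ^ a * cnj z ^ b)"
    unfolding complex_gaussian_gauss using integrable_mixed_mono[OF s, of 0 0 a b] meas
    by (subst integrable_distr_eq) (auto simp: m)
  have "(\<integral>z. z ^ a * cnj z ^ b \<partial>complex_gaussian v) = mixed_moment ?s 0 0 a b"
    unfolding complex_gaussian_gauss mixed_moment_def[OF s] m using meas
    by (subst integral_distr) auto
  then show "(\<integral>z. z ^ a * cnj z ^ b \<partial>complex_gaussian v) = (if a = b then fact a * of_real v ^ a else 0)"
    using assms by (simp add: mixed_moment_eq[OF s])
qed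

section \<open>Expectations of polynomials in independent Gaussians\<close>

type_synonym entry = "nat \<times> nat"
type_synonym gletter = "entry \<times> bool"

definition gval :: "gletter \<Rightarrow> (entry \<Rightarrow> complex) \<Rightarrow> complex" where
  "gval x t = (if snd x then cnj (t (fst x)) else t (fst x))"

definition gmono :: "gletter list \<Rightarrow> (entry \<Rightarrow> complex) \<Rightarrow> complex" where
  "gmono xs t = (\<Prod>x\<leftarrow>xs. gval x t)"

text \<open>The index set may be infinite. With \<open>UNIV\<close> as index set a single expectation serves all dimensions
  at once, which spares the comparison of the marginals of different matrix sizes.\<close>

definition gauss_law :: "entry set \<Rightarrow> real \<Rightarrow> (entry \<Rightarrow> complex) measure" where
  "gauss_law I v = PiM I (\<lambda>_. complex_gaussian v)"

text \<open>The expectation of a monomial when all entries are independent standard complex Gaussians: an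
  entry and its conjugate have to occur equally often, and then can be paired in factorially many
  ways.\<close>

definition wick :: "gletter list \<Rightarrow> complex" where
  "wick xs = (\<Prod>e\<in>fst ` set xs. if count_list xs (e, False) = count_list xs (e, True)
     then fact (count_list xs (e, False)) else 0)"

lemma gmono_Nil [simp]: "gmono [] t = 1"
  and gmono_Cons [simp]: "gmono (x # xs) t = gval x t * gmono xs t"
  and gmono_append [simp]: "gmono (xs @ ys) t = gmono xs t * gmono ys t"
  by (simp_all add: gmono_def)

lemma wick_superset:
  assumes "finite S" "fst ` set xs \<subseteq> S"
  shows "wick xs = (\<Prod>e\<in>S. if count_list xs (e, False) = count_list xs (e, True)
     then fact (count_list xs (e, False)) else 0)"
  unfolding wick_def
proof (rule prod.mono_neutral_left[OF assms], intro ballI)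
  fix e assume "e \<in> S - fst ` set xs"
  then have "count_list xs (e, b) = 0" for b by (auto simp: count_list_0_iff image_iff)
  then show "(if count_list xs (e, False) = count_list xs (e, True) then fact (count_list xs (e, False)) else 0)
      = (1::complex)"
    by simp
qed

lemma gmono_as_prod:
  assumes "finite S" "fst ` set xs \<subseteq> S"
  shows "gmono xs t = (\<Prod>e\<in>S. t e ^ count_list xs (e, False) * cnj (t e) ^ count_list xs (e, True))"
  using assms(2)
proof (induction xs)
  case Nil
  then show ?case by simp
next
  case (Cons x xs)
  obtain e0 b where x: "x = (e0, b)" by (cases x)
  have "(\<Prod>e\<in>S. t e ^ count_list (x # xs) (e, False) * cnj (t e) ^ count_list (x # xs) (e, True))
      = (\<Prod>e\<in>S. (if e0 = e then gval x t else 1) * (t e ^ count_list xs (e, False) * cnj (t e) ^ count_list xs (e,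
          True)))"
    by (rule prod.cong) (auto simp: x gval_def)
  also have "\<dots> = gval x t * (\<Prod>e\<in>S. t e ^ count_list xs (e, False) * cnj (t e) ^ count_list xs (e, True))"
    using Cons.prems assms(1) by (simp add: prod.distrib prod.delta x)
  finally show ?case using Cons by simp
qed

lemma sum_count_list:
  assumes "finite S" "fst ` set xs \<subseteq> S"
  shows "(\<Sum>e\<in>S. count_list xs (e, False) + count_list xs (e, True)) = length xs"
  using assms(2)
proof (induction xs)
  case (Cons x xs)
  obtain e0 b where x: "x = (e0, b)" by (cases x)
  have "(\<Sum>e\<in>S. count_list (x # xs) (e, False) + count_list (x # xs) (e, True))
     = (\<Sum>e\<in>S. (if e0 = e then 1 else 0) + (count_list xs (e, False) + count_list xs (e, True)))"
    by (rule sum.cong) (auto simp: x)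
  then show ?case using Cons assms(1) by (simp add: sum.distrib x)
qed simp

lemma gmono_expectation:
  assumes v: "v > 0" and I: "fst ` set xs \<subseteq> I"
  shows "integrable (gauss_law I v) (gmono xs)"
    and "(\<integral>t. gmono xs t \<partial>gauss_law I v) = of_real (sqrt v) ^ length xs * wick xs"
proof -
  let ?M = "\<lambda>_::entry. complex_gaussian v"
  let ?S = "fst ` set xs"
  let ?f = "\<lambda>e z. z ^ count_list xs (e, False) * cnj z ^ count_list xs (e, True)"
  interpret product_prob_space ?M I
    using prob_space_complex_gaussian[OF v]
    by (auto intro!: product_prob_spaceI)
  have S: "finite ?S" by simp
  have eq: "gmono xs t = (\<Prod>e\<in>?S. ?f e (restrict t ?S e))" for t
    using gmono_as_prod[OF S order_refl] by simp
  have meas: "(\<lambda>t. restrict t ?S) \<in> measurable (PiM I ?M) (PiM ?S ?M)"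
    using I by (rule measurable_restrict_subset)
  have int1: "integrable (PiM ?S ?M) (\<lambda>t. \<Prod>e\<in>?S. ?f e (t e))"
    by (intro product_integrable_prod S complex_gaussian_moment(1) v)
  have D: "distr (PiM I ?M) (PiM ?S ?M) (\<lambda>t. restrict t ?S) = PiM ?S ?M"
    by (rule distr_PiM_restrict_finite[OF S I])
  have int2: "integrable (distr (PiM I ?M) (PiM ?S ?M) (\<lambda>t. restrict t ?S)) (\<lambda>t. \<Prod>e\<in>?S. ?f e (t e))"
    unfolding D by (rule int1)
  show "integrable (gauss_law I v) (gmono xs)"
    unfolding gauss_law_def eq using integrable_distr[OF meas int2] by simp
  have "(\<integral>t. gmono xs t \<partial>gauss_law I v) = (\<integral>t. (\<Prod>e\<in>?S. ?f e (t e)) \<partial>distr (PiM I ?M) (PiM ?S ?M) (\<lambda>t. restrict t ?S))"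
    unfolding gauss_law_def eq
    using borel_measurable_integrable[OF int1] by (subst integral_distr[OF meas]) auto
  also have "\<dots> = (\<Prod>e\<in>?S. \<integral>z. ?f e z \<partial>complex_gaussian v)"
    unfolding D by (rule product_integral_prod[OF S]) (rule complex_gaussian_moment(1)[OF v])
  also have "\<dots> = (\<Prod>e\<in>?S. of_real (sqrt v) ^ (count_list xs (e, False) + count_list xs (e, True)) *
      (if count_list xs (e, False) = count_list xs (e, True) then fact (count_list xs (e, False)) else 0))"
  proof (rule prod.cong[OF refl])
    fix e
    have "complex_of_real v ^ k = complex_of_real (sqrt v) ^ (k + k)" for k :: nat
    proof -
      have "of_real v ^ k = (complex_of_real (sqrt v * sqrt v)) ^ k" using v by simp
      also have "\<dots> = of_real (sqrt v) ^ (k + k)" by (simp only: of_real_mult power_mult_distrib power_add)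
      finally show ?thesis .
    qed
    then show "(\<integral>z. ?f e z \<partial>complex_gaussian v) = of_real (sqrt v) ^ (count_list xs (e, False)
        + count_list xs (e, True)) *
      (if count_list xs (e, False) = count_list xs (e, True) then fact (count_list xs (e, False)) else 0)"
      unfolding complex_gaussian_moment(2)[OF v] by simp
  qed
  also have "\<dots> = of_real (sqrt v) ^ length xs * wick xs"
    unfolding prod.distrib wick_def power_sum[symmetric] sum_count_list[OF S order_refl] ..
  finally show "(\<integral>t. gmono xs t \<partial>gauss_law I v) = of_real (sqrt v) ^ length xs * wick xs" .
qed

text \<open>A formal representative of a polynomial function of the entries and their conjugates. Working with
  representatives makes the formal derivative, homogeneity and integrability immediate.\<close>

type_synonym gpoly = "(complex \<times> gletter list) list"

definition geval :: "gpoly \<Rightarrow> (entry \<Rightarrow> complex) \<Rightarrow> complex" where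
  "geval cs t = (\<Sum>(c, xs)\<leftarrow>cs. c * gmono xs t)"

primrec gmono_deriv :: "entry \<Rightarrow> gletter list \<Rightarrow> (entry \<Rightarrow> complex) \<Rightarrow> complex" where
  "gmono_deriv a [] t = 0"
| "gmono_deriv a (x # xs) t = (if x = (a, False) then gmono xs t else 0) + gval x t * gmono_deriv a xs t"

definition gderiv :: "entry \<Rightarrow> gpoly \<Rightarrow> (entry \<Rightarrow> complex) \<Rightarrow> complex" where
  "gderiv a cs t = (\<Sum>(c, xs)\<leftarrow>cs. c * gmono_deriv a xs t)"

definition gmult :: "gpoly \<Rightarrow> gpoly \<Rightarrow> gpoly" where
  "gmult cs ds = map (\<lambda>(y, u). (fst y * fst u, snd y @ snd u)) (List.product cs ds)"

lemma gmono_deriv_append: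
  "gmono_deriv a (xs @ ys) t = gmono_deriv a xs t * gmono ys t + gmono xs t * gmono_deriv a ys t"
  by (induction xs) (simp_all add: algebra_simps)

lemma geval_append: "geval (cs @ ds) t = geval cs t + geval ds t"
  and gderiv_append: "gderiv a (cs @ ds) t = gderiv a cs t + gderiv a ds t"
  by (simp_all add: geval_def gderiv_def)

lemma geval_gmult: "geval (gmult cs ds) t = geval cs t * geval ds t"
proof (induction cs)
  case (Cons z cs)
  obtain c xs where z: "z = (c, xs)" by (cases z)
  have "geval (map (\<lambda>(d, ys). (c * d, xs @ ys)) ds) t = c * gmono xs t * geval ds t"
    by (simp add: geval_def comp_def split_def sum_list_const_mult[symmetric] algebra_simps)
  moreover have "gmult (z # cs) ds = map (\<lambda>(d, ys). (c * d, xs @ ys)) ds @ gmult cs ds"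
    by (simp add: gmult_def z split_def comp_def)
  moreover have "geval (z # cs) t = c * gmono xs t + geval cs t"
    by (simp add: geval_def z)
  ultimately show ?case using Cons by (simp add: geval_append algebra_simps)
qed (simp add: gmult_def geval_def)

lemma gderiv_gmult: "gderiv a (gmult cs ds) t = gderiv a cs t * geval ds t + geval cs t * gderiv a ds t"
proof (induction cs)
  case (Cons z cs)
  obtain c xs where z: "z = (c, xs)" by (cases z)
  have "gderiv a (map (\<lambda>(d, ys). (c * d, xs @ ys)) ds) t
      = c * gmono_deriv a xs t * geval ds t + c * gmono xs t * gderiv a ds t"
    by (induction ds) (auto simp add: geval_def gderiv_def gmono_deriv_append algebra_simps)
  moreover have "gmult (z # cs) ds = map (\<lambda>(d, ys). (c * d, xs @ ys)) ds @ gmult cs ds"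
    by (simp add: gmult_def z split_def comp_def)
  moreover have "geval (z # cs) t = c * gmono xs t + geval cs t" "gderiv a (z # cs) t = c * gmono_deriv a xs t
      + gderiv a cs t"
    by (simp_all add: geval_def gderiv_def z)
  ultimately show ?case using Cons by (simp add: gderiv_append algebra_simps)
qed (simp add: gmult_def geval_def gderiv_def)

text \<open>The derivative in the entry \<open>a\<close>, its conjugate being treated as an independent variable. It is a
  relation because it is read off a representative of the function.\<close>

definition has_gderiv :: "entry \<Rightarrow> ((entry \<Rightarrow> complex) \<Rightarrow> complex) \<Rightarrow> ((entry \<Rightarrow> complex) \<Rightarrow> complex) \<Rightarrow> bool" where
  "has_gderiv a f f' \<longleftrightarrow> (\<exists>cs. f = geval cs \<and> f' = gderiv a cs)"

definition is_gpoly :: "((entry \<Rightarrow> complex) \<Rightarrow> complex) \<Rightarrow> bool" where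
  "is_gpoly f \<longleftrightarrow> (\<exists>cs. f = geval cs)"

definition hom_gpoly :: "entry set \<Rightarrow> nat \<Rightarrow> ((entry \<Rightarrow> complex) \<Rightarrow> complex) \<Rightarrow> bool" where
  "hom_gpoly I L f \<longleftrightarrow> (\<exists>cs. f = geval cs \<and> (\<forall>z\<in>set cs. length (snd z) = L \<and> fst ` set (snd z) \<subseteq> I))"

lemma has_gderiv_const: "has_gderiv a (\<lambda>_. c) (\<lambda>_. 0)"
  unfolding has_gderiv_def by (rule exI[of _ "[(c, [])]"]) (simp add: geval_def gderiv_def fun_eq_iff)

lemma has_gderiv_entry: "has_gderiv a (\<lambda>t. t e) (\<lambda>_. if e = a then 1 else 0)"
  unfolding has_gderiv_def by (rule exI[of _ "[(1, [(e, False)])]"]) (simp add: geval_def gderiv_def gval_def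
      fun_eq_iff)

lemma has_gderiv_cnj: "has_gderiv a (\<lambda>t. cnj (t e)) (\<lambda>_. 0)"
  unfolding has_gderiv_def by (rule exI[of _ "[(1, [(e, True)])]"]) (simp add: geval_def gderiv_def gval_def fun_eq_iff)

lemma has_gderiv_add: "has_gderiv a f f' \<Longrightarrow> has_gderiv a g g' \<Longrightarrow> has_gderiv a (\<lambda>t. f t + g t) (\<lambda>t. f' t + g' t)"
  proof -
  assume "has_gderiv a f f'" "has_gderiv a g g'"
  then obtain cs ds where "f = geval cs" "f' = gderiv a cs" "g = geval ds" "g' = gderiv a ds"
    unfolding has_gderiv_def by blast
  then show "has_gderiv a (\<lambda>t. f t + g t) (\<lambda>t. f' t + g' t)"
    unfolding has_gderiv_def by (intro exI[of _ "cs @ ds"]) (simp add: fun_eq_iff geval_append gderiv_append)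
qed

lemma has_gderiv_mult: "has_gderiv a f f' \<Longrightarrow> has_gderiv a g g' \<Longrightarrow>
    has_gderiv a (\<lambda>t. f t * g t) (\<lambda>t. f' t * g t + f t * g' t)"
  proof -
  assume "has_gderiv a f f'" "has_gderiv a g g'"
  then obtain cs ds where "f = geval cs" "f' = gderiv a cs" "g = geval ds" "g' = gderiv a ds"
    unfolding has_gderiv_def by blast
  then show "has_gderiv a (\<lambda>t. f t * g t) (\<lambda>t. f' t * g t + f t * g' t)"
    unfolding has_gderiv_def by (intro exI[of _ "gmult cs ds"]) (simp add: fun_eq_iff geval_gmult gderiv_gmult)
qed

lemma has_gderiv_sum: "(\<And>x. x \<in> A \<Longrightarrow> has_gderiv a (f x) (f' x)) \<Longrightarrow>
    has_gderiv a (\<lambda>t. \<Sum>x\<in>A. f x t) (\<lambda>t. \<Sum>x\<in>A. f' x t)"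
  by (induction A rule: infinite_finite_induct) (simp_all add: has_gderiv_const has_gderiv_add)

lemma is_gpoly_const: "is_gpoly (\<lambda>_. c)"
  and is_gpoly_entry: "is_gpoly (\<lambda>t. t e)"
  and is_gpoly_cnj: "is_gpoly (\<lambda>t. cnj (t e))"
  using has_gderiv_const has_gderiv_entry has_gderiv_cnj unfolding has_gderiv_def is_gpoly_def by blast+

lemma is_gpoly_add: "is_gpoly f \<Longrightarrow> is_gpoly g \<Longrightarrow> is_gpoly (\<lambda>t. f t + g t)"
proof -
  assume "is_gpoly f" "is_gpoly g"
  then obtain cs ds where "f = geval cs" "g = geval ds" unfolding is_gpoly_def by blast
  then show "is_gpoly (\<lambda>t. f t + g t)"
    unfolding is_gpoly_def by (intro exI[of _ "cs @ ds"]) (simp add: fun_eq_iff geval_append)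
qed

lemma is_gpoly_mult: "is_gpoly f \<Longrightarrow> is_gpoly g \<Longrightarrow> is_gpoly (\<lambda>t. f t * g t)"
proof -
  assume "is_gpoly f" "is_gpoly g"
  then obtain cs ds where "f = geval cs" "g = geval ds" unfolding is_gpoly_def by blast
  then show "is_gpoly (\<lambda>t. f t * g t)"
    unfolding is_gpoly_def by (intro exI[of _ "gmult cs ds"]) (simp add: fun_eq_iff geval_gmult)
qed

lemma is_gpoly_sum: "(\<And>x. x \<in> A \<Longrightarrow> is_gpoly (f x)) \<Longrightarrow> is_gpoly (\<lambda>t. \<Sum>x\<in>A. f x t)"
  by (induction A rule: infinite_finite_induct) (simp_all add: is_gpoly_const is_gpoly_add)

lemma is_gpoly_sum_list: "(\<And>x. x \<in> set xs \<Longrightarrow> is_gpoly (f x)) \<Longrightarrow> is_gpoly (\<lambda>t. \<Sum>x\<leftarrow>xs. f x t)"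
  by (induction xs) (simp_all add: is_gpoly_const is_gpoly_add)

lemma is_gpoly_prod_list: "(\<And>x. x \<in> set xs \<Longrightarrow> is_gpoly (f x)) \<Longrightarrow> is_gpoly (\<lambda>t. \<Prod>x\<leftarrow>xs. f x t)"
  by (induction xs) (simp_all add: is_gpoly_const is_gpoly_mult)

lemma hom_gpoly_const: "hom_gpoly I 0 (\<lambda>_. c)"
  unfolding hom_gpoly_def by (rule exI[of _ "[(c, [])]"]) (simp add: geval_def fun_eq_iff)

lemma hom_gpoly_zero: "hom_gpoly I L (\<lambda>_. 0)"
  unfolding hom_gpoly_def by (rule exI[of _ "[]"]) (simp add: geval_def fun_eq_iff)

lemma hom_gpoly_entry: "e \<in> I \<Longrightarrow> hom_gpoly I 1 (\<lambda>t. t e)"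
  unfolding hom_gpoly_def by (rule exI[of _ "[(1, [(e, False)])]"]) (simp add: geval_def gval_def fun_eq_iff)

lemma hom_gpoly_cnj: "e \<in> I \<Longrightarrow> hom_gpoly I 1 (\<lambda>t. cnj (t e))"
  unfolding hom_gpoly_def by (rule exI[of _ "[(1, [(e, True)])]"]) (simp add: geval_def gval_def fun_eq_iff)

lemma hom_gpoly_add: 
  assumes "hom_gpoly I L f" "hom_gpoly I L g" shows "hom_gpoly I L (\<lambda>t. f t + g t)"
proof -
  obtain cs where cs: "f = geval cs" "\<forall>z\<in>set cs. length (snd z) = L \<and> fst ` set (snd z) \<subseteq> I"
    using assms(1) unfolding hom_gpoly_def by blast
  obtain ds where ds: "g = geval ds" "\<forall>z\<in>set ds. length (snd z) = L \<and> fst ` set (snd z) \<subseteq> I"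
    using assms(2) unfolding hom_gpoly_def by blast
  show ?thesis unfolding hom_gpoly_def
    by (rule exI[of _ "cs @ ds"]) (use cs ds in \<open>auto simp: geval_append\<close>)
qed

lemma hom_gpoly_mult:
  assumes "hom_gpoly I L f" "hom_gpoly I L' g" shows "hom_gpoly I (L + L') (\<lambda>t. f t * g t)"
proof -
  obtain cs where cs: "f = geval cs" "\<forall>z\<in>set cs. length (snd z) = L \<and> fst ` set (snd z) \<subseteq> I"
    using assms(1) unfolding hom_gpoly_def by blast
  obtain ds where ds: "g = geval ds" "\<forall>z\<in>set ds. length (snd z) = L' \<and> fst ` set (snd z) \<subseteq> I"
    using assms(2) unfolding hom_gpoly_def by blast
  have "set (gmult cs ds) = (\<lambda>(y, u). (fst y * fst u, snd y @ snd u)) ` (set cs \<times> set ds)"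
    unfolding gmult_def by simp
  then have "\<forall>z\<in>set (gmult cs ds). length (snd z) = L + L' \<and> fst ` set (snd z) \<subseteq> I"
    using cs(2) ds(2) by (auto simp: image_Un)
  then show ?thesis unfolding hom_gpoly_def
    by (intro exI[of _ "gmult cs ds"]) (simp add: cs ds geval_gmult fun_eq_iff)
qed

lemma hom_gpoly_sum: "(\<And>x. x \<in> A \<Longrightarrow> hom_gpoly I L (f x)) \<Longrightarrow> hom_gpoly I L (\<lambda>t. \<Sum>x\<in>A. f x t)"
  by (induction A rule: infinite_finite_induct) (simp_all add: hom_gpoly_zero hom_gpoly_add)

lemma hom_gpoly_is_gpoly: "hom_gpoly I L f \<Longrightarrow> is_gpoly f"
  unfolding hom_gpoly_def is_gpoly_def by blast

lemma hom_gpoly_has_gderiv: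
  assumes "hom_gpoly I L f" "a \<notin> I"
  shows "has_gderiv a f (\<lambda>_. 0)"
proof -
  obtain cs where cs: "f = geval cs" "\<forall>z\<in>set cs. length (snd z) = L \<and> fst ` set (snd z) \<subseteq> I"
    using assms(1) unfolding hom_gpoly_def by blast
  have "gmono_deriv a xs t = 0" if "fst ` set xs \<subseteq> I" for xs t
    using that assms(2) by (induction xs) auto
  then have "gderiv a cs = (\<lambda>_. 0)"
    using cs(2) by (induction cs) (auto simp: gderiv_def fun_eq_iff)
  then show ?thesis using cs(1) unfolding has_gderiv_def by auto
qed

definition gexp :: "((entry \<Rightarrow> complex) \<Rightarrow> complex) \<Rightarrow> complex" where
  "gexp f = (\<integral>t. f t \<partial>gauss_law UNIV 1)"

lemma integrable_geval:
  assumes "v > 0" "\<forall>z\<in>set cs. fst ` set (snd z) \<subseteq> I"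
  shows "integrable (gauss_law I v) (geval cs)"
    and "(\<integral>t. geval cs t \<partial>gauss_law I v) = (\<Sum>(c, xs)\<leftarrow>cs. c * (of_real (sqrt v) ^ length xs * wick xs))"
proof -
  have "integrable (gauss_law I v) (geval cs) \<and>
     (\<integral>t. geval cs t \<partial>gauss_law I v) = (\<Sum>(c, xs)\<leftarrow>cs. c * (of_real (sqrt v) ^ length xs * wick xs))"
    using assms(2)
  proof (induction cs)
    case Nil
    then show ?case by (simp add: geval_def)
  next
    case (Cons z cs)
    obtain c xs where z: "z = (c, xs)" by (cases z)
    have "geval (z # cs) = (\<lambda>t. c * gmono xs t + geval cs t)"
      by (simp add: geval_def z fun_eq_iff)
    moreover have "fst ` set xs \<subseteq> I" using Cons.prems z by simp
    ultimately show ?case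
      using Cons gmono_expectation[OF assms(1), of xs I] by (simp add: z)
  qed
  then show "integrable (gauss_law I v) (geval cs)"
    and "(\<integral>t. geval cs t \<partial>gauss_law I v) = (\<Sum>(c, xs)\<leftarrow>cs. c * (of_real (sqrt v) ^ length xs * wick xs))"
    by auto
qed

lemma gexp_geval: "gexp (geval cs) = (\<Sum>(c, xs)\<leftarrow>cs. c * wick xs)"
  unfolding gexp_def by (subst integrable_geval(2)) auto

lemma gexp_add: "is_gpoly f \<Longrightarrow> is_gpoly g \<Longrightarrow> gexp (\<lambda>t. f t + g t) = gexp f + gexp g"
  unfolding is_gpoly_def gexp_def
  by (elim exE, hypsubst, intro Bochner_Integration.integral_add integrable_geval(1)) auto

lemma gexp_sum: "(\<And>x. x \<in> A \<Longrightarrow> is_gpoly (f x)) \<Longrightarrow> gexp (\<lambda>t. \<Sum>x\<in>A. f x t) = (\<Sum>x\<in>A. gexp (f x))"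
  by (induction A rule: infinite_finite_induct) (simp_all add: gexp_add is_gpoly_sum, simp_all add: gexp_def)

lemma gexp_sum_list: "(\<And>x. x \<in> set xs \<Longrightarrow> is_gpoly (f x)) \<Longrightarrow> gexp (\<lambda>t. \<Sum>x\<leftarrow>xs. f x t) = (\<Sum>x\<leftarrow>xs. gexp (f x))"
  by (induction xs) (simp_all add: gexp_add is_gpoly_sum_list, simp_all add: gexp_def)

lemma gexp_one: "gexp (\<lambda>_. 1) = 1"
proof -
  have "geval [(1, [])] = (\<lambda>_. 1)" by (simp add: geval_def fun_eq_iff)
  then show ?thesis using gexp_geval[of "[(1, [])]"] by (simp add: wick_def)
qed

text \<open>Scaling the variance of all entries by \<open>v\<close> multiplies a monomial of degree \<open>L\<close> by the \<open>L\<close>-th power of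
  \<open>sqrt v\<close>, since the monomials with unequally many conjugated and unconjugated factors vanish.\<close>

lemma hom_gpoly_expectation:
  assumes "v > 0" "hom_gpoly I L f"
  shows "(\<integral>t. f t \<partial>gauss_law I v) = of_real (sqrt v) ^ L * gexp f"
proof -
  obtain cs where cs: "f = geval cs" "\<forall>z\<in>set cs. length (snd z) = L \<and> fst ` set (snd z) \<subseteq> I"
    using assms(2) unfolding hom_gpoly_def by blast
  have "(\<integral>t. f t \<partial>gauss_law I v) = (\<Sum>(c, xs)\<leftarrow>cs. c * (of_real (sqrt v) ^ length xs * wick xs))"
    unfolding cs(1) using cs(2) by (intro integrable_geval(2) assms) auto
  also have "\<dots> = (\<Sum>(c, xs)\<leftarrow>cs. of_real (sqrt v) ^ L * (c * wick xs))"
    using cs(2) by (intro arg_cong[where f = sum_list] map_cong) auto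
  also have "\<dots> = of_real (sqrt v) ^ L * gexp f"
    unfolding cs(1) gexp_geval by (simp add: sum_list_const_mult split_def)
  finally show ?thesis .
qed

lemma gmono_deriv_eq:
  "gmono_deriv a xs t = of_nat (count_list xs (a, False)) * gmono (remove1 (a, False) xs) t"
proof (induction xs)
  case (Cons x xs)
  have "(a, False) \<in> set xs \<Longrightarrow> gmono xs t = t a * gmono (remove1 (a, False) xs) t"
    by (induction xs) (auto simp: gval_def)
  then show ?case using Cons
    by (cases "(a, False) \<in> set xs") (auto simp: gval_def algebra_simps count_list_0_iff)
qed simp

text \<open>A conjugated entry is paired with one of the equal unconjugated entries.\<close>

lemma wick_stein:
  "wick ((a, True) # xs) = of_nat (count_list xs (a, False)) * wick (remove1 (a, False) xs)"
proof -
  let ?S = "insert a (fst ` set xs)"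
  let ?h = "\<lambda>ys e. if count_list ys (e, False)
      = count_list ys (e, True) then fact (count_list ys (e, False)) else (0::complex)"
  have cnt: "count_list (remove1 z xs) y = (if y = z then count_list xs y - 1 else count_list xs y)" for z y :: gletter
    by (induction xs) auto
  have w: "wick ys = ?h ys a * (\<Prod>e\<in>?S - {a}. ?h ys e)" if "fst ` set ys \<subseteq> ?S" for ys
    unfolding wick_superset[of ?S, OF _ that, simplified] by (rule prod.remove) auto
  have 1: "wick ((a, True) # xs) = ?h ((a, True) # xs) a * (\<Prod>e\<in>?S - {a}. ?h ((a, True) # xs) e)"
    by (rule w) auto
  have 2: "wick (remove1 (a, False) xs) = ?h (remove1 (a, False) xs) a * (\<Prod>e\<in>?S - {a}. ?h (remove1 (a, False) xs) e)"
    by (rule w) (use set_remove1_subset[of "(a, False)" xs] in auto)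
  have 3: "(\<Prod>e\<in>?S - {a}. ?h ((a, True) # xs) e) = (\<Prod>e\<in>?S - {a}. ?h (remove1 (a, False) xs) e)"
    by (rule prod.cong) (auto simp: cnt)
  have 4: "?h ((a, True) # xs) a = of_nat (count_list xs (a, False)) * ?h (remove1 (a, False) xs) a"
    by (cases "count_list xs (a, False)") (auto simp: cnt)
  show ?thesis unfolding 1 2 3 4 by (simp add: mult.assoc)
qed

text \<open>The complex form of Gaussian integration by parts.\<close>

lemma gexp_stein:
  assumes "has_gderiv a f f'"
  shows "gexp (\<lambda>t. cnj (t a) * f t) = gexp f'" and "is_gpoly f'"
proof -
  obtain cs where cs: "f = geval cs" "f' = gderiv a cs"
    using assms unfolding has_gderiv_def by blast
  define ds where "ds = map (\<lambda>(c, xs). (c * of_nat (count_list xs (a, False)), remove1 (a, False) xs)) cs"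
  have f': "f' = geval ds"
    unfolding cs(2) ds_def geval_def gderiv_def
    by (simp add: fun_eq_iff comp_def split_def gmono_deriv_eq mult.assoc)
  then show "is_gpoly f'" unfolding is_gpoly_def by blast
  have "(\<lambda>t. cnj (t a) * f t) = geval (map (\<lambda>(c, xs). (c, (a, True) # xs)) cs)"
    unfolding cs(1) by (induction cs) (auto simp: geval_def fun_eq_iff gval_def algebra_simps)
  then show "gexp (\<lambda>t. cnj (t a) * f t) = gexp f'"
    unfolding f' by (simp add: gexp_geval ds_def comp_def split_def wick_stein mult.assoc)
qed

lemma has_gderiv_is_gpoly: "has_gderiv a f f' \<Longrightarrow> is_gpoly f"
  unfolding has_gderiv_def is_gpoly_def by blast

section \<open>Adding one row and one column\<close>

lemma sum_list_map_concat: "(\<Sum>x\<leftarrow>concat xss. f x) = (\<Sum>xs\<leftarrow>xss. \<Sum>x\<leftarrow>xs. f x)"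
  for f :: "'b \<Rightarrow> 'a::comm_monoid_add"
  by (induction xss) simp_all

lemma sum_mult_sum_list:
  fixes f :: "'b \<Rightarrow> 'a::comm_semiring_0"
  shows "(\<Sum>z\<in>A. f z * (\<Sum>(a, b)\<leftarrow>ss. g a z * h b)) = (\<Sum>(a, b)\<leftarrow>ss. (\<Sum>z\<in>A. f z * g a z) * h b)"
  by (induction ss) (auto simp: algebra_simps sum.distrib sum_distrib_left sum_distrib_right)

text \<open>The entries of the strictly upper triangular matrix and of its adjoint, without mentioning the
  dimension; \<open>path\<close> below gives the entries of the product spelled by a word, as a sum over index
  paths.\<close>

definition entry_factor :: "letter \<Rightarrow> nat \<Rightarrow> nat \<Rightarrow> (entry \<Rightarrow> complex) \<Rightarrow> complex" where
  "entry_factor c x z t = (case c of Opr \<Rightarrow> if x < z then t (x, z) else 0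
                           | Adj \<Rightarrow> if z < x then cnj (t (z, x)) else 0)"

primrec path :: "nat \<Rightarrow> word \<Rightarrow> nat \<Rightarrow> nat \<Rightarrow> (entry \<Rightarrow> complex) \<Rightarrow> complex" where
  "path d [] x y t = (if x = y then 1 else 0)"
| "path d (c # p) x y t = (\<Sum>z<d. entry_factor c x z t * path d p z y t)"

definition tr :: "nat \<Rightarrow> word \<Rightarrow> (entry \<Rightarrow> complex) \<Rightarrow> complex" where
  "tr d p t = (\<Sum>x<d. path d p x x t)"

lemma path_append:
  "x < d \<Longrightarrow> path d (p @ q) x y t = (\<Sum>z<d. path d p x z t * path d q z y t)"
proof (induction p arbitrary: x)
  case Nil
  then have "(\<Sum>z<d. path d [] x z t * path d q z y t) = (\<Sum>z<d. if x = z then path d q z y t else 0)"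
    by (intro sum.cong) auto
  then show ?case using Nil by simp
next
  case (Cons c p)
  have "path d ((c # p) @ q) x y t = (\<Sum>w<d. \<Sum>z<d. entry_factor c x w t * (path d p w z t * path d q z y t))"
    using Cons.IH by (simp add: sum_distrib_left)
  also have "\<dots> = (\<Sum>z<d. \<Sum>w<d. entry_factor c x w t * (path d p w z t * path d q z y t))"
    by (rule sum.swap)
  finally show ?case by (simp add: sum_distrib_right mult.assoc)
qed

lemma tr_append: "tr d (p @ q) t = (\<Sum>x<d. \<Sum>z<d. path d p x z t * path d q z x t)"
  unfolding tr_def by (intro sum.cong) (auto simp: path_append)

lemma tr_rotate: "tr d (p @ q) t = tr d (q @ p) t"
  unfolding tr_append by (subst sum.swap) (simp add: mult.commute)

lemma mat_word_path:
  "mat_word d (triangular_mat d t) p \<in> carrier_mat d d \<and>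
   (\<forall>x<d. \<forall>y<d. mat_word d (triangular_mat d t) p $$ (x, y) = path d p x y t)"
proof (induction p)
  case Nil
  then show ?case by simp
next
  case (Cons c p)
  define X where "X = (case c of Adj \<Rightarrow> mat_adjoint (triangular_mat d t) | Opr \<Rightarrow> triangular_mat d t)"
  let ?P = "mat_word d (triangular_mat d t) p"
  have X: "X \<in> carrier_mat d d" "\<And>x z. x < d \<Longrightarrow> z < d \<Longrightarrow> X $$ (x, z) = entry_factor c x z t"
    by (auto simp: X_def triangular_mat_def entry_factor_def mat_adjoint_def mat_of_rows_def split: letter.splits)
  have P: "?P \<in> carrier_mat d d" "\<And>x y. x < d \<Longrightarrow> y < d \<Longrightarrow> ?P $$ (x, y) = path d p x y t"
    using Cons by auto
  have "(X * ?P) $$ (x, y) = path d (c # p) x y t" if "x < d" "y < d" for x y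
    using X P that carrier_matD[OF X(1)] carrier_matD[OF P(1)]
    by (simp add: scalar_prod_def lessThan_atLeast0)
  moreover have "X * ?P \<in> carrier_mat d d" using X(1) P(1) by auto
  ultimately show ?case by (simp add: X_def)
qed

lemma mat_trace_tr: "mat_trace (mat_word d (triangular_mat d t) p) = tr d p t"
  using mat_word_path[of d t p] unfolding mat_trace_def tr_def by auto

definition col_path :: "nat \<Rightarrow> word \<Rightarrow> nat \<Rightarrow> (entry \<Rightarrow> complex) \<Rightarrow> complex" where
  "col_path d q x t = (\<Sum>y<d. path d q x y t * t (y, d))"

text \<open>The column added in dimension \<open>Suc d\<close> consists of the entries \<open>t (x, d)\<close>. The three functions here are
  a matrix product in dimension \<open>d\<close> multiplied by that column on the right, by its adjoint on the
  left, and by both.\<close>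

definition row_path :: "nat \<Rightarrow> word \<Rightarrow> nat \<Rightarrow> (entry \<Rightarrow> complex) \<Rightarrow> complex" where
  "row_path d q y t = (\<Sum>x<d. cnj (t (x, d)) * path d q x y t)"

definition quad :: "nat \<Rightarrow> word \<Rightarrow> (entry \<Rightarrow> complex) \<Rightarrow> complex" where
  "quad d q t = (\<Sum>x<d. cnj (t (x, d)) * col_path d q x t)"

definition quads :: "nat \<Rightarrow> word list \<Rightarrow> (entry \<Rightarrow> complex) \<Rightarrow> complex" where
  "quads d qs t = (\<Prod>q\<leftarrow>qs. quad d q t)"

lemma quads_simps [simp]: "quads d [] t = 1" "quads d (q # qs) t = quad d q t * quads d qs t"
  "quads d (qs @ qs') t = quads d qs t * quads d qs' t"
  by (simp_all add: quads_def)

lemma quad_append: "quad d (p @ q) t = (\<Sum>x<d. row_path d p x t * col_path d q x t)"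
proof -
  have "quad d (p @ q) t = (\<Sum>z<d. \<Sum>y<d. \<Sum>x<d. cnj (t (z, d)) * (path d p z x t * (path d q x y t * t (y, d))))"
    unfolding quad_def col_path_def
    by (intro sum.cong refl) (simp add: path_append sum_distrib_left sum_distrib_right mult.assoc)
  also have "\<dots> = (\<Sum>z<d. \<Sum>x<d. \<Sum>y<d. cnj (t (z, d)) * (path d p z x t * (path d q x y t * t (y, d))))"
    by (intro sum.cong refl sum.swap)
  also have "\<dots> = (\<Sum>x<d. \<Sum>z<d. \<Sum>y<d. cnj (t (z, d)) * (path d p z x t * (path d q x y t * t (y, d))))"
    by (rule sum.swap)
  also have "\<dots> = (\<Sum>x<d. row_path d p x t * col_path d q x t)"
    unfolding row_path_def col_path_def by (simp add: sum_product mult.assoc)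
  finally show ?thesis .
qed

text \<open>All ways of cutting a word at an occurrence of a given letter, which is dropped.\<close>

primrec splits :: "letter \<Rightarrow> word \<Rightarrow> (word \<times> word) list" where
  "splits c [] = []"
| "splits c (x # p) = (if x = c then [([], p)] else []) @ map (\<lambda>(a, b). (x # a, b)) (splits c p)"

lemma splits_eq: "(a, b) \<in> set (splits c p) \<Longrightarrow> p = a @ c # b"
  by (induction p arbitrary: a) (auto split: if_splits)

lemma splits_length: "(a, b) \<in> set (splits c p) \<Longrightarrow> length p = Suc (length a + length b)"
  by (drule splits_eq) simp

text \<open>Decompositions of a path that starts and ends at the new, largest index. The new row of the strictly
  upper triangular matrix is zero, so the new index can be left only by an \<open>Adj\<close> and entered only by
  an \<open>Opr\<close>; the lists contain the words spelled between two consecutive visits.\<close>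

function loops :: "word \<Rightarrow> word list list" where
  "loops [] = [[]]"
| "loops (Opr # p) = []"
| "loops (Adj # p) = concat (map (\<lambda>(a, b). map (\<lambda>qs. a # qs) (loops b)) (splits Opr p))"
  by pat_completeness auto
termination by (relation "Wellfounded.measure length") (auto dest!: splits_length)

text \<open>Decompositions of a path that starts at the new index and ends at an old one: the excursions
  between visits together with the word spelled after the last visit.\<close>

function exits :: "word \<Rightarrow> (word list \<times> word) list" where
  "exits [] = []"
| "exits (Opr # p) = []"
| "exits (Adj # p) = ([], p) # concat (map (\<lambda>(a, b). map (\<lambda>(qs, e). (a # qs, e)) (exits b)) (splits Opr p))"
  by pat_completeness auto
termination by (relation "Wellfounded.measure length") (auto dest!: splits_length)

text \<open>The decompositions of a closed path that visits the new index. If the base point of the path is an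
  old index, then the part before the first visit and the part after the last one are joined
  cyclically into one word.\<close>

definition cuts :: "word \<Rightarrow> word list list" where
  "cuts p = loops p @ concat (map (\<lambda>(a, b). map (\<lambda>(qs, e). (e @ a) # qs) (exits b)) (splits Opr p))"

text \<open>A trace or quadratic form of a word of length \<open>k\<close> grows like the \<open>(k + 2)\<close>-th power of the square
  root of the dimension. Every operation of the recursion lowers the weight of the words that it
  affects or preserves it, and the asymptotics are proved by induction on the weight.\<close>

definition weight :: "word list \<Rightarrow> nat" where
  "weight ps = (\<Sum>p\<leftarrow>ps. length p + 2)"

lemma weight_simps [simp]: "weight [] = 0" "weight (p # ps) = length p + 2 + weight ps"
  "weight (ps @ ps') = weight ps + weight ps'"
  by (simp_all add: weight_def)

lemma weight_loops: "qs \<in> set (loops p) \<Longrightarrow> weight qs = length p"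
  by (induction p arbitrary: qs rule: loops.induct) (fastforce dest: splits_length)+

lemma weight_exits: "(qs, e) \<in> set (exits p) \<Longrightarrow> Suc (weight qs + length e) = length p"
  by (induction p arbitrary: qs rule: exits.induct) (fastforce dest: splits_length)+

lemma weight_cuts: "qs \<in> set (cuts p) \<Longrightarrow> weight qs = length p"
  unfolding cuts_def by (auto dest!: weight_loops weight_exits splits_length)

lemma member_weight: "q \<in> set qs \<Longrightarrow> length q + 2 \<le> weight qs"
  by (induction qs) auto

text \<open>Decomposition at the first visit to the new index.\<close>

lemma path_first_visit:
  assumes "x < d" "y \<le> d"
  shows "path (Suc d) p x y t = (if y < d then path d p x y t else 0)
     + (\<Sum>(a, b)\<leftarrow>splits Opr p. col_path d a x t * path (Suc d) b d y t)"
  using assms(1)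
proof (induction p arbitrary: x)
  case Nil
  then show ?case using assms(2) by auto
next
  case (Cons c p)
  have v: "col_path d (c # a) x t = (\<Sum>z<d. entry_factor c x z t * col_path d a z t)" for a
    unfolding col_path_def by (simp add: sum_distrib_left sum_distrib_right mult.assoc) (rule sum.swap)
  have e: "col_path d [] x t = t (x, d)"
  proof -
    have "col_path d [] x t = (\<Sum>y<d. if x = y then t (y, d) else 0)"
      unfolding col_path_def by (rule sum.cong) auto
    then show ?thesis using Cons.prems by simp
  qed
  have "path (Suc d) (c # p) x y t = (\<Sum>z<d. entry_factor c x z t * path (Suc d) p z y t)
      + entry_factor c x d t * path (Suc d) p d y t"
    by simp
  also have "(\<Sum>z<d. entry_factor c x z t * path (Suc d) p z y t)
      = (\<Sum>z<d. entry_factor c x z t * (if y < d then path d p z y t else 0))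
        + (\<Sum>z<d. entry_factor c x z t * (\<Sum>(a, b)\<leftarrow>splits Opr p. col_path d a z t * path (Suc d) b d y t))"
    unfolding sum.distrib[symmetric] distrib_left[symmetric] by (intro sum.cong refl) (simp add: Cons.IH)
  also have "(\<Sum>z<d. entry_factor c x z t * (if y < d then path d p z y t else 0))
      = (if y < d then path d (c # p) x y t else 0)"
    by simp
  also have "(\<Sum>z<d. entry_factor c x z t * (\<Sum>(a, b)\<leftarrow>splits Opr p. col_path d a z t * path (Suc d) b d y t))
      = (\<Sum>(a, b)\<leftarrow>splits Opr p. col_path d (c # a) x t * path (Suc d) b d y t)"
    unfolding v by (rule sum_mult_sum_list)
  also have "entry_factor c x d t = (if c = Opr then t (x, d) else 0)"
    using Cons.prems by (cases c) (auto simp: entry_factor_def)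
  finally show ?case
    by (simp add: e comp_def split_def)
qed

lemma path_last_Opr: "path (Suc d) (Opr # p) d y t = 0"
  by (simp add: entry_factor_def)

lemma path_last_Adj:
  assumes "y \<le> d"
  shows "path (Suc d) (Adj # p) d y t = (if y < d then row_path d p y t else 0)
     + (\<Sum>(a, b)\<leftarrow>splits Opr p. quad d a t * path (Suc d) b d y t)"
proof -
  have "path (Suc d) (Adj # p) d y t = (\<Sum>z<d. cnj (t (z, d)) * path (Suc d) p z y t)"
    by (simp add: entry_factor_def)
  also have "\<dots> = (\<Sum>z<d. cnj (t (z, d)) * (if y < d then path d p z y t else 0))
        + (\<Sum>z<d. cnj (t (z, d)) * (\<Sum>(a, b)\<leftarrow>splits Opr p. col_path d a z t * path (Suc d) b d y t))"
    unfolding sum.distrib[symmetric] distrib_left[symmetric]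
    by (intro sum.cong refl) (simp add: path_first_visit assms)
  also have "\<dots> = (if y < d then row_path d p y t else 0)
     + (\<Sum>(a, b)\<leftarrow>splits Opr p. quad d a t * path (Suc d) b d y t)"
    unfolding sum_mult_sum_list row_path_def quad_def by simp
  finally show ?thesis .
qed

lemma path_loops: "path (Suc d) p d d t = (\<Sum>qs\<leftarrow>loops p. quads d qs t)"
proof (induction p rule: loops.induct)
  case (3 p)
  have "path (Suc d) (Adj # p) d d t = (\<Sum>(a, b)\<leftarrow>splits Opr p. quad d a t * path (Suc d) b d d t)"
    by (subst path_last_Adj) auto
  also have "\<dots> = (\<Sum>(a, b)\<leftarrow>splits Opr p. quad d a t * (\<Sum>qs\<leftarrow>loops b. quads d qs t))"
    using 3 by (intro arg_cong[where f = sum_list] map_cong) auto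
  also have "\<dots> = (\<Sum>qs\<leftarrow>loops (Adj # p). quads d qs t)"
    by (simp add: sum_list_map_concat comp_def split_def sum_list_const_mult)
  finally show ?case .
qed (simp_all add: path_last_Opr del: path.simps(2))

lemma path_exits:
  assumes "y < d"
  shows "path (Suc d) p d y t = (\<Sum>(qs, e)\<leftarrow>exits p. row_path d e y t * quads d qs t)"
proof (induction p rule: exits.induct)
  case (3 p)
  have "path (Suc d) (Adj # p) d y t = row_path d p y t + (\<Sum>(a, b)\<leftarrow>splits Opr p. quad d a t * path (Suc d) b d y t)"
    using assms by (subst path_last_Adj) auto
  also have "(\<Sum>(a, b)\<leftarrow>splits Opr p. quad d a t * path (Suc d) b d y t)
     = (\<Sum>(a, b)\<leftarrow>splits Opr p. quad d a t * (\<Sum>(qs, e)\<leftarrow>exits b. row_path d e y t * quads d qs t))"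
    using 3 by (intro arg_cong[where f = sum_list] map_cong) auto
  finally show ?case
    by (simp add: sum_list_map_concat comp_def split_def sum_list_const_mult[symmetric] mult.left_commute)
qed (use assms in \<open>simp_all add: path_last_Opr del: path.simps(2)\<close>)

text \<open>Enlarging the matrix by one index adds to a trace exactly the closed paths that visit this index.\<close>

lemma tr_Suc: "tr (Suc d) p t = tr d p t + (\<Sum>qs\<leftarrow>cuts p. quads d qs t)"
proof -
  have "(\<Sum>x<d. path (Suc d) p x x t)
     = (\<Sum>x<d. path d p x x t + (\<Sum>(a, b)\<leftarrow>splits Opr p. col_path d a x t * path (Suc d) b d x t))"
    by (intro sum.cong refl) (simp add: path_first_visit)
  also have "\<dots> = tr d p t + (\<Sum>x<d. \<Sum>(a, b)\<leftarrow>splits Opr p. \<Sum>(qs, e)\<leftarrow>exits b. row_path d e x t * col_path d a x t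
      * quads d qs t)"
    by (simp add: sum.distrib tr_def path_exits split_def sum_list_const_mult[symmetric] ac_simps)
  also have "(\<Sum>x<d. \<Sum>(a, b)\<leftarrow>splits Opr p. \<Sum>(qs, e)\<leftarrow>exits b. row_path d e x t * col_path d a x t * quads d qs t)
     = (\<Sum>(a, b)\<leftarrow>splits Opr p. \<Sum>(qs, e)\<leftarrow>exits b. quad d (e @ a) t * quads d qs t)"
  proof -
    have s: "(\<Sum>x<d. \<Sum>z\<leftarrow>zs. f z x) = (\<Sum>z\<leftarrow>zs. \<Sum>x<d. f z x)"
      for f :: "'z \<Rightarrow> nat \<Rightarrow> complex" and zs
      by (induction zs) (simp_all add: sum.distrib)
    show ?thesis by (simp add: split_def s quad_append sum_distrib_right)
  qed
  also have "\<dots> = (\<Sum>qs\<leftarrow>concat (map (\<lambda>(a, b). map (\<lambda>(qs, e). (e @ a) # qs) (exits b)) (splits Opr p)). quads d qs t)"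
    by (simp add: sum_list_map_concat comp_def split_def)
  finally have "tr (Suc d) p t = path (Suc d) p d d t + (tr d p t +
     (\<Sum>qs\<leftarrow>concat (map (\<lambda>(a, b). map (\<lambda>(qs, e). (e @ a) # qs) (exits b)) (splits Opr p)). quads d qs t))"
    unfolding tr_def by simp
  then show ?thesis unfolding cuts_def path_loops by simp
qed

section \<open>The limiting moments\<close>

text \<open>The limit of the normalized moments: in leading order the \<open>d\<close>-th increment of the trace is a sum of
  products of traces of the words into which the new index cuts the path, and the denominator comes
  from summing the increments. In combinatorial terms \<open>mu p\<close> is the sum over the non-crossing pairings
  of \<open>p\<close> of the volume of the associated order polytope, and the recursion removes the largest
  coordinate.\<close>

function mu :: "word \<Rightarrow> complex" where
  "mu p = (\<Sum>qs\<leftarrow>cuts p. \<Prod>q\<leftarrow>qs. mu q) / (of_nat (length p) / 2 + 1)"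
  by auto
termination
proof (relation "Wellfounded.measure length")
  fix p qs q assume "qs \<in> set (cuts p)" "q \<in> set qs"
  then show "(q, p) \<in> Wellfounded.measure length"
    using weight_cuts[of qs p] member_weight[of q qs] by simp
qed simp

declare mu.simps [simp del]

abbreviation mus :: "word list \<Rightarrow> complex" where
  "mus ps \<equiv> \<Prod>p\<leftarrow>ps. mu p"

lemma half_Suc_neq_0: "of_nat n / 2 + 1 \<noteq> (0::complex)"
proof
  assume "of_nat n / 2 + 1 = (0::complex)"
  then have "Re (of_nat n / 2 + 1) = 0" by simp
  then show False by simp
qed

lemma mu_cuts: "(of_nat (length p) / 2 + 1) * mu p = (\<Sum>qs\<leftarrow>cuts p. mus qs)"
  using half_Suc_neq_0[of "length p"] by (subst mu.simps) simp

definition upper_entries :: "nat \<Rightarrow> entry set" where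
  "upper_entries d = {(i, j). i < j \<and> j < d}"

lemma hom_gpoly_path: "x < d \<Longrightarrow> hom_gpoly (upper_entries d) (length p) (path d p x y)"
proof (induction p arbitrary: x)
  case Nil
  then show ?case using hom_gpoly_const[of "upper_entries d" "if x = y then 1 else 0"] by simp
next
  case (Cons c p)
  have "hom_gpoly (upper_entries d) 1 (entry_factor c x z)" if "z < d" for z
  proof (cases "(c = Opr \<and> x < z) \<or> (c = Adj \<and> z < x)")
    case True
    then show ?thesis
      using hom_gpoly_entry[of "(x, z)" "upper_entries d"] hom_gpoly_cnj[of "(z, x)" "upper_entries d"] Cons.prems that
      by (cases c) (auto simp: entry_factor_def[abs_def] upper_entries_def)
  next
    case False
    then have "entry_factor c x z = (\<lambda>_. 0)" by (cases c) (auto simp: entry_factor_def fun_eq_iff)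
    then show ?thesis by (simp add: hom_gpoly_zero)
  qed
  then have "hom_gpoly (upper_entries d) (1 + length p) (\<lambda>t. \<Sum>z<d. entry_factor c x z t * path d p z y t)"
    using Cons.IH by (intro hom_gpoly_sum hom_gpoly_mult) auto
  then show ?case by simp
qed

lemma hom_gpoly_tr: "hom_gpoly (upper_entries d) (length p) (tr d p)"
proof -
  have "hom_gpoly (upper_entries d) (length p) (\<lambda>t. \<Sum>x<d. path d p x x t)"
    by (intro hom_gpoly_sum hom_gpoly_path) auto
  then show ?thesis by (simp add: tr_def[abs_def])
qed

lemma is_gpoly_tr: "is_gpoly (tr d p)"
  by (rule hom_gpoly_is_gpoly[OF hom_gpoly_tr])

lemma is_gpoly_path: "x < d \<Longrightarrow> is_gpoly (path d p x y)"
  by (rule hom_gpoly_is_gpoly[OF hom_gpoly_path])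

lemma is_gpoly_col_path: "x < d \<Longrightarrow> is_gpoly (col_path d q x)"
  unfolding col_path_def[abs_def] by (intro is_gpoly_sum is_gpoly_mult is_gpoly_path is_gpoly_entry)

lemma is_gpoly_quad: "is_gpoly (quad d q)"
  unfolding quad_def[abs_def] by (intro is_gpoly_sum is_gpoly_mult is_gpoly_col_path is_gpoly_cnj) auto

lemma is_gpoly_quads: "is_gpoly (quads d qs)"
  unfolding quads_def[abs_def] by (intro is_gpoly_prod_list is_gpoly_quad)

definition trs :: "nat \<Rightarrow> word list \<Rightarrow> (entry \<Rightarrow> complex) \<Rightarrow> complex" where
  "trs d ps t = (\<Prod>p\<leftarrow>ps. tr d p t)"

lemma trs_simps [simp]: "trs d [] t = 1" "trs d (p # ps) t = tr d p t * trs d ps t"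
  "trs d (ps @ ps') t = trs d ps t * trs d ps' t"
  by (simp_all add: trs_def)

lemma is_gpoly_trs: "is_gpoly (trs d ps)"
  unfolding trs_def[abs_def] by (intro is_gpoly_prod_list is_gpoly_tr)

text \<open>Three kinds of factors occur while a moment in dimension \<open>Suc d\<close> is reduced to moments in dimension
  \<open>d\<close>: traces already rewritten in terms of the small matrix, traces of the enlarged matrix, and
  quadratic forms in the added column.\<close>

definition joint :: "nat \<Rightarrow> word list \<Rightarrow> word list \<Rightarrow> word list \<Rightarrow> complex" where
  "joint d ps rs qs = gexp (\<lambda>t. trs d ps t * trs (Suc d) rs t * quads d qs t)"

text \<open>The pairing of the leading conjugated entry of the form \<open>q\<close> with an entry of another form \<open>r\<close> turns
  the two forms into the single form of the product \<open>r @ q\<close>.\<close>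

primrec merges :: "word \<Rightarrow> word list \<Rightarrow> word list list" where
  "merges q [] = []"
| "merges q (r # qs) = ((r @ q) # qs) # map (\<lambda>qs'. r # qs') (merges q qs)"

lemma weight_merges: "qs' \<in> set (merges q qs) \<Longrightarrow> weight qs' + 2 = weight (q # qs)"
  by (induction qs arbitrary: qs') auto

primrec quads_deriv :: "nat \<Rightarrow> nat \<Rightarrow> word list \<Rightarrow> (entry \<Rightarrow> complex) \<Rightarrow> complex" where
  "quads_deriv d x [] t = 0"
| "quads_deriv d x (q # qs) t = row_path d q x t * quads d qs t + quad d q t * quads_deriv d x qs t"

lemma has_gderiv_path: "x < d \<Longrightarrow> has_gderiv (z, d) (path d p x y) (\<lambda>_. 0)"
  by (rule hom_gpoly_has_gderiv[OF hom_gpoly_path]) (auto simp: upper_entries_def)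

lemma has_gderiv_quad: "z < d \<Longrightarrow> has_gderiv (z, d) (quad d q) (row_path d q z)"
proof -
  assume z: "z < d"
  have "has_gderiv (z, d) (\<lambda>t. \<Sum>x<d. cnj (t (x, d)) * (\<Sum>y<d. path d q x y t * t (y, d)))
     (\<lambda>t. \<Sum>x<d. 0 * (\<Sum>y<d. path d q x y t * t (y, d)) + cnj (t (x, d)) *
       (\<Sum>y<d. 0 * t (y, d) + path d q x y t * (if (y, d) = (z, d) then 1 else 0)))"
    by (intro has_gderiv_sum has_gderiv_mult has_gderiv_path has_gderiv_cnj has_gderiv_entry) auto
  moreover have "(\<lambda>t. \<Sum>x<d. 0 * (\<Sum>y<d. path d q x y t * t (y, d)) + cnj (t (x, d)) *
       (\<Sum>y<d. 0 * t (y, d) + path d q x y t * (if (y, d) = (z, d) then 1 else 0))) = row_path d q z"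
    using z by (simp add: row_path_def fun_eq_iff if_distrib[of "\<lambda>c. _ * c"] cong: if_cong)
  ultimately show ?thesis by (simp add: quad_def[abs_def] col_path_def[abs_def])
qed

lemma has_gderiv_quads: "z < d \<Longrightarrow> has_gderiv (z, d) (quads d qs) (quads_deriv d z qs)"
proof (induction qs)
  case Nil
  then show ?case using has_gderiv_const[of "(z, d)" 1] by (simp add: quads_def[abs_def] fun_eq_iff)
next
  case (Cons q qs)
  have "has_gderiv (z, d) (\<lambda>t. quad d q t * quads d qs t) (\<lambda>t. row_path d q z t * quads d qs t
      + quad d q t * quads_deriv d z qs t)"
    using Cons by (intro has_gderiv_mult has_gderiv_quad) auto
  then show ?case by (simp add: fun_eq_iff[symmetric] quads_def[abs_def])
qed

lemma col_path_quads_deriv: "(\<Sum>x<d. col_path d q x t * quads_deriv d x qs t) = (\<Sum>qs'\<leftarrow>merges q qs. quads d qs' t)"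
proof (induction qs)
  case (Cons r qs)
  have "(\<Sum>x<d. col_path d q x t * quads_deriv d x (r # qs) t)
     = (\<Sum>x<d. row_path d r x t * col_path d q x t) * quads d qs t + quad d r t * (\<Sum>x<d. col_path d q x t *
         quads_deriv d x qs t)"
    by (simp add: sum.distrib sum_distrib_left sum_distrib_right algebra_simps)
  also have "\<dots> = (\<Sum>qs'\<leftarrow>merges q (r # qs). quads d qs' t)"
    unfolding Cons quad_append[symmetric] by (simp add: comp_def sum_list_const_mult)
  finally show ?case .
qed simp

text \<open>Integrating out one conjugated entry of the added column: it is paired either inside its own
  quadratic form, which then closes up to a trace, or with another form, and the two forms merge.\<close>

lemma joint_wick:
  "joint d ps [] (q # qs) = joint d (q # ps) [] qs + (\<Sum>qs'\<leftarrow>merges q qs. joint d ps [] qs')"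
proof -
  let ?G = "\<lambda>t. trs d ps t * quads d qs t"
  have trs: "has_gderiv (x, d) (trs d ps) (\<lambda>_. 0)" for x
  proof (induction ps)
    case Nil
    then show ?case using has_gderiv_const[of "(x, d)" 1] by (simp add: trs_def[abs_def])
  next
    case (Cons p ps)
    have "has_gderiv (x, d) (tr d p) (\<lambda>_. 0)"
      by (rule hom_gpoly_has_gderiv[OF hom_gpoly_tr]) (auto simp: upper_entries_def)
    from has_gderiv_mult[OF this Cons] show ?case by (simp add: trs_def[abs_def])
  qed
  have der: "has_gderiv (x, d) (\<lambda>t. \<Sum>y<d. path d q x y t * t (y, d) * ?G t)
      (\<lambda>t. path d q x x t * ?G t + col_path d q x t * (trs d ps t * quads_deriv d x qs t))" if "x < d" for x
  proof -
    have "has_gderiv (x, d) (\<lambda>t. \<Sum>y<d. path d q x y t * t (y, d) * ?G t)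
      (\<lambda>t. \<Sum>y<d. (0 * t (y, d) + path d q x y t * (if (y, d) = (x, d) then 1 else 0)) * ?G t +
         path d q x y t * t (y, d) * (0 * quads d qs t + trs d ps t * quads_deriv d x qs t))"
      using that by (intro has_gderiv_sum has_gderiv_mult has_gderiv_path has_gderiv_entry trs has_gderiv_quads) auto
    moreover have "(\<lambda>t. \<Sum>y<d. (0 * t (y, d) + path d q x y t * (if (y, d) = (x, d) then 1 else 0)) * ?G t +
         path d q x y t * t (y, d) * (0 * quads d qs t + trs d ps t * quads_deriv d x qs t))
       = (\<lambda>t. path d q x x t * ?G t + col_path d q x t * (trs d ps t * quads_deriv d x qs t))"
      using that by (simp add: fun_eq_iff sum.distrib col_path_def sum_distrib_right if_distrib[of "\<lambda>c. _ * c"]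
          if_distrib[of "\<lambda>c. c * _"] cong: if_cong)
    ultimately show ?thesis by simp
  qed
  have "joint d ps [] (q # qs) = gexp (\<lambda>t. \<Sum>x<d. cnj (t (x, d)) * (\<Sum>y<d. path d q x y t * t (y, d) * ?G t))"
    unfolding joint_def by (simp add: quad_def col_path_def sum_distrib_left sum_distrib_right ac_simps)
  also have "\<dots> = (\<Sum>x<d. gexp (\<lambda>t. cnj (t (x, d)) * (\<Sum>y<d. path d q x y t * t (y, d) * ?G t)))"
    by (intro gexp_sum is_gpoly_mult is_gpoly_cnj has_gderiv_is_gpoly[OF der]) auto
  also have "\<dots> = (\<Sum>x<d. gexp (\<lambda>t. path d q x x t * ?G t + col_path d q x t * (trs d ps t * quads_deriv d x qs t)))"
    by (intro sum.cong refl gexp_stein(1) der) auto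
  also have "\<dots> = gexp (\<lambda>t. \<Sum>x<d. path d q x x t * ?G t + col_path d q x t * (trs d ps t * quads_deriv d x qs t))"
    by (intro gexp_sum[symmetric] gexp_stein(2)[OF der]) auto
  also have "(\<lambda>t. \<Sum>x<d. path d q x x t * ?G t + col_path d q x t * (trs d ps t * quads_deriv d x qs t))
     = (\<lambda>t. trs d (q # ps) t * quads d qs t + (\<Sum>qs'\<leftarrow>merges q qs. trs d ps t * quads d qs' t))"
  proof
    fix t
    have "(\<Sum>x<d. path d q x x t * ?G t + col_path d q x t * (trs d ps t * quads_deriv d x qs t))
       = tr d q t * ?G t + trs d ps t * (\<Sum>x<d. col_path d q x t * quads_deriv d x qs t)"
      by (simp add: sum.distrib tr_def sum_distrib_left sum_distrib_right ac_simps)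
    then show "(\<Sum>x<d. path d q x x t * ?G t + col_path d q x t * (trs d ps t * quads_deriv d x qs t))
       = trs d (q # ps) t * quads d qs t + (\<Sum>qs'\<leftarrow>merges q qs. trs d ps t * quads d qs' t)"
      unfolding col_path_quads_deriv by (simp add: sum_list_const_mult)
  qed
  also have "gexp \<dots> = gexp (\<lambda>t. trs d (q # ps) t * quads d qs t)
      + (\<Sum>qs'\<leftarrow>merges q qs. gexp (\<lambda>t. trs d ps t * quads d qs' t))"
    using gexp_sum_list[of "merges q qs" "\<lambda>qs' t. trs d ps t * quads d qs' t"]
    by (subst gexp_add; (intro is_gpoly_sum_list)?; (intro is_gpoly_mult is_gpoly_trs is_gpoly_quads)?)
       (simp_all add: is_gpoly_mult is_gpoly_trs is_gpoly_quads)
  finally show ?thesis unfolding joint_def by simp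
qed

lemma joint_cuts:
  "joint d ps (r # rs) qs = joint d (r # ps) rs qs + (\<Sum>qs'\<leftarrow>cuts r. joint d ps rs (qs' @ qs))"
proof -
  have "(\<lambda>t. trs d ps t * trs (Suc d) (r # rs) t * quads d qs t)
     = (\<lambda>t. trs d (r # ps) t * trs (Suc d) rs t * quads d qs t
        + (\<Sum>qs'\<leftarrow>cuts r. trs d ps t * trs (Suc d) rs t * quads d (qs' @ qs) t))"
    by (simp add: tr_Suc algebra_simps sum_list_const_mult fun_eq_iff sum_list_mult_const)
  then show ?thesis unfolding joint_def
    by (simp only:) (subst gexp_add; (intro is_gpoly_sum_list is_gpoly_mult is_gpoly_trs is_gpoly_quads)?;
       subst gexp_sum_list; (intro is_gpoly_mult is_gpoly_trs is_gpoly_quads)?; simp)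
qed

lemma joint_Suc: "joint d [] ps [] = joint (Suc d) ps [] []"
  by (simp add: joint_def)

lemma joint_commute: "joint d (p # ps @ ps') rs qs = joint d (ps @ p # ps') rs qs"
  by (simp add: joint_def ac_simps)

text \<open>Half-integral exponents of the dimension cannot be avoided in the induction, since single words of
  odd length occur; hence powers of its square root.\<close>

definition growth :: "(nat \<Rightarrow> complex) \<Rightarrow> nat \<Rightarrow> complex \<Rightarrow> bool" where
  "growth f w L \<longleftrightarrow> (\<lambda>d. f d / of_real (sqrt (real d)) ^ w) \<longlonglongrightarrow> L"

lemma growth_add: "growth f w L \<Longrightarrow> growth g w L' \<Longrightarrow> growth (\<lambda>d. f d + g d) w (L + L')"
  unfolding growth_def add_divide_distrib by (rule tendsto_add)

lemma growth_diff: "growth f w L \<Longrightarrow> growth g w L' \<Longrightarrow> growth (\<lambda>d. f d - g d) w (L - L')"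
  unfolding growth_def diff_divide_distrib by (rule tendsto_diff)

lemma growth_zero: "growth (\<lambda>_. 0) w 0"
  unfolding growth_def by simp

lemma growth_sum_list:
  "(\<And>x. x \<in> set xs \<Longrightarrow> growth (f x) w (L x)) \<Longrightarrow> growth (\<lambda>d. \<Sum>x\<leftarrow>xs. f x d) w (\<Sum>x\<leftarrow>xs. L x)"
  by (induction xs) (simp_all add: growth_zero growth_add)

lemma growth_lower:
  assumes "growth f w L"
  shows "growth f (w + 2) 0"
proof -
  have "(\<lambda>d. 1 / complex_of_real (sqrt (real d)) ^ 2) = (\<lambda>d. of_real (1 / real d))"
    by (simp add: fun_eq_iff flip: of_real_power)
  moreover have "(\<lambda>d. complex_of_real (1 / real d)) \<longlonglongrightarrow> of_real 0"
    by (intro tendsto_of_real lim_const_over_n)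
  ultimately have "(\<lambda>d. f d / of_real (sqrt (real d)) ^ w * (1 / complex_of_real (sqrt (real d)) ^ 2)) \<longlonglongrightarrow> L * 0"
    using assms unfolding growth_def by (intro tendsto_mult) auto
  moreover have "f d / complex_of_real (sqrt (real d)) ^ (w + 2)
      = f d / of_real (sqrt (real d)) ^ w * (1 / complex_of_real (sqrt (real d)) ^ 2)" for d
    by (simp only: power_add times_divide_eq_right mult_1_right divide_divide_eq_left)
  ultimately show ?thesis by (simp only: growth_def mult_zero_right)
qed

lemma sqrt_power_difference:
  "(\<lambda>d::nat. (sqrt (real (Suc d)) ^ (k + 2) - sqrt (real d) ^ (k + 2)) / sqrt (real d) ^ k) \<longlonglongrightarrow> (real k + 2) / 2"
proof -
  define a where "a = (real k + 2) / 2"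
  have a: "a > 0" by (simp add: a_def)
  have "(\<lambda>d::nat. ((real d + 1) powr a - real d powr a) / real d powr (a - 1)) \<longlonglongrightarrow> a"
    using a by real_asymp
  moreover have "sqrt x ^ (k + 2) = x powr a" "sqrt x ^ k = x powr (a - 1)" if "x > 0" for x :: real
    using that by (simp_all add: a_def powr_half_sqrt[symmetric] powr_powr powr_realpow[symmetric] field_simps flip:
        powr_add)
  then have "\<forall>\<^sub>F d in sequentially. ((real d + 1) powr a - real d powr a) / real d powr (a - 1)
      = (sqrt (real (Suc d)) ^ (k + 2) - sqrt (real d) ^ (k + 2)) / sqrt (real d) ^ k"
    by (intro eventually_sequentiallyI[of 1]) (simp add: add.commute)
  ultimately show ?thesis
    unfolding a_def[symmetric] by (rule Lim_transform_eventually)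
qed

text \<open>Summing \<open>d\<close> increments that are small compared with the \<open>k\<close>-th power of the square root gains one
  factor \<open>d\<close>, because that power is monotone.\<close>

lemma growth_summation_zero:
  assumes "growth (\<lambda>d. f (Suc d) - f d) k 0"
  shows "growth f (k + 2) 0"
  unfolding growth_def
proof (rule LIMSEQ_I)
  fix \<epsilon> :: real assume \<epsilon>: "\<epsilon> > 0"
  obtain D where D: "\<And>d. d \<ge> D \<Longrightarrow> norm ((f (Suc d) - f d) / of_real (sqrt (real d)) ^ k) < \<epsilon> / 2"
    using LIMSEQ_D[OF assms[unfolded growth_def], of "\<epsilon> / 2"] \<epsilon> by auto
  \<comment> \<open>positivity of the index makes division by its powers harmless\<close>
  define D' where "D' = max D 1"
  have step: "norm (f (Suc d) - f d) \<le> \<epsilon> / 2 * sqrt (real d) ^ k" if "d \<ge> D'" for d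
  proof -
    have pos: "sqrt (real d) ^ k > 0" using that by (simp add: D'_def)
    have "norm (f (Suc d) - f d) / sqrt (real d) ^ k < \<epsilon> / 2"
      using D[of d] that by (simp add: D'_def norm_divide norm_power)
    then show ?thesis using pos by (simp add: pos_divide_less_eq)
  qed
  have bound: "norm (f d) \<le> norm (f D') + \<epsilon> / 2 * (real (d - D') * sqrt (real d) ^ k)" if "d \<ge> D'" for d
    using that
  proof (induction d rule: dec_induct)
    case (step d)
    have mono: "sqrt (real d) ^ k \<le> sqrt (real (Suc d)) ^ k" by (intro power_mono) auto
    have "norm (f (Suc d)) \<le> norm (f d) + norm (f (Suc d) - f d)"
      by (metis add.commute diff_add_cancel norm_triangle_ineq)
    also have "\<dots> \<le> norm (f D') + \<epsilon> / 2 * (real (d - D') * sqrt (real d) ^ k) + \<epsilon> / 2 * sqrt (real d) ^ k"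
      using step \<open>\<And>d. d \<ge> D' \<Longrightarrow> norm (f (Suc d) - f d) \<le> \<epsilon> / 2 * sqrt (real d) ^ k\<close>[of d] by simp
    also have "\<dots> = norm (f D') + \<epsilon> / 2 * (real (Suc d - D') * sqrt (real d) ^ k)"
      using step by (simp add: Suc_diff_le algebra_simps)
    also have "\<dots> \<le> norm (f D') + \<epsilon> / 2 * (real (Suc d - D') * sqrt (real (Suc d)) ^ k)"
      using \<epsilon> mono by (intro add_left_mono mult_left_mono) auto
    finally show ?case .
  qed simp
  have "(\<lambda>d::nat. norm (f D') / sqrt (real d) ^ (k + 2)) \<longlonglongrightarrow> 0"
    by (intro tendsto_divide_0[OF tendsto_const] filterlim_at_top_imp_at_infinity filterlim_pow_at_top
        filterlim_compose[OF sqrt_at_top filterlim_real_sequentially]) auto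
  then obtain E where E: "\<And>d. d \<ge> E \<Longrightarrow> norm (f D') / sqrt (real d) ^ (k + 2) < \<epsilon> / 2"
    using LIMSEQ_D[of _ 0 "\<epsilon> / 2"] \<epsilon> by fastforce
  show "\<exists>no. \<forall>d\<ge>no. norm (f d / of_real (sqrt (real d)) ^ (k + 2) - 0) < \<epsilon>"
  proof (intro exI allI impI)
    fix d assume d: "d \<ge> max D' E"
    then have pos: "sqrt (real d) ^ (k + 2) > 0" by (simp add: D'_def)
    have "real (d - D') * sqrt (real d) ^ k \<le> real d * sqrt (real d) ^ k"
      by (intro mult_right_mono) auto
    also have "\<dots> = sqrt (real d) ^ (k + 2)" by simp
    finally have "norm (f d) \<le> norm (f D') + \<epsilon> / 2 * sqrt (real d) ^ (k + 2)"
      using bound[of d] d \<epsilon> by (smt (verit) max.bounded_iff mult_left_mono half_gt_zero)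
    also have "norm (f D') < \<epsilon> / 2 * sqrt (real d) ^ (k + 2)"
      using E[of d] d pos by (simp add: pos_divide_less_eq)
    finally have "norm (f d) < \<epsilon> * sqrt (real d) ^ (k + 2)" by simp
    then have "norm (f d) / sqrt (real d) ^ (k + 2) < \<epsilon>" using pos by (simp add: pos_divide_less_eq)
    then show "norm (f d / of_real (sqrt (real d)) ^ (k + 2) - 0) < \<epsilon>"
      by (simp only: diff_zero norm_divide norm_power norm_of_real abs_of_nonneg real_sqrt_ge_zero of_nat_0_le_iff)
  qed
qed

text \<open>A discrete form of integrating a power: subtracting the sequence with the expected leading term
  reduces the claim to the previous lemma.\<close>

lemma growth_summation:
  assumes "growth (\<lambda>d. f (Suc d) - f d) k c"
  shows "growth f (k + 2) (c / (of_nat k / 2 + 1))"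
proof -
  define m where "m = c / (of_nat k / 2 + 1)"
  \<comment> \<open>the sequence whose increments have the prescribed leading term\<close>
  define g where "g d = m * of_real (sqrt (real d) ^ (k + 2))" for d :: nat
  have "(\<lambda>d. m * of_real ((sqrt (real (Suc d)) ^ (k + 2) - sqrt (real d) ^ (k
      + 2)) / sqrt (real d) ^ k)) \<longlonglongrightarrow> m * of_real ((real k + 2) / 2)"
    by (intro tendsto_intros sqrt_power_difference)
  moreover have "m * of_real ((real k + 2) / 2) = c"
    using half_Suc_neq_0[of k] by (simp add: m_def add_divide_distrib)
  ultimately have "growth (\<lambda>d. g (Suc d) - g d) k c"
    unfolding growth_def g_def
    by (simp only: of_real_diff of_real_divide of_real_power right_diff_distrib[symmetric] times_divide_eq_right)
  from growth_diff[OF assms this] have "growth (\<lambda>d. (f (Suc d) - g (Suc d)) - (f d - g d)) k 0"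
    by (simp add: algebra_simps)
  then have 1: "growth (\<lambda>d. f d - g d) (k + 2) 0" by (rule growth_summation_zero)
  have "\<forall>\<^sub>F d in sequentially. m = g d / of_real (sqrt (real d)) ^ (k + 2)"
    by (rule eventually_sequentiallyI[of 1]) (simp add: g_def)
  then have "growth g (k + 2) m"
    unfolding growth_def by (rule Lim_transform_eventually[OF tendsto_const])
  from growth_add[OF 1 this] show ?thesis by (simp add: m_def)
qed

lemma sum_mus_cuts: "(\<Sum>qs\<leftarrow>cuts p. mus (qs @ ps)) = (of_nat (length p) / 2 + 1) * mus (p # ps)"
  by (simp add: mu_cuts[symmetric] sum_list_mult_const mult.assoc flip: mu_cuts)

text \<open>Joint moments factorize in leading order, and only two effects contribute: in \<open>joint_wick\<close> the pairing
  that closes a quadratic form up to a trace, because a merger costs a factor of the dimension, and in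
  \<open>joint_cuts\<close> the terms in which exactly one of the traces visits the new index.\<close>

lemma joint_growth: "growth (\<lambda>d. joint d ps rs qs) (weight (ps @ rs @ qs)) (mus (ps @ rs @ qs))"
proof (induction "weight (ps @ rs @ qs)" arbitrary: ps rs qs rule: less_induct)
  case less
  define n where "n = weight (ps @ rs @ qs)"
  have IH: "growth (\<lambda>d. joint d ps rs qs) m (mus (ps @ rs @ qs))"
    if "weight (ps @ rs @ qs) = m" "m + 2 \<le> n" for ps rs qs m
    using less[of ps rs qs] that by (simp add: n_def)
  have traces: "growth (\<lambda>d. joint d ps [] []) n (mus ps)" if w: "weight ps = n" for ps
  proof (cases ps)
    case Nil
    then show ?thesis using w by (simp add: joint_def trs_def quads_def gexp_one growth_def)
  next
    case (Cons p0 ps0)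
    define m where "m = length p0 + weight ps0"
    have m: "n = m + 2" using w Cons by (simp add: m_def)
    \<comment> \<open>replacing the enlarged traces \<open>bs\<close> by small ones one after another\<close>
    have "growth (\<lambda>d. joint d as bs [] - joint d (as @ bs) [] []) m (of_nat (weight bs) / 2 * mus (as @ bs))"
      if "weight (as @ bs) = n" for as bs
      using that
    proof (induction bs arbitrary: as)
      case Nil
      then show ?case by (simp add: growth_zero)
    next
      case (Cons b bs)
      have "growth (\<lambda>d. joint d (b # as) bs [] - joint d ((b # as) @ bs) [] []) m (of_nat (weight bs) / 2
          * mus ((b # as) @ bs))"
        using Cons.prems by (intro Cons.IH) simp
      moreover have "growth (\<lambda>d. \<Sum>qs\<leftarrow>cuts b. joint d as bs (qs @ [])) m (\<Sum>qs\<leftarrow>cuts b. mus (as @ bs @ qs @ []))"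
        using Cons.prems m by (intro growth_sum_list IH) (auto dest: weight_cuts)
      moreover have "(\<Sum>qs\<leftarrow>cuts b. mus (as @ bs @ qs @ [])) = (of_nat (length b) / 2 + 1) * mus (as @ b # bs)"
        using sum_mus_cuts[where p = b and ps = "as @ bs"] by (simp add: ac_simps)
      ultimately have "growth (\<lambda>d. joint d (b # as) bs [] - joint d ((b # as) @ bs) [] []
          + (\<Sum>qs\<leftarrow>cuts b. joint d as bs (qs @ []))) m
         (of_nat (weight bs) / 2 * mus ((b # as) @ bs) + (of_nat (length b) / 2 + 1) * mus (as @ b # bs))"
        by (intro growth_add) simp_all
      then show ?case
        using joint_commute[of _ b as bs "[]" "[]"]
        by (simp add: joint_cuts[of _ as b bs "[]"] algebra_simps add_divide_distrib)
    qed
    from this[of "[]" ps] w have "growth (\<lambda>d. joint (Suc d) ps [] [] - joint d ps [] []) m (of_nat n / 2 * mus ps)"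
      by (simp add: joint_Suc)
    moreover have "complex_of_nat n / 2 = of_nat m / 2 + 1" by (simp add: m add_divide_distrib)
    ultimately have "growth (\<lambda>d. joint (Suc d) ps [] [] - joint d ps [] []) m ((of_nat m / 2 + 1) * mus ps)"
      by simp
    from growth_summation[OF this] show ?thesis
      by (simp only: m nonzero_mult_div_cancel_left[OF half_Suc_neq_0])
  qed
  have forms: "growth (\<lambda>d. joint d ps [] qs) n (mus (ps @ qs))" if w: "weight (ps @ qs) = n" for ps qs
    using w
  proof (induction qs arbitrary: ps)
    case Nil
    then show ?case using traces by simp
  next
    case (Cons q qs)
    define m where "m = length q + weight ps + weight qs"
    have m: "n = m + 2" using Cons.prems by (simp add: m_def)
    have "growth (\<lambda>d. joint d (q # ps) [] qs) n (mus ((q # ps) @ qs))"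
      using Cons by (intro Cons.IH) simp
    moreover have "growth (\<lambda>d. \<Sum>qs'\<leftarrow>merges q qs. joint d ps [] qs') m (\<Sum>qs'\<leftarrow>merges q qs. mus (ps @ [] @ qs'))"
      using Cons.prems m by (intro growth_sum_list IH) (auto dest: weight_merges)
    ultimately have "growth (\<lambda>d. joint d (q # ps) [] qs
        + (\<Sum>qs'\<leftarrow>merges q qs. joint d ps [] qs')) n (mus ((q # ps) @ qs) + 0)"
      unfolding m by (intro growth_add growth_lower)
    then show ?case by (simp add: joint_wick ac_simps)
  qed
  have "growth (\<lambda>d. joint d ps rs qs) n (mus (ps @ rs @ qs))" if w: "weight (ps @ rs @ qs) = n" for ps rs qs
    using w
  proof (induction rs arbitrary: ps)
    case Nil
    then show ?case using forms by simp
  next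
    case (Cons r rs)
    define m where "m = length r + weight ps + weight rs + weight qs"
    have m: "n = m + 2" using Cons.prems by (simp add: m_def)
    have "growth (\<lambda>d. joint d (r # ps) rs qs) n (mus ((r # ps) @ rs @ qs))"
      using Cons by (intro Cons.IH) simp
    moreover have "growth (\<lambda>d. \<Sum>qs'\<leftarrow>cuts r. joint d ps rs (qs' @ qs)) m (\<Sum>qs'\<leftarrow>cuts r. mus (ps @ rs @ (qs' @ qs)))"
      using Cons.prems m by (intro growth_sum_list IH) (auto dest: weight_cuts)
    ultimately have "growth (\<lambda>d. joint d (r # ps) rs qs
        + (\<Sum>qs'\<leftarrow>cuts r. joint d ps rs (qs' @ qs))) n (mus ((r # ps) @ rs @ qs) + 0)"
      unfolding m by (intro growth_add growth_lower)
    then show ?case by (simp add: joint_cuts[of _ ps r rs qs] ac_simps)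
  qed
  then show ?case by (simp add: n_def)
qed

lemma expected_moment_tr:
  assumes "d > 0"
  shows "expected_moment d p = gexp (tr d p) / of_real (sqrt (real d)) ^ (length p + 2)"
proof -
  have e: "entries_law d = gauss_law (upper_entries d) (1 / real d)"
    by (simp add: entries_law_def gauss_law_def upper_entries_def)
  have "expected_moment d p = (\<integral>t. tr d p t \<partial>gauss_law (upper_entries d) (1 / real d)) / of_nat d"
    unfolding expected_moment_def e mat_trace_tr by simp
  also have "\<dots> = of_real (sqrt (1 / real d)) ^ length p * gexp (tr d p) / of_nat d"
    using assms by (subst hom_gpoly_expectation[OF _ hom_gpoly_tr]) auto
  also have "\<dots> = gexp (tr d p) / of_real (sqrt (real d)) ^ (length p + 2)"
  proof -
    have "complex_of_real (sqrt (real d)) ^ 2 = of_nat d" by (simp flip: of_real_power)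
    moreover have "complex_of_real (sqrt (1 / real d)) = 1 / of_real (sqrt (real d))"
      by (simp add: real_sqrt_divide)
    ultimately show ?thesis unfolding power_add by (simp add: power_divide del: of_real_divide)
  qed
  finally show ?thesis .
qed

text \<open>The prefactor \<open>1 / d\<close> and the variance \<open>1 / d\<close> together divide by the \<open>(k + 2)\<close>-th power of the square
  root of the dimension, which is the growth rate of the trace of a word of length \<open>k\<close>.\<close>

lemma expected_moment_limit: "(\<lambda>d. expected_moment d p) \<longlonglongrightarrow> mu p"
proof -
  have "growth (\<lambda>d. gexp (tr d p)) (length p + 2) (mu p)"
    using joint_growth[of "[p]" "[]" "[]"] by (simp add: joint_def)
  moreover have "\<forall>\<^sub>F d in sequentially. gexp (tr d p) / of_real (sqrt (real d)) ^ (length p + 2) = expected_moment d p"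
    by (rule eventually_sequentiallyI[of 1]) (simp only: expected_moment_tr)
  ultimately show ?thesis unfolding growth_def by (rule Lim_transform_eventually)
qed

text \<open>Inherited from the cyclic invariance of the trace.\<close>

lemma mu_rotate: "mu (p @ q) = mu (q @ p)"
proof -
  have "(\<lambda>d. expected_moment d (p @ q)) = (\<lambda>d. expected_moment d (q @ p))"
    unfolding expected_moment_def mat_trace_tr tr_rotate[of _ p q] ..
  then show ?thesis using expected_moment_limit[of "p @ q"] expected_moment_limit[of "q @ p"]
    by (metis LIMSEQ_unique)
qed

lemma quasinilpotent_DT_moment: "quasinilpotent_DT J T \<tau> \<Longrightarrow> \<tau> (op_word T p) = mu p"
  unfolding quasinilpotent_DT_def using expected_moment_limit LIMSEQ_unique by blast

section \<open>Generating functions of alternating words\<close>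

abbreviation lookup where "lookup \<equiv> Poly_Mapping.lookup"
abbreviation keys where "keys \<equiv> Poly_Mapping.keys"

text \<open>The factors contributed to the recursion for \<open>mu\<close> by the paths that start at the new index and
  either return to it at the end (\<open>loops_weight\<close>) or end elsewhere (\<open>exits_weight\<close>). In the second case
  the word spelled after the last visit is completed cyclically by \<open>a\<close>, the word spelled before the
  first visit.\<close>

definition loops_weight :: "word \<Rightarrow> complex" where
  "loops_weight p = (\<Sum>qs\<leftarrow>loops p. mus qs)"

definition exits_weight :: "word \<Rightarrow> word \<Rightarrow> complex" where
  "exits_weight a p = (\<Sum>(qs, e)\<leftarrow>exits p. mu (e @ a) * mus qs)"

lemma loops_weight_simps: "loops_weight [] = 1" "loops_weight (Opr # p) = 0" "loops_weight (Adj # p)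
    = (\<Sum>(a, b)\<leftarrow>splits Opr p. mu a * loops_weight b)"
  by (simp_all add: loops_weight_def sum_list_map_concat comp_def split_def sum_list_const_mult)

lemma exits_weight_simps: "exits_weight a [] = 0" "exits_weight a (Opr # p) = 0"
  "exits_weight a (Adj # p) = mu (p @ a) + (\<Sum>(b, c)\<leftarrow>splits Opr p. mu b * exits_weight a c)"
  by (simp_all add: exits_weight_def sum_list_map_concat comp_def split_def sum_list_const_mult[symmetric]
      mult.left_commute)

lemma mu_splits: "(of_nat (length p) / 2 + 1) * mu p = loops_weight p + (\<Sum>(a, b)\<leftarrow>splits Opr p. exits_weight a b)"
  unfolding mu_cuts cuts_def loops_weight_def exits_weight_def
  by (simp add: sum_list_map_concat comp_def split_def)

subsection \<open>Balanced words\<close>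

definition excess :: "word \<Rightarrow> int" where
  "excess p = int (count_list p Opr) - int (count_list p Adj)"

lemma excess_simps [simp]: "excess [] = 0" "excess (Opr # p) = excess p + 1" "excess (Adj # p) = excess p - 1"
  "excess (p @ q) = excess p + excess q"
  by (simp_all add: excess_def)

lemma excess_loops: "qs \<in> set (loops p) \<Longrightarrow> (\<Sum>q\<leftarrow>qs. excess q) = excess p"
proof (induction p arbitrary: qs rule: loops.induct)
  case (3 p)
  then obtain a b qs' where h: "(a, b) \<in> set (splits Opr p)" "qs = a # qs'" "qs' \<in> set (loops b)"
    by auto
  then have "(\<Sum>q\<leftarrow>qs'. excess q) = excess b" using 3 by blast
  then show ?case using h splits_eq[OF h(1)] by simp
qed auto

lemma excess_exits: "(qs, e) \<in> set (exits p) \<Longrightarrow> (\<Sum>q\<leftarrow>qs. excess q) + excess e = excess p + 1"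
proof (induction p arbitrary: qs rule: exits.induct)
  case (3 p)
  show ?case
  proof (cases "(qs, e) = ([], p)")
    case False
    then obtain a b qs' where h: "(a, b) \<in> set (splits Opr p)" "qs = a # qs'" "(qs', e) \<in> set (exits b)"
      using 3 by auto
    then have "(\<Sum>q\<leftarrow>qs'. excess q) + excess e = excess b + 1" using 3 by blast
    then show ?thesis using h splits_eq[OF h(1)] by simp
  qed simp
qed auto

lemma excess_cuts: "qs \<in> set (cuts p) \<Longrightarrow> (\<Sum>q\<leftarrow>qs. excess q) = excess p"
  unfolding cuts_def by (auto dest!: excess_loops excess_exits splits_eq)

text \<open>The excesses of the words in a decomposition add up to that of the whole word, so every
  decomposition of an unbalanced word has an unbalanced part.\<close>

lemma mu_unbalanced: "excess p \<noteq> 0 \<Longrightarrow> mu p = 0"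
proof (induction p rule: mu.induct)
  case (1 p)
  have "mus qs = 0" if qs: "qs \<in> set (cuts p)" for qs
  proof -
    have "\<exists>q\<in>set qs. excess q \<noteq> 0"
    proof (rule ccontr)
      assume "\<not> (\<exists>q\<in>set qs. excess q \<noteq> 0)"
      then have "(\<Sum>q\<leftarrow>qs. excess q) = 0" by (induction qs) auto
      then show False using excess_cuts[OF qs] 1 by simp
    qed
    then obtain q where q: "q \<in> set qs" "excess q \<noteq> 0" by blast
    then have "mu q = 0" using 1 qs by blast
    then show ?thesis using q(1) by (induction qs) auto
  qed
  then have "(\<Sum>qs\<leftarrow>cuts p. mus qs) = (\<Sum>qs\<leftarrow>cuts p. 0)"
    by (intro arg_cong[where f = sum_list] map_cong refl)
  then show ?case by (subst mu.simps) simp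
qed

lemma excess_odd: "odd (length p) \<Longrightarrow> excess p \<noteq> 0"
proof -
  have "length p = count_list p Opr + count_list p Adj"
    by (induction p) (auto simp: letter.exhaust, metis letter.exhaust)
  then show "odd (length p) \<Longrightarrow> excess p \<noteq> 0" unfolding excess_def by auto
qed

subsection \<open>Words with prescribed exponents\<close>

definition lower :: "var \<Rightarrow> monomial \<Rightarrow> monomial" where
  "lower v m = m - Poly_Mapping.single v 1"

lemma lookup_lower: "lookup (lower v m) u = (if u = v then lookup m u - 1 else lookup m u)"
  by (auto simp: lower_def lookup_minus lookup_single)

text \<open>The alternating word whose exponents are read off a monomial. The indices form an arbitrary list,
  since the recursion leads to sublists and to cyclic rotations.\<close>

definition block_word :: "nat list \<Rightarrow> monomial \<Rightarrow> word" where
  "block_word I m = concat (map (\<lambda>i. replicate (lookup m (Z i)) Adj @ replicate (lookup m (W i)) Opr) I)"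

lemma block_word_simps [simp]: "block_word [] m = []"
  "block_word (i # I) m = replicate (lookup m (Z i)) Adj @ replicate (lookup m (W i)) Opr @ block_word I m"
  "block_word (I @ J) m = block_word I m @ block_word J m"
  by (simp_all add: block_word_def)

definition vars_of :: "nat list \<Rightarrow> var set" where
  "vars_of I = Z ` set I \<union> W ` set I"

lemma vars_of_simps [simp]: "vars_of [] = {}" "vars_of (i # I)
    = insert (Z i) (insert (W i) (vars_of I))" "vars_of (I @ J) = vars_of I \<union> vars_of J"
  "Z i \<in> vars_of I \<longleftrightarrow> i \<in> set I" "W i \<in> vars_of I \<longleftrightarrow> i \<in> set I" "finite (vars_of I)"
  by (auto simp: vars_of_def)

lemma block_word_cong: "(\<And>v. v \<in> vars_of I \<Longrightarrow> lookup m v = lookup m' v) \<Longrightarrow> block_word I m = block_word I m'"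
  by (induction I) auto

lemma block_word_lower: "v \<notin> vars_of I \<Longrightarrow> block_word I (lower v m) = block_word I m"
  by (rule block_word_cong) (auto simp: lookup_lower)

primrec breaks :: "nat list \<Rightarrow> (nat list \<times> nat list) list" where
  "breaks [] = []"
| "breaks (i # I) = ([i], I) # map (\<lambda>(J, K). (i # J, K)) (breaks I)"

lemma breaks_eq: "(J, K) \<in> set (breaks I) \<Longrightarrow> I = J @ K \<and> J \<noteq> []"
  by (induction I arbitrary: J) auto

lemma breaks_hd: "(J, K) \<in> set (breaks (i # I)) \<Longrightarrow> hd J = i"
  by auto

lemma splits_replicate_Adj:
  "(\<Sum>(a, b)\<leftarrow>splits Opr (replicate k Adj @ p). g a b) = (\<Sum>(a, b)\<leftarrow>splits Opr p. g (replicate k Adj @ a) b)"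
  by (induction k arbitrary: g) (simp_all add: comp_def split_def)

lemma splits_replicate_Opr:
  assumes "\<And>a b. g a (Opr # b) = (0::complex)"
  shows "(\<Sum>(a, b)\<leftarrow>splits Opr (replicate l Opr @ p). g a b)
    = (if l > 0 then g (replicate (l - 1) Opr) p else 0) + (\<Sum>(a, b)\<leftarrow>splits Opr p. g (replicate l Opr @ a) b)"
  using assms
proof (induction l arbitrary: g)
  case (Suc l)
  have "(\<Sum>(a, b)\<leftarrow>splits Opr (replicate l Opr @ p). g (Opr # a) b)
    = (if l > 0 then g (Opr # replicate (l - 1) Opr) p else 0) + (\<Sum>(a, b)\<leftarrow>splits Opr p. g (Opr # replicate l Opr @
        a) b)"
    using Suc.prems by (intro Suc.IH)
  then show ?case using Suc.prems by (cases l) (simp_all add: comp_def split_def)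
qed simp

text \<open>A cut at an \<open>Opr\<close> that is not the last letter of its power leaves a rest starting with \<open>Opr\<close>, and
  contributes nothing in the recursion because the new index is never left by an \<open>Opr\<close>. The last
  letters of the powers correspond to the indices with a positive exponent, so that a sum over the
  letters of the word becomes a sum over positions in the list of indices.\<close>

lemma splits_block_word:
  assumes "\<And>a b. g a (Opr # b) = (0::complex)" "distinct I"
  shows "(\<Sum>(a, b)\<leftarrow>splits Opr (block_word I m). g a b)
    = (\<Sum>(J, K)\<leftarrow>breaks I. if lookup m (W (last J)) > 0 then g (block_word J (lower (W (last J)) m)) (block_word K m)
        else 0)"
  using assms
proof (induction I arbitrary: g)
  case (Cons i I)
  let ?A = "replicate (lookup m (Z i)) Adj" and ?B = "replicate (lookup m (W i)) Opr"
  have "(\<Sum>(a, b)\<leftarrow>splits Opr (block_word (i # I) m). g a b)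
    = (\<Sum>(a, b)\<leftarrow>splits Opr (?B @ block_word I m). g (?A @ a) b)"
    by (simp add: splits_replicate_Adj)
  also have "\<dots> = (if lookup m (W i) > 0 then g (?A @ replicate (lookup m (W i) - 1) Opr) (block_word I m) else 0)
     + (\<Sum>(a, b)\<leftarrow>splits Opr (block_word I m). g (?A @ ?B @ a) b)"
    using Cons.prems(1) by (subst splits_replicate_Opr) auto
  also have "(\<Sum>(a, b)\<leftarrow>splits Opr (block_word I m). g (?A @ ?B @ a) b)
    = (\<Sum>(J, K)\<leftarrow>breaks I. if lookup m (W (last J)) > 0 then g (?A @ ?B @ block_word J (lower (W (last J)) m))
        (block_word K m) else 0)"
    using Cons.prems by (intro Cons.IH) auto
  also have "\<dots> = (\<Sum>(J, K)\<leftarrow>breaks I. if lookup m (W (last (i # J))) > 0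
       then g (block_word (i # J) (lower (W (last (i # J))) m)) (block_word K m) else 0)"
  proof (intro arg_cong[where f = sum_list] map_cong refl, safe)
    fix J K assume "(J, K) \<in> set (breaks I)"
    then have "J \<noteq> []" "I = J @ K" using breaks_eq by blast+
    moreover from this have "last J \<in> set I" by simp
    ultimately have "last J \<noteq> i" "J \<noteq> []" using Cons.prems(2) by auto
    then show "(if lookup m (W (last J)) > 0 then g (?A @ ?B @ block_word J (lower (W (last J)) m)) (block_word K m)
        else 0)
       = (if lookup m (W (last (i # J))) > 0 then g (block_word (i # J) (lower (W (last (i # J))) m)) (block_word K
           m) else 0)"
      by (auto simp: lookup_lower)
  qed
  finally show ?case by (simp add: comp_def split_def lookup_lower cong: if_cong)
qed simp

lemma total_degree_superset: "finite V \<Longrightarrow> keys m \<subseteq> V \<Longrightarrow> total_degree m = (\<Sum>v\<in>V. lookup m v)"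
  unfolding total_degree_def by (rule sum.mono_neutral_left) (auto simp: in_keys_iff)

lemma length_block_word: "distinct I \<Longrightarrow> length (block_word I m) = (\<Sum>v\<in>vars_of I. lookup m v)"
  by (induction I) auto

lemma length_block_word_total_degree: "distinct I \<Longrightarrow> keys m \<subseteq> vars_of I \<Longrightarrow> length (block_word I m) = total_degree m"
  by (simp add: length_block_word total_degree_superset[of "vars_of I" m])

lemma total_degree_lower: "lookup m v > 0 \<Longrightarrow> Suc (total_degree (lower v m)) = total_degree m"
proof -
  assume "lookup m v > 0"
  then have "m = lower v m + Poly_Mapping.single v 1"
    by (intro poly_mapping_eqI) (auto simp: lookup_add lookup_lower lookup_single when_def)
  moreover have "total_degree (Poly_Mapping.single v 1) = 1" by (simp add: total_degree_def)
  ultimately show ?thesis by (metis total_degree_add add.commute plus_1_eq_Suc)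
qed

lemma keys_lower: "keys (lower v m) \<subseteq> keys m"
  by (auto simp: in_keys_iff lookup_lower split: if_splits)

lemma keys_lower_iff: "v \<in> V \<Longrightarrow> keys (lower v m) \<subseteq> V \<longleftrightarrow> keys m \<subseteq> V"
  by (auto simp: in_keys_iff lookup_lower subset_iff split: if_splits)

subsection \<open>Power series with prescribed coefficients\<close>

text \<open>The power of the series variable is tied to the degree of the monomial. The shift \<open>\<delta>\<close> records how
  many more variables the power accounts for: it is \<open>2\<close> for generating functions of moments, where a
  word of length \<open>2 m\<close> goes with the power \<open>m + 1\<close>, and it drops by one with each extracted
  variable.\<close>

definition represents :: "nat \<Rightarrow> var set \<Rightarrow> polynomial fps \<Rightarrow> (monomial \<Rightarrow> complex) \<Rightarrow> bool" where
  "represents \<delta> V F \<phi> \<longleftrightarrow> (\<forall>j m. lookup (fps_nth F j) m = (if keys m \<subseteq> V \<and> total_degree m + \<delta> = 2 * j then \<phi> m else 0))"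

definition depends_on :: "var set \<Rightarrow> (monomial \<Rightarrow> 'a) \<Rightarrow> bool" where
  "depends_on V \<phi> \<longleftrightarrow> (\<forall>m m'. (\<forall>v\<in>V. lookup m v = lookup m' v) \<longrightarrow> \<phi> m = \<phi> m')"

lemma represents_cong:
  "represents \<delta> V F \<phi> \<Longrightarrow> (\<And>m. keys m \<subseteq> V \<Longrightarrow> \<phi> m = \<psi> m) \<Longrightarrow> represents \<delta> V F \<psi>"
  unfolding represents_def by auto

lemma represents_unique: "represents \<delta> V F \<phi> \<Longrightarrow> represents \<delta> V G \<phi> \<Longrightarrow> F = G"
  unfolding represents_def by (intro fps_ext poly_mapping_eqI) simp

lemma represents_zero: "represents \<delta> V 0 (\<lambda>_. 0)"
  unfolding represents_def by simp

lemma represents_one: "represents 0 {} 1 (\<lambda>_. 1)"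
  unfolding represents_def by (auto simp: lookup_one when_def total_degree_def)

lemma represents_add:
  "represents \<delta> V F \<phi> \<Longrightarrow> represents \<delta> V G \<psi> \<Longrightarrow> represents \<delta> V (F + G) (\<lambda>m. \<phi> m + \<psi> m)"
  unfolding represents_def by (simp add: lookup_add)

lemma represents_sum_list:
  "(\<And>x. x \<in> set xs \<Longrightarrow> represents \<delta> V (F x) (\<phi> x)) \<Longrightarrow> represents \<delta> V (\<Sum>x\<leftarrow>xs. F x) (\<lambda>m. \<Sum>x\<leftarrow>xs. \<phi> x m)"
  by (induction xs) (simp_all add: represents_zero represents_add)

lemma represents_superset:
  assumes "represents \<delta> V F \<phi>" "V \<subseteq> V'"
  shows "represents \<delta> V' F (\<lambda>m. if keys m \<subseteq> V then \<phi> m else 0)"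
  using assms unfolding represents_def by auto

lemma lookup_var_poly_mult: "lookup (var_poly v * P) m = (if lookup m v > 0 then lookup P (lower v m) else 0)"
proof -
  have "lookup (var_poly v * P) m = prod_fun (lookup (var_poly v)) (lookup P) m"
    by (simp add: times_poly_mapping.rep_eq)
  also have "\<dots> = (if \<exists>b. m = Poly_Mapping.single v 1 + b then lookup P (lower v m) else 0)"
    unfolding prod_fun_lookup by (simp add: var_poly_def lower_def)
  also have "(\<exists>b. m = Poly_Mapping.single v 1 + b) \<longleftrightarrow> lookup m v > 0"
  proof
    assume "lookup m v > 0"
    then have "m = Poly_Mapping.single v 1 + lower v m"
      by (intro poly_mapping_eqI) (auto simp: lookup_add lookup_lower lookup_single when_def)
    then show "\<exists>b. m = Poly_Mapping.single v 1 + b" ..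
  qed (auto simp: lookup_add)
  finally show ?thesis .
qed

lemma represents_var:
  assumes "represents (Suc \<delta>) V F \<phi>" "v \<in> V"
  shows "represents \<delta> V (fps_const (var_poly v) * F) (\<lambda>m. if lookup m v > 0 then \<phi> (lower v m) else 0)"
  unfolding represents_def
proof (intro allI)
  fix j m
  show "lookup (fps_nth (fps_const (var_poly v) * F) j) m
     = (if keys m \<subseteq> V \<and> total_degree m + \<delta> = 2 * j then if lookup m v > 0 then \<phi> (lower v m) else 0 else 0)"
    using assms(1) total_degree_lower[of m v] keys_lower_iff[OF assms(2)] unfolding represents_def
    by (auto simp: lookup_var_poly_mult)
qed

lemma represents_deriv:
  assumes "represents 2 V F \<phi>"
  shows "represents 0 V (fps_deriv F) (\<lambda>m. (of_nat (total_degree m) / 2 + 1) * \<phi> m)"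
  unfolding represents_def
proof (intro allI)
  fix j m
  have "lookup (of_nat n * P) m = of_nat n * lookup P m" for n and P :: polynomial
    by (induction n) (simp_all add: lookup_add algebra_simps)
  then have "lookup (fps_nth (fps_deriv F) j) m = of_nat (Suc j) * lookup (fps_nth F (Suc j)) m"
    by (simp only: fps_deriv_nth Suc_eq_plus1)
  then show "lookup (fps_nth (fps_deriv F) j) m
     = (if keys m \<subseteq> V \<and> total_degree m + 0 = 2 * j then (of_nat (total_degree m) / 2 + 1) * \<phi> m else 0)"
    using assms unfolding represents_def by auto
qed

lemma represents_exists:
  assumes "finite V"
  shows "\<exists>F. represents \<delta> V F \<phi>"
proof -
  let ?S = "\<lambda>j. {m. keys m \<subseteq> V \<and> total_degree m + \<delta> = 2 * j}"
  have fin: "finite (?S j)" for j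
  proof -
    have "inj_on lookup (?S j)" by (simp add: inj_on_def lookup_inject)
    moreover have "lookup ` ?S j \<subseteq> {f. \<forall>v. (v \<in> V \<longrightarrow> f v \<in> {..2 * j}) \<and> (v \<notin> V \<longrightarrow> f v = 0)}"
    proof safe
      fix m v assume m: "keys m \<subseteq> V" "total_degree m + \<delta> = 2 * j"
      show "lookup m v \<le> 2 * j" if "v \<in> V"
        using member_le_sum[OF that, of "lookup m"] assms m total_degree_superset[OF assms m(1)] by simp
      show "lookup m v = 0" if "v \<notin> V" using m that by (auto simp: in_keys_iff)
    qed
    moreover have "finite {f. \<forall>v. (v \<in> V \<longrightarrow> f v \<in> {..2 * j}) \<and> (v \<notin> V \<longrightarrow> f v = (0::nat))}"
      using assms by (intro finite_set_of_finite_funs) auto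
    ultimately show ?thesis by (meson finite_imageD finite_subset)
  qed
  define F where "F = Abs_fps (\<lambda>j. \<Sum>m\<in>?S j. Poly_Mapping.single m (\<phi> m))"
  have "lookup (fps_nth F j) m = (\<Sum>m'\<in>?S j. if m' = m then \<phi> m' else 0)" for j m
    unfolding F_def by (simp add: lookup_sum lookup_single when_def)
  then have "represents \<delta> V F \<phi>"
    unfolding represents_def by (intro allI) (simp only: sum.delta[OF fin] mem_Collect_eq)
  then show ?thesis ..
qed

definition mono_restrict :: "var set \<Rightarrow> monomial \<Rightarrow> monomial" where
  "mono_restrict V m = Abs_poly_mapping (\<lambda>v. if v \<in> V then lookup m v else 0)"

lemma lookup_mono_restrict: "lookup (mono_restrict V m) v = (if v \<in> V then lookup m v else 0)"
proof -
  have "finite {v. (if v \<in> V then lookup m v else 0) \<noteq> 0}"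
    by (rule finite_subset[OF _ finite_lookup[of m]]) auto
  then show ?thesis unfolding mono_restrict_def by simp
qed

lemma mono_restrict_add:
  assumes "keys a \<subseteq> V" "keys b \<subseteq> V'" "V \<inter> V' = {}"
  shows "mono_restrict V (a + b) = a" "mono_restrict V' (a + b) = b"
proof -
  have "lookup a v = 0" if "v \<notin> V" for v using assms(1) that by (auto simp: in_keys_iff)
  moreover have "lookup b v = 0" if "v \<notin> V'" for v using assms(2) that by (auto simp: in_keys_iff)
  ultimately show "mono_restrict V (a + b) = a" "mono_restrict V' (a + b) = b"
    using assms(3) by (intro poly_mapping_eqI; force simp: lookup_mono_restrict lookup_add)+
qed

lemma mono_restrict_sum:
  assumes "keys m \<subseteq> V \<union> V'" "V \<inter> V' = {}"
  shows "m = mono_restrict V m + mono_restrict V' m"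
  using assms by (auto intro!: poly_mapping_eqI simp: lookup_mono_restrict lookup_add in_keys_iff subset_iff)

lemma keys_mono_restrict: "keys (mono_restrict V m) \<subseteq> V"
  by (auto simp: in_keys_iff lookup_mono_restrict split: if_splits)

text \<open>A monomial in two disjoint groups of variables factors uniquely.\<close>

lemma lookup_mult_disjoint:
  fixes P Q :: polynomial
  assumes "\<And>a. lookup P a \<noteq> 0 \<Longrightarrow> keys a \<subseteq> V" "\<And>b. lookup Q b \<noteq> 0 \<Longrightarrow> keys b \<subseteq> V'" "V \<inter> V' = {}"
  shows "lookup (P * Q) m = (if keys m \<subseteq> V \<union> V' then lookup P (mono_restrict V m) * lookup Q (mono_restrict V' m)
      else 0)"
proof -
  have "lookup P a * (if \<exists>b. m = a + b then lookup Q (m - a) else 0)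
      = (if a = mono_restrict V m then if keys m \<subseteq> V \<union> V' then lookup P a * lookup Q (mono_restrict V' m) else 0
          else 0)"
    if "a \<in> keys P" for a
  proof (cases "\<exists>b. m = a + b")
    case True
    then obtain b where b: "m = a + b" by blast
    have a: "keys a \<subseteq> V" using that assms(1) by (simp add: in_keys_iff)
    show ?thesis
    proof (cases "lookup Q b = 0")
      case False
      then have b': "keys b \<subseteq> V'" by (rule assms(2))
      then have "keys m \<subseteq> V \<union> V'" using a keys_add[of a b] unfolding b by blast
      then show ?thesis using mono_restrict_add[OF a b' assms(3)] b by simp
    next
      case Q: True
      have "lookup Q (mono_restrict V' m) = 0" if "a = mono_restrict V m" "keys m \<subseteq> V \<union> V'"
      proof -
        have "m = a + mono_restrict V' m" using mono_restrict_sum[OF that(2) assms(3)] that(1) by simp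
        then have "mono_restrict V' m = b" using b by simp
        then show ?thesis using Q by simp
      qed
      then show ?thesis using b Q by auto
    qed
  next
    case False
    then have "\<not> (a = mono_restrict V m \<and> keys m \<subseteq> V \<union> V')" using mono_restrict_sum[of m V V'] assms(3) by blast
    then show ?thesis using False by auto
  qed
  then have "lookup (P * Q) m = (\<Sum>a\<in>keys P. if a
      = mono_restrict V m then if keys m \<subseteq> V \<union> V' then lookup P a * lookup Q (mono_restrict V' m) else 0 else 0)"
    unfolding times_poly_mapping.rep_eq prod_fun_lookup by (intro sum.cong) auto
  also have "\<dots> = (if keys m \<subseteq> V \<union> V' then lookup P (mono_restrict V m) * lookup Q (mono_restrict V' m) else 0)"
    by (subst sum.delta) (auto simp: in_keys_iff)
  finally show ?thesis .
qed

text \<open>The parity assumption excludes that the degree splits into two parts neither of which is matched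
  by a power of the series variable.\<close>

lemma represents_mult:
  assumes F: "represents \<delta> V F \<phi>" and G: "represents \<delta>' V' G \<psi>" and disj: "V \<inter> V' = {}"
    and dep: "depends_on V \<phi>" "depends_on V' \<psi>"
    and par: "\<And>m. keys m \<subseteq> V \<Longrightarrow> \<phi> m \<noteq> 0 \<Longrightarrow> even (total_degree m + \<delta>)"
  shows "represents (\<delta> + \<delta>') (V \<union> V') (F * G) (\<lambda>m. \<phi> m * \<psi> m)"
  unfolding represents_def
proof (intro allI)
  fix j m
  let ?a = "mono_restrict V m" and ?b = "mono_restrict V' m"
  have l: "lookup (fps_nth F i * fps_nth G i') m
      = (if keys m \<subseteq> V \<union> V' then lookup (fps_nth F i) ?a * lookup (fps_nth G i') ?b else 0)" for i i'
    by (rule lookup_mult_disjoint[OF _ _ disj]) (use F G in \<open>auto simp: represents_def split: if_splits\<close>)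
  have \<phi>: "\<phi> ?a = \<phi> m" and \<psi>: "\<psi> ?b = \<psi> m"
    using dep unfolding depends_on_def by (auto simp: lookup_mono_restrict)
  have terms: "lookup (fps_nth F i) ?a * lookup (fps_nth G i') ?b
      = (if total_degree ?a + \<delta> = 2 * i \<and> total_degree ?b + \<delta>' = 2 * i' then \<phi> m * \<psi> m else 0)" for i i'
    using F G keys_mono_restrict \<phi> \<psi> unfolding represents_def by simp
  show "lookup (fps_nth (F * G) j) m
      = (if keys m \<subseteq> V \<union> V' \<and> total_degree m + (\<delta> + \<delta>') = 2 * j then \<phi> m * \<psi> m else 0)"
  proof (cases "keys m \<subseteq> V \<union> V'")
    case True
    have deg: "total_degree m = total_degree ?a + total_degree ?b"
      using mono_restrict_sum[OF True disj] by (metis total_degree_add)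
    have "lookup (fps_nth (F * G) j) m = (\<Sum>i=0..j. if total_degree ?a + \<delta> = 2 * i \<and> total_degree ?b + \<delta>'
        = 2 * (j - i) then \<phi> m * \<psi> m else 0)"
      using True by (simp add: fps_mult_nth lookup_sum l terms)
    also have "\<dots> = (if total_degree m + (\<delta> + \<delta>') = 2 * j then \<phi> m * \<psi> m else 0)"
    proof (cases "total_degree m + (\<delta> + \<delta>') = 2 * j \<and> \<phi> m \<noteq> 0")
      case c: True
      then have "even (total_degree ?a + \<delta>)" using par[of ?a] keys_mono_restrict \<phi> by simp
      then obtain i0 where i0: "total_degree ?a + \<delta> = 2 * i0" by (elim evenE)
      have "(total_degree ?a + \<delta> = 2 * i \<and> total_degree ?b + \<delta>' = 2 * (j - i)) \<longleftrightarrow> i = i0" if "i \<le> j" for i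
        using c deg i0 that by auto
      then have "(\<Sum>i=0..j. if total_degree ?a + \<delta> = 2 * i \<and> total_degree ?b + \<delta>' = 2 * (j - i) then \<phi> m * \<psi> m else 0)
          = (\<Sum>i=0..j. if i = i0 then \<phi> m * \<psi> m else 0)"
        by (intro sum.cong) auto
      also have "\<dots> = \<phi> m * \<psi> m" using c deg i0 by simp
      finally show ?thesis using c by simp
    next
      case False
      then have "(if total_degree ?a + \<delta> = 2 * i \<and> total_degree ?b + \<delta>' = 2 * (j - i) then \<phi> m * \<psi> m else 0) = 0"
        if "i \<in> {0..j}" for i using deg that by auto
      then show ?thesis using False by (auto intro!: sum.neutral)
    qed
    finally show ?thesis using True by simp
  next
    case False
    then show ?thesis by (simp add: fps_mult_nth lookup_sum l)
  qed
qed

text \<open>The generating function of the moments of the block words over \<open>I\<close>, in which a word of length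
  \<open>2 m\<close> is weighted by the \<open>(m + 1)\<close>-st power of the series variable. This weight turns the factor
  \<open>m + 1\<close> of the recursion into a derivative.\<close>

definition moment_gf :: "nat list \<Rightarrow> polynomial fps" where
  "moment_gf I = (SOME F. represents 2 (vars_of I) F (\<lambda>m. mu (block_word I m)))"

lemma represents_moment_gf: "represents 2 (vars_of I) (moment_gf I) (\<lambda>m. mu (block_word I m))"
  unfolding moment_gf_def by (rule someI_ex[OF represents_exists]) simp

lemma moment_gf_rotate: "distinct (I @ J) \<Longrightarrow> moment_gf (I @ J) = moment_gf (J @ I)"
proof (rule represents_unique)
  show "represents 2 (vars_of (I @ J)) (moment_gf (I @ J)) (\<lambda>m. mu (block_word (I @ J) m))"
      by (rule represents_moment_gf)
  have "represents 2 (vars_of (J @ I)) (moment_gf (J @ I)) (\<lambda>m. mu (block_word (J @ I) m))"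
      by (rule represents_moment_gf)
  then show "represents 2 (vars_of (I @ J)) (moment_gf (J @ I)) (\<lambda>m. mu (block_word (I @ J) m))"
    by (simp add: mu_rotate[of "block_word J _"] Un_commute)
qed

text \<open>An excursion that leaves the new index at the first index of \<open>J\<close> and returns at the last one uses
  up one \<open>Adj\<close> of the former and one \<open>Opr\<close> of the latter.\<close>

definition loop_gf :: "nat list \<Rightarrow> polynomial fps" where
  "loop_gf J = fps_const (var_poly (Z (hd J))) * (fps_const (var_poly (W (last J))) * moment_gf J)"

definition loop_coef :: "nat list \<Rightarrow> monomial \<Rightarrow> complex" where
  "loop_coef J m = (if lookup m (Z (hd J)) > 0 then
     if lookup (lower (Z (hd J)) m) (W (last J)) > 0 then mu (block_word J (lower (W (last J)) (lower (Z (hd J))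
         m))) else 0 else 0)"

lemma represents_loop_gf: "J \<noteq> [] \<Longrightarrow> represents 0 (vars_of J) (loop_gf J) (loop_coef J)"
  unfolding loop_gf_def loop_coef_def[abs_def]
  by (intro represents_var represents_moment_gf[unfolded numeral_2_eq_2]) auto

text \<open>Paths that start at the new index, read along the list of indices. The first index is skipped (its
  exponents are zero), or a final excursion starts there (\<open>H\<close>), or an excursion over \<open>J\<close> starts there
  and the path continues with \<open>K\<close>; \<open>c\<close> is the contribution of a path that ends at the new index.
  An excursion uses an \<open>Adj\<close> of its first and an \<open>Opr\<close> of its last index, while skipped indices have
  zero exponents; hence a path determines these choices even if some exponents vanish.\<close>

function chain :: "polynomial fps \<Rightarrow> (nat list \<Rightarrow> polynomial fps) \<Rightarrow> nat list \<Rightarrow> polynomial fps" where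
  "chain c H [] = c"
| "chain c H (i # I) = chain c H I + H (i # I) + (\<Sum>(J, K)\<leftarrow>breaks (i # I). loop_gf J * chain c H K)"
  by pat_completeness auto
termination
proof (relation "Wellfounded.measure (\<lambda>(c, H, I). length I)", goal_cases)
  case (3 c H i I x J K)
  then have "i # I = J @ K" "J \<noteq> []" using breaks_eq[of J K "i # I"] by simp_all
  then have "length (i # I) = length J + length K" by (metis length_append)
  then show ?case using \<open>J \<noteq> []\<close> by (cases J) auto
qed auto

declare chain.simps(2) [simp del]

lemma loop_coef_even:
  assumes "keys m \<subseteq> vars_of J" "J \<noteq> []" "distinct J" "loop_coef J m \<noteq> 0"
  shows "even (total_degree m)"
proof -
  let ?z = "Z (hd J)" and ?w = "W (last J)"
  let ?m = "lower ?w (lower ?z m)"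
  from assms(4) have pos: "lookup m ?z > 0" "lookup (lower ?z m) ?w > 0" and mu: "mu (block_word J ?m) \<noteq> 0"
    by (auto simp: loop_coef_def split: if_splits)
  have "even (length (block_word J ?m))" using mu mu_unbalanced excess_odd by blast
  moreover have "keys ?m \<subseteq> vars_of J" using assms(1) keys_lower by blast
  ultimately have "even (total_degree ?m)" using length_block_word_total_degree[OF assms(3)] by simp
  then show ?thesis using total_degree_lower[OF pos(1)] total_degree_lower[OF pos(2)]
    by (metis even_Suc)
qed

lemma loop_coef_depends: "J \<noteq> [] \<Longrightarrow> depends_on (vars_of J) (loop_coef J)"
  unfolding depends_on_def
proof (intro allI impI)
  fix m m' :: monomial assume J: "J \<noteq> []" and eq: "\<forall>v\<in>vars_of J. lookup m v = lookup m' v"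
  have "block_word J (lower (W (last J)) (lower (Z (hd J)) m))
      = block_word J (lower (W (last J)) (lower (Z (hd J)) m'))"
    using eq J by (intro block_word_cong) (auto simp: lookup_lower)
  then show "loop_coef J m = loop_coef J m'"
    using J eq by (simp add: loop_coef_def lookup_lower)
qed

text \<open>The recursion of \<open>chain\<close> on lists of indices computes any weight \<open>X\<close> that satisfies the recursion for
  words. \<open>V'\<close> holds the variables of the indices passed before the first visit.\<close>

lemma represents_chain:
  assumes "distinct I" "vars_of I \<inter> V' = {}"
    and X: "\<And>m p. X m (Opr # p) = 0" "\<And>m p. X m (Adj # p) = h m p + (\<Sum>(a, b)\<leftarrow>splits Opr p. mu a * X m b)"
    and dep: "\<And>p. depends_on V' (\<lambda>m. X m p)"
    and c: "represents \<delta> V' c (\<lambda>m. X m [])"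
    and H: "\<And>K. K \<noteq> [] \<Longrightarrow> distinct K \<Longrightarrow> vars_of K \<inter> V' = {} \<Longrightarrow>
      represents \<delta> (vars_of K \<union> V') (H K) (\<lambda>m.
          if lookup m (Z (hd K)) > 0 then h m (block_word K (lower (Z (hd K)) m)) else 0)"
  shows "represents \<delta> (vars_of I \<union> V') (chain c H I) (\<lambda>m. X m (block_word I m))"
  using assms(1,2)
proof (induction I rule: length_induct)
  case (1 I)
  show ?case
  proof (cases I)
    case Nil
    then show ?thesis using c by simp
  next
    case (Cons i I')
    let ?V = "vars_of I \<union> V'"
    have i: "i \<notin> set I'" using 1 Cons by simp
    have r1: "represents \<delta> ?V (chain c H I') (\<lambda>m. if keys m \<subseteq> vars_of I' \<union> V' then X m (block_word I' m) else 0)"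
      by (rule represents_superset[of _ "vars_of I' \<union> V'"]) (use 1 Cons in auto)
    have r2: "represents \<delta> ?V (H I) (\<lambda>m. if lookup m (Z i) > 0 then h m (block_word I (lower (Z i) m)) else 0)"
    proof -
      have hd: "hd I = i" and "I \<noteq> []" "distinct I" "vars_of I \<inter> V' = {}" using 1 Cons by simp_all
      from H[OF this(2-4)] show ?thesis by (simp only: hd)
    qed
    have r3: "represents \<delta> ?V (loop_gf J * chain c H K) (\<lambda>m. loop_coef J m * X m (block_word K m))"
      if JK: "(J, K) \<in> set (breaks I)" for J K
    proof -
      have IJK: "I = J @ K" "J \<noteq> []" using breaks_eq[OF JK] by auto
      have K: "represents \<delta> (vars_of K \<union> V') (chain c H K) (\<lambda>m. X m (block_word K m))"
        using 1 IJK by (intro 1(1)[rule_format]) auto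
      have "vars_of J \<inter> vars_of K = {}" using 1 IJK by (auto simp: vars_of_def)
      then have disj: "vars_of J \<inter> (vars_of K \<union> V') = {}" using 1 IJK by auto
      have "represents (0 + \<delta>) (vars_of J \<union> (vars_of K \<union> V')) (loop_gf J * chain c H K) (\<lambda>m. loop_coef J m
          * X m (block_word K m))"
      proof (rule represents_mult[OF represents_loop_gf K disj])
        show "depends_on (vars_of K \<union> V') (\<lambda>m. X m (block_word K m))"
          unfolding depends_on_def
        proof (intro allI impI)
          fix m m' :: monomial assume eq: "\<forall>v\<in>vars_of K \<union> V'. lookup m v = lookup m' v"
          then have "block_word K m = block_word K m'" by (intro block_word_cong) auto
          then show "X m (block_word K m) = X m' (block_word K m')"
            using dep[of "block_word K m"] eq unfolding depends_on_def by auto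
        qed
        show "even (total_degree m + 0)" if "keys m \<subseteq> vars_of J" "loop_coef J m \<noteq> 0" for m
          using loop_coef_even[OF that(1) IJK(2) _ that(2)] 1 IJK by simp
      qed (use IJK loop_coef_depends in auto)
      then show ?thesis using IJK by (simp add: Un_assoc)
    qed
    have "represents \<delta> ?V (\<Sum>(J, K)\<leftarrow>breaks I. loop_gf J * chain c H K) (\<lambda>m. \<Sum>x\<leftarrow>breaks I. loop_coef (fst x) m
        * X m (block_word (snd x) m))"
      unfolding split_def by (rule represents_sum_list) (use r3 in auto)
    from represents_add[OF represents_add[OF r1 r2] this]
    have "represents \<delta> ?V (chain c H I) (\<lambda>m. (if keys m \<subseteq> vars_of I' \<union> V' then X m (block_word I' m) else 0)
       + (if lookup m (Z i) > 0 then h m (block_word I (lower (Z i) m)) else 0)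
       + (\<Sum>x\<leftarrow>breaks I. loop_coef (fst x) m * X m (block_word (snd x) m)))"
      unfolding Cons chain.simps(2) .
    then show ?thesis
    proof (rule represents_cong)
      fix m :: monomial assume m: "keys m \<subseteq> ?V"
      have hd: "hd (fst x) = i" if "x \<in> set (breaks I)" for x
        using breaks_hd[of "fst x" "snd x" i I'] that Cons by simp
      have ZW: "i \<notin> set I'" "Z i \<notin> V'" "W i \<notin> V'" using 1 Cons by auto
      have keys: "keys m \<subseteq> vars_of I' \<union> V' \<longleftrightarrow> lookup m (Z i) = 0 \<and> lookup m (W i) = 0"
      proof -
        have "keys m \<subseteq> insert (Z i) (insert (W i) (vars_of I' \<union> V'))" using m Cons by simp
        moreover have "Z i \<notin> vars_of I' \<union> V'" "W i \<notin> vars_of I' \<union> V'" using ZW by simp_all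
        ultimately have "keys m \<subseteq> vars_of I' \<union> V' \<longleftrightarrow> Z i \<notin> keys m \<and> W i \<notin> keys m" by blast
        then show ?thesis by (simp add: in_keys_iff)
      qed
      let ?S = "\<Sum>x\<leftarrow>breaks I. loop_coef (fst x) m * X m (block_word (snd x) m)"
      show "(if keys m \<subseteq> vars_of I' \<union> V' then X m (block_word I' m) else 0)
       + (if lookup m (Z i) > 0 then h m (block_word I (lower (Z i) m)) else 0) + ?S = X m (block_word I m)"
      proof (cases "lookup m (Z i)")
        case 0
        then have "loop_coef (fst x) m = 0" if "x \<in> set (breaks I)" for x
          using hd[OF that] by (simp add: loop_coef_def)
        then have "?S = (\<Sum>x\<leftarrow>breaks I. 0)" by (intro arg_cong[where f = sum_list] map_cong) auto
        then have S: "?S = 0" by simp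
        show ?thesis
        proof (cases "lookup m (W i)")
          case 0
          then show ?thesis using S \<open>lookup m (Z i) = 0\<close> keys Cons by simp
        next
          case (Suc w)
          then show ?thesis using S \<open>lookup m (Z i) = 0\<close> keys Cons X(1) by simp
        qed
      next
        case (Suc k)
        let ?m = "lower (Z i) m"
        have w: "block_word I m = Adj # block_word I ?m"
          using Suc ZW(1) Cons block_word_lower[of "Z i" I' m] by (simp add: lookup_lower)
        have "X m (block_word I m) = h m (block_word I ?m) + (\<Sum>(a, b)\<leftarrow>splits Opr (block_word I ?m). mu a * X m b)"
          unfolding w X(2) ..
        also have "(\<Sum>(a, b)\<leftarrow>splits Opr (block_word I ?m). mu a * X m b)
           = (\<Sum>(J, K)\<leftarrow>breaks I. if lookup ?m (W (last J)) > 0 then mu (block_word J (lower (W (last J)) ?m)) * X m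
               (block_word K ?m) else 0)"
          using 1 X(1) by (intro splits_block_word) auto
        also have "\<dots> = ?S"
        proof (intro arg_cong[where f = sum_list] map_cong refl)
          fix x assume x: "x \<in> set (breaks I)"
          obtain J K where JK: "x = (J, K)" by (cases x)
          have "I = J @ K" "J \<noteq> []" using x JK breaks_eq[of J K I] by auto
          then have "i \<notin> set K" using ZW(1) Cons by (cases J) auto
          then have "block_word K ?m = block_word K m" by (intro block_word_lower) simp
          then show "(case x of (J, K) \<Rightarrow> if lookup ?m (W (last J)) > 0
              then mu (block_word J (lower (W (last J)) ?m)) * X m (block_word K ?m) else 0)
             = loop_coef (fst x) m * X m (block_word (snd x) m)"
            using hd[OF x] Suc by (simp add: loop_coef_def JK)
        qed
        finally show ?thesis using Suc keys by simp
      qed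
    qed
  qed
qed

definition loops_gf :: "nat list \<Rightarrow> polynomial fps" where
  "loops_gf = chain 1 (\<lambda>_. 0)"

text \<open>Here \<open>J\<close> is the list of indices passed before the first visit; it closes up cyclically with the last
  excursion.\<close>

definition exits_gf :: "nat list \<Rightarrow> nat list \<Rightarrow> polynomial fps" where
  "exits_gf J = chain 0 (\<lambda>K. fps_const (var_poly (Z (hd K))) * moment_gf (K @ J))"

lemma represents_loops_gf: "distinct I \<Longrightarrow> represents 0 (vars_of I) (loops_gf I) (\<lambda>m. loops_weight (block_word I m))"
  unfolding loops_gf_def
  using represents_chain[of I "{}" "\<lambda>_. loops_weight" "\<lambda>_ _. 0" 0 1 "\<lambda>_. 0"] represents_zero represents_one
  by (simp add: loops_weight_simps depends_on_def)

lemma represents_exits_gf: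
  assumes "distinct (J @ K)"
  shows "represents 1 (vars_of K \<union> vars_of J) (exits_gf J K) (\<lambda>m. exits_weight (block_word J m) (block_word K m))"
  unfolding exits_gf_def
proof (rule represents_chain[where h = "\<lambda>m p. mu (p @ block_word J m)"])
  show "distinct K" using assms by simp
  show "vars_of K \<inter> vars_of J = {}" using assms by (auto simp: vars_of_def)
  show "depends_on (vars_of J) (\<lambda>m. exits_weight (block_word J m) p)" for p
    unfolding depends_on_def
  proof (intro allI impI)
    fix m m' :: monomial assume "\<forall>v\<in>vars_of J. lookup m v = lookup m' v"
    then have "block_word J m = block_word J m'" by (intro block_word_cong) auto
    then show "exits_weight (block_word J m) p = exits_weight (block_word J m') p" by simp
  qed
  show "represents 1 (vars_of J) 0 (\<lambda>m. exits_weight (block_word J m) [])"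
      by (simp add: exits_weight_simps represents_zero)
  fix L assume L: "L \<noteq> []" "distinct L" "vars_of L \<inter> vars_of J = {}"
  have "represents 1 (vars_of (L @ J)) (fps_const (var_poly (Z (hd L))) * moment_gf (L @ J))
     (\<lambda>m. if lookup m (Z (hd L)) > 0 then mu (block_word (L @ J) (lower (Z (hd L)) m)) else 0)"
    using L represents_moment_gf[of "L @ J"] by (intro represents_var) (auto simp: numeral_2_eq_2)
  moreover have "Z (hd L) \<notin> vars_of J" using L by (cases L) (auto simp: vars_of_def)
  ultimately show "represents 1 (vars_of L \<union> vars_of J) (fps_const (var_poly (Z (hd L))) * moment_gf (L @ J))
     (\<lambda>m. if lookup m (Z (hd L)) > 0 then mu (block_word L (lower (Z (hd L)) m) @ block_word J m) else 0)"
    by (simp add: block_word_lower cong: if_cong)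
qed (simp_all add: exits_weight_simps)

text \<open>The recursion for \<open>mu\<close> as a differential equation for generating functions.\<close>

theorem moment_gf_deriv:
  assumes "distinct I"
  shows "fps_deriv (moment_gf I) = loops_gf I + (\<Sum>(J, K)\<leftarrow>breaks I. fps_const (var_poly (W (last J))) * exits_gf J K)"
proof (rule represents_unique)
  have "represents 0 (vars_of I) (fps_deriv (moment_gf I)) (\<lambda>m. (of_nat (total_degree m) / 2
      + 1) * mu (block_word I m))"
    by (rule represents_deriv[OF represents_moment_gf])
  then show "represents 0 (vars_of I) (fps_deriv (moment_gf I)) (\<lambda>m. (of_nat (length (block_word I m)) / 2
      + 1) * mu (block_word I m))"
    by (rule represents_cong) (simp add: length_block_word_total_degree assms)
  have r: "represents 0 (vars_of I) (fps_const (var_poly (W (last J))) * exits_gf J K)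
     (\<lambda>m. if lookup m (W (last J)) > 0 then exits_weight (block_word J (lower (W (last J)) m)) (block_word K m) else 0)"
    if JK: "(J, K) \<in> set (breaks I)" for J K
  proof -
    have IJK: "I = J @ K" "J \<noteq> []" using breaks_eq[OF JK] by auto
    have "represents 1 (vars_of I) (exits_gf J K) (\<lambda>m. exits_weight (block_word J m) (block_word K m))"
      using represents_exits_gf[of J K] assms IJK by (simp add: Un_commute)
    then have "represents 0 (vars_of I) (fps_const (var_poly (W (last J))) * exits_gf J K)
      (\<lambda>m. if lookup m (W (last J)) > 0 then exits_weight (block_word J (lower (W (last J)) m)) (block_word K (lower
          (W (last J)) m)) else 0)"
      using IJK by (intro represents_var) auto
    moreover have "last J \<notin> set K" using assms IJK(1) last_in_set[OF IJK(2)] by auto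
    ultimately show ?thesis by (simp add: block_word_lower cong: if_cong)
  qed
  have "represents 0 (vars_of I) (\<Sum>(J, K)\<leftarrow>breaks I. fps_const (var_poly (W (last J))) * exits_gf J K)
     (\<lambda>m. \<Sum>x\<leftarrow>breaks I. if lookup m (W (last (fst x))) > 0 then exits_weight (block_word (fst x) (lower (W (last (fst
         x))) m)) (block_word (snd x) m) else 0)"
    unfolding split_def by (rule represents_sum_list) (use r in auto)
  from represents_add[OF represents_loops_gf[OF assms] this]
  show "represents 0 (vars_of I) (loops_gf I + (\<Sum>(J, K)\<leftarrow>breaks I. fps_const (var_poly (W (last J))) * exits_gf J K))
     (\<lambda>m. (of_nat (length (block_word I m)) / 2 + 1) * mu (block_word I m))"
    unfolding mu_splits splits_block_word[of exits_weight, OF exits_weight_simps(2) assms] by (simp add: split_def)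
qed

section \<open>Iterated convolutions of exponentials\<close>

lemma lookup_of_nat_mult: "lookup (of_nat n * P) m = of_nat n * lookup P m" for P :: polynomial
  by (induction n) (simp_all add: lookup_add algebra_simps)

text \<open>The ring of polynomials is torsion-free because its coefficients are complex numbers; this makes
  linear differential equations with polynomial coefficients uniquely solvable.\<close>

lemma of_nat_Suc_mult_cancel: "of_nat (Suc n) * P = of_nat (Suc n) * Q \<Longrightarrow> P = Q" for P Q :: polynomial
proof (rule poly_mapping_eqI)
  fix m assume "of_nat (Suc n) * P = of_nat (Suc n) * Q"
  then have "of_nat (Suc n) * lookup P m = of_nat (Suc n) * lookup Q m"
    by (metis lookup_of_nat_mult)
  then show "lookup P m = lookup Q m" by (simp del: of_nat_Suc)
qed

lemma fps_linear_ode_unique: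
  fixes X Y R :: "polynomial fps"
  assumes "fps_deriv X = fps_const u * X + R" "fps_deriv Y = fps_const u * Y + R"
    and "fps_nth X 0 = fps_nth Y 0"
  shows "X = Y"
proof (rule fps_ext)
  fix n show "fps_nth X n = fps_nth Y n"
  proof (induction n)
    case (Suc n)
    have "of_nat (Suc n) * fps_nth X (Suc n) = u * fps_nth X n + fps_nth R n"
      using arg_cong[OF assms(1), of "\<lambda>F. fps_nth F n"] by simp
    moreover have "of_nat (Suc n) * fps_nth Y (Suc n) = u * fps_nth Y n + fps_nth R n"
      using arg_cong[OF assms(2), of "\<lambda>F. fps_nth F n"] by simp
    ultimately show ?case using Suc of_nat_Suc_mult_cancel by metis
  qed (rule assms(3))
qed

text \<open>For \<open>l\<close> arguments and \<open>n \<ge> l - 1\<close>, the complete homogeneous symmetric polynomial of degree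
  \<open>n - (l - 1)\<close> in the arguments.\<close>

fun hurwitz :: "polynomial list \<Rightarrow> nat \<Rightarrow> polynomial" where
  "hurwitz [] n = 0"
| "hurwitz (u # us) 0 = (if us = [] then 1 else 0)"
| "hurwitz (u # us) (Suc n) = u * hurwitz (u # us) n + hurwitz us n"

text \<open>The iterated convolution of the exponentials with the given exponents, as \<open>exp_conv_deriv\<close> shows.
  The formal Laplace transform, which replaces the \<open>n\<close>-th power of the series variable by \<open>n!\<close>, takes
  it to the sum of the \<open>hurwitz\<close> polynomials, that is, to the product of the \<open>1 / (1 - u)\<close>.\<close>

definition exp_conv :: "polynomial list \<Rightarrow> polynomial fps" where
  "exp_conv us = Abs_fps (\<lambda>n. Poly_Mapping.single 0 (1 / fact n) * hurwitz us n)"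

lemma exp_conv_Nil [simp]: "exp_conv [] = 0"
  by (simp add: exp_conv_def fps_eq_iff)

lemma exp_conv_nth_0: "fps_nth (exp_conv (u # us)) 0 = (if us = [] then 1 else 0)"
  by (simp add: exp_conv_def)

lemma exp_conv_deriv: "fps_deriv (exp_conv (u # us)) = fps_const u * exp_conv (u # us) + exp_conv us"
proof (rule fps_ext)
  fix n
  have "of_nat (Suc n) * Poly_Mapping.single 0 (1 / fact (Suc n)) = (Poly_Mapping.single 0 (1 / fact n) :: polynomial)"
  proof -
    have "of_nat (Suc n) * (1 / fact (Suc n)) = (1 / fact n :: complex)"
      by (simp add: fact_Suc del: of_nat_Suc)
    then show ?thesis by (simp only: of_nat_single mult_single add_0 o_apply)
  qed
  then have "of_nat (Suc n) * fps_nth (exp_conv (u # us)) (Suc n)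
      = Poly_Mapping.single 0 (1 / fact n) * hurwitz (u # us) (Suc n)"
    unfolding exp_conv_def fps_nth_Abs_fps by (metis mult.assoc)
  then have "fps_nth (fps_deriv (exp_conv (u # us))) n = Poly_Mapping.single 0 (1 / fact n) * hurwitz (u # us) (Suc n)"
    by (simp only: fps_deriv_nth Suc_eq_plus1)
  then show "fps_nth (fps_deriv (exp_conv (u # us))) n = fps_nth (fps_const u * exp_conv (u # us) + exp_conv us) n"
    by (simp add: exp_conv_def algebra_simps)
qed

text \<open>Monotone lattice paths from one corner of a grid to the opposite one. They index the simplices of
  the standard triangulation of a product of two simplices.\<close>

fun lattice_paths :: "'a list \<Rightarrow> 'b list \<Rightarrow> ('a \<times> 'b) list list" where
  "lattice_paths [] bs = []"
| "lattice_paths (u # us) [] = []"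
| "lattice_paths (u # us) (v # bs) = (if us = [] \<and> bs = [] then [[(u, v)]]
     else map (\<lambda>p. (u, v) # p) (lattice_paths us (v # bs) @ lattice_paths (u # us) bs))"

lemma lattice_paths_length: "p \<in> set (lattice_paths us bs) \<Longrightarrow> Suc (length p) = length us + length bs"
  by (induction us bs arbitrary: p rule: lattice_paths.induct) (auto split: if_splits)

lemma lattice_paths_set: "p \<in> set (lattice_paths us bs) \<Longrightarrow> set p \<subseteq> set us \<times> set bs"
  by (induction us bs arbitrary: p rule: lattice_paths.induct) (fastforce split: if_splits)+

lemma lattice_paths_distinct:
  "p \<in> set (lattice_paths us bs) \<Longrightarrow> distinct us \<Longrightarrow> distinct bs \<Longrightarrow> distinct p"
proof (induction us bs arbitrary: p rule: lattice_paths.induct)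
  case (3 u us v bs)
  show ?case
  proof (cases "us = [] \<and> bs = []")
    case False
    then obtain q where q: "p = (u, v) # q" "q \<in> set (lattice_paths us (v # bs)) \<or> q \<in> set (lattice_paths (u # us) bs)"
      using 3(3) by auto
    from q(2) have "distinct q \<and> (u, v) \<notin> set q"
    proof
      assume h: "q \<in> set (lattice_paths us (v # bs))"
      show ?thesis using 3(1)[OF False h] 3(4,5) lattice_paths_set[OF h] by auto
    next
      assume h: "q \<in> set (lattice_paths (u # us) bs)"
      show ?thesis using 3(2)[OF False h] 3(4,5) lattice_paths_set[OF h] by auto
    qed
    then show ?thesis using q(1) by simp
  qed (use 3(3) in simp)
qed auto

text \<open>Both sides solve the same linear differential equation. Geometrically, an iterated convolution is an
  integral over a simplex, and the product of two simplices is cut into simplices indexed by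
  lattice paths.\<close>

lemma exp_conv_mult:
  "exp_conv (map f us) * exp_conv (map g bs) = (\<Sum>p\<leftarrow>lattice_paths us bs. exp_conv (map (\<lambda>(a, b). f a + g b) p))"
proof (induction us bs rule: lattice_paths.induct)
  case (3 u us v bs)
  let ?h = "\<lambda>(a, b). f a + g b"
  let ?F = "exp_conv (map f (u # us))" and ?G = "exp_conv (map g (v # bs))"
  let ?w = "f u + g v"
  have deriv: "fps_deriv (?F * ?G) = fps_const ?w * (?F * ?G) + (exp_conv (map f us) * ?G + ?F * exp_conv (map g bs))"
    by (simp add: exp_conv_deriv algebra_simps flip: fps_const_add)
  show ?case
  proof (cases "us = [] \<and> bs = []")
    case True
    have "?F * ?G = exp_conv [?w]"
      by (rule fps_linear_ode_unique[OF deriv]) (use True in \<open>simp_all add: exp_conv_deriv exp_conv_nth_0\<close>)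
    then show ?thesis using True by simp
  next
    case False
    let ?P = "lattice_paths us (v # bs) @ lattice_paths (u # us) bs"
    have ne: "p \<noteq> []" if "p \<in> set ?P" for p
      using that False by (auto dest!: lattice_paths_length)
    have d: "fps_deriv (\<Sum>p\<leftarrow>ps. exp_conv (?w # map ?h p)) = fps_const ?w * (\<Sum>p\<leftarrow>ps. exp_conv (?w # map ?h p))
        + (\<Sum>p\<leftarrow>ps. exp_conv (map ?h p))" for ps
      by (induction ps) (simp_all add: exp_conv_deriv algebra_simps)
    have z: "fps_nth (\<Sum>p\<leftarrow>ps. exp_conv (?w # map ?h p)) 0 = 0" if "\<And>p. p \<in> set ps \<Longrightarrow> p \<noteq> []" for ps
      using that by (induction ps) (simp_all add: exp_conv_nth_0)
    have "?F * ?G = (\<Sum>p\<leftarrow>?P. exp_conv (?w # map ?h p))"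
    proof (rule fps_linear_ode_unique[OF deriv])
      show "fps_deriv (\<Sum>p\<leftarrow>?P. exp_conv (?w # map ?h p))
         = fps_const ?w * (\<Sum>p\<leftarrow>?P. exp_conv (?w # map ?h p)) + (exp_conv (map f us) * ?G + ?F * exp_conv (map g bs))"
        unfolding d using 3(1)[OF False] 3(2)[OF False] by simp
      show "fps_nth (?F * ?G) 0 = fps_nth (\<Sum>p\<leftarrow>?P. exp_conv (?w # map ?h p)) 0"
      proof -
        have "fps_nth (?F * ?G) 0 = 0" using False by (auto simp: exp_conv_nth_0)
        moreover have "fps_nth (\<Sum>p\<leftarrow>?P. exp_conv (?w # map ?h p)) 0 = 0" by (rule z) (rule ne)
        ultimately show ?thesis by (simp only:)
      qed
    qed
    then show ?thesis using False by (auto simp: comp_def)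
  qed
qed simp_all

section \<open>Sums of admissible terms\<close>

definition upoly :: "nat set \<Rightarrow> (nat \<Rightarrow> nat) \<Rightarrow> polynomial" where
  "upoly A \<sigma> = (\<Sum>i\<in>A. var_poly (Z i) * var_poly (W (\<sigma> i)))"

definition term_gf :: "nat set \<Rightarrow> ratterm \<Rightarrow> polynomial fps" where
  "term_gf A t = fps_const (numerator t) * exp_conv (map (upoly A) (snd (snd t)))"

text \<open>The shape of the terms that survive the induction: the number of exponentials exceeds the number of
  variables \<open>z\<close> in the numerator by exactly \<open>c\<close>, with \<open>c = 2\<close> for generating functions of moments and
  \<open>c = 1\<close> for their products with one \<open>z\<close> and one \<open>w\<close>. \<open>P\<close> restricts the permutations that may occur,
  and is used to keep permutations distinct.\<close>

definition balanced :: "nat set \<Rightarrow> ((nat \<Rightarrow> nat) \<Rightarrow> bool) \<Rightarrow> nat \<Rightarrow> nat \<Rightarrow> ratterm \<Rightarrow> bool" where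
  "balanced A P c l = (\<lambda>(is, js, \<sigma>s). length js = length is \<and> length is + c = length \<sigma>s \<and> length \<sigma>s \<le> l \<and>
     set is \<subseteq> A \<and> set js \<subseteq> A \<and> (\<forall>\<sigma>\<in>set \<sigma>s. \<sigma> permutes A \<and> P \<sigma>) \<and> distinct \<sigma>s)"

definition spanned :: "nat set \<Rightarrow> ((nat \<Rightarrow> nat) \<Rightarrow> bool) \<Rightarrow> nat \<Rightarrow> nat \<Rightarrow> polynomial fps \<Rightarrow> bool" where
  "spanned A P c l F \<longleftrightarrow> (\<exists>ts. (\<forall>t\<in>set ts. balanced A P c l t) \<and> F = (\<Sum>t\<leftarrow>ts. term_gf A t))"

lemma spanned_zero: "spanned A P c l 0"
  unfolding spanned_def by (rule exI[of _ "[]"]) simp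

lemma spanned_add: "spanned A P c l F \<Longrightarrow> spanned A P c l G \<Longrightarrow> spanned A P c l (F + G)"
proof -
  assume "spanned A P c l F" "spanned A P c l G"
  then obtain ts ts' where "\<forall>t\<in>set ts. balanced A P c l t" "F = (\<Sum>t\<leftarrow>ts. term_gf A t)"
    "\<forall>t\<in>set ts'. balanced A P c l t" "G = (\<Sum>t\<leftarrow>ts'. term_gf A t)" unfolding spanned_def by blast
  then show "spanned A P c l (F + G)" unfolding spanned_def by (intro exI[of _ "ts @ ts'"]) auto
qed

lemma spanned_sum_list: "(\<And>x. x \<in> set xs \<Longrightarrow> spanned A P c l (F x)) \<Longrightarrow> spanned A P c l (\<Sum>x\<leftarrow>xs. F x)"
  by (induction xs) (simp_all add: spanned_zero spanned_add)

lemma spanned_mono: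
  assumes "spanned A P c l F" "\<And>\<sigma>. \<sigma> permutes A \<Longrightarrow> P \<sigma> \<Longrightarrow> Q \<sigma>" "l \<le> l'"
  shows "spanned A Q c l' F"
proof -
  have "balanced A Q c l' t" if "balanced A P c l t" for t
    using that assms(2,3) by (cases t) (auto simp: balanced_def)
  then show ?thesis using assms(1) unfolding spanned_def by blast
qed

lemma spanned_var_mult:
  assumes "spanned A P (Suc c) l F" "i \<in> A" "j \<in> A"
  shows "spanned A P c l (fps_const (var_poly (Z i)) * (fps_const (var_poly (W j)) * F))"
proof -
  obtain ts where ts: "\<forall>t\<in>set ts. balanced A P (Suc c) l t" "F = (\<Sum>t\<leftarrow>ts. term_gf A t)"
    using assms(1) unfolding spanned_def by blast
  let ?f = "\<lambda>t. (i # fst t, j # fst (snd t), snd (snd t))"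
  have "term_gf A (?f t) = fps_const (var_poly (Z i)) * (fps_const (var_poly (W j)) * term_gf A t)" for t
  proof -
    have "numerator (?f t) = var_poly (Z i) * (var_poly (W j) * numerator t)"
      by (simp add: numerator_def split_def ac_simps)
    then show ?thesis by (simp add: term_gf_def mult.assoc flip: fps_const_mult)
  qed
  then have "fps_const (var_poly (Z i)) * (fps_const (var_poly (W j)) * F) = (\<Sum>t\<leftarrow>map ?f ts. term_gf A t)"
    unfolding ts(2) by (simp add: comp_def sum_list_const_mult)
  moreover have "balanced A P c l (?f t)" if "balanced A P (Suc c) l t" for t
    using that assms(2,3) by (cases t) (auto simp: balanced_def)
  then have "\<forall>t\<in>set (map ?f ts). balanced A P c l t" using ts(1) by simp
  ultimately show ?thesis unfolding spanned_def by blast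
qed

lemma upoly_comp:
  assumes "finite A" "finite B" "A \<inter> B = {}" "\<sigma> permutes A" "\<rho> permutes B"
  shows "upoly (A \<union> B) (\<sigma> \<circ> \<rho>) = upoly A \<sigma> + upoly B \<rho>"
proof -
  have "(\<sigma> \<circ> \<rho>) i = \<sigma> i" if "i \<in> A" for i
  proof -
    have "i \<notin> B" using that assms(3) by blast
    then show ?thesis by (simp add: permutes_not_in[OF assms(5)])
  qed
  moreover have "(\<sigma> \<circ> \<rho>) i = \<rho> i" if "i \<in> B" for i
  proof -
    have "\<rho> i \<notin> A" using that assms(3) permutes_in_image[OF assms(5), of i] by blast
    then show ?thesis by (simp add: permutes_not_in[OF assms(4)])
  qed
  ultimately show ?thesis unfolding upoly_def using assms(1-3) by (simp add: sum.union_disjoint)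
qed

text \<open>Distinct pairs of permutations of two disjoint sets give distinct permutations of the union, so the
  vertices of a lattice path give distinct permutations.\<close>

lemma permutes_comp_inj:
  assumes "A \<inter> B = {}"
  shows "inj_on (\<lambda>(\<sigma>, \<rho>). \<sigma> \<circ> \<rho>) ({\<sigma>. \<sigma> permutes A} \<times> {\<rho>. \<rho> permutes B})"
proof (rule inj_onI, clarify)
  fix \<sigma> \<rho> \<sigma>' \<rho>'
  assume p: "\<sigma> permutes A" "\<rho> permutes B" "\<sigma>' permutes A" "\<rho>' permutes B" and eq: "\<sigma> \<circ> \<rho> = \<sigma>' \<circ> \<rho>'"
  have "\<sigma> x = \<sigma>' x" for x
  proof (cases "x \<in> A")
    case True
    then have "\<rho> x = x" "\<rho>' x = x" using p(2,4) assms by (auto intro!: permutes_not_in)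
    then show ?thesis using fun_cong[OF eq, of x] by simp
  qed (use p in \<open>simp add: permutes_not_in\<close>)
  then have "\<sigma> = \<sigma>'" by blast
  moreover have "inj \<sigma>'" using p(3) by (rule permutes_inj)
  ultimately show "\<sigma> = \<sigma>' \<and> \<rho> = \<rho>'" using eq by (auto simp: fun_eq_iff inj_def)
qed

text \<open>Products over disjoint sets of indices stay within the class with \<open>c = 1\<close>, as a lattice path through a
  \<open>p\<close> by \<open>q\<close> grid has \<open>p + q - 1\<close> vertices. All resulting permutations preserve both sets.\<close>

lemma spanned_mult:
  assumes fin: "finite A" "finite B" and disj: "A \<inter> B = {}"
    and F: "spanned A P 1 p F" and G: "spanned B Q 1 q G"
  shows "spanned (A \<union> B) (\<lambda>\<sigma>. \<forall>x\<in>A. \<sigma> x \<in> A) 1 (p + q - 1) (F * G)"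
proof -
  obtain ts where ts: "\<forall>t\<in>set ts. balanced A P 1 p t" "F = (\<Sum>t\<leftarrow>ts. term_gf A t)"
    using F unfolding spanned_def by blast
  obtain ts' where ts': "\<forall>t\<in>set ts'. balanced B Q 1 q t" "G = (\<Sum>t\<leftarrow>ts'. term_gf B t)"
    using G unfolding spanned_def by blast
  have one: "spanned (A \<union> B) (\<lambda>\<sigma>. \<forall>x\<in>A. \<sigma> x \<in> A) 1 (p + q - 1) (term_gf A t * term_gf B t')"
    if t: "balanced A P 1 p t" and t': "balanced B Q 1 q t'" for t t'
  proof -
    obtain "is" js \<sigma>s where td: "t = (is, js, \<sigma>s)" by (cases t)
    obtain is' js' \<rho>s where td': "t' = (is', js', \<rho>s)" by (cases t')
    let ?f = "\<lambda>r. (is @ is', js @ js', map (\<lambda>(\<sigma>, \<rho>). \<sigma> \<circ> \<rho>) r)"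
    have perm: "\<sigma> permutes A \<and> \<rho> permutes B" if "r \<in> set (lattice_paths \<sigma>s \<rho>s)" "(\<sigma>, \<rho>) \<in> set r" for r \<sigma> \<rho>
      using lattice_paths_set[OF that(1)] that(2) t t' by (auto simp: balanced_def td td')
    have num: "numerator t * numerator t' = numerator (is @ is', js @ js', r)" for r
      by (simp add: numerator_def td td' ac_simps)
    have "term_gf A t * term_gf B t' = fps_const (numerator t * numerator t')
       * (exp_conv (map (upoly A) \<sigma>s) * exp_conv (map (upoly B) \<rho>s))"
      by (simp add: term_gf_def td td' ac_simps flip: fps_const_mult)
    also have "\<dots> = (\<Sum>r\<leftarrow>lattice_paths \<sigma>s \<rho>s. fps_const (numerator t * numerator t')
        * exp_conv (map (\<lambda>(\<sigma>, \<rho>). upoly A \<sigma> + upoly B \<rho>) r))"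
      unfolding exp_conv_mult by (simp add: sum_list_const_mult)
    also have "\<dots> = (\<Sum>r\<leftarrow>lattice_paths \<sigma>s \<rho>s. term_gf (A \<union> B) (?f r))"
    proof (intro arg_cong[where f = sum_list] map_cong refl)
      fix r assume r: "r \<in> set (lattice_paths \<sigma>s \<rho>s)"
      have "map (\<lambda>(\<sigma>, \<rho>). upoly A \<sigma> + upoly B \<rho>) r = map (upoly (A \<union> B)) (map (\<lambda>(\<sigma>, \<rho>). \<sigma> \<circ> \<rho>) r)"
        using perm[OF r] by (auto simp: upoly_comp[OF fin disj])
      then show "fps_const (numerator t * numerator t') * exp_conv (map (\<lambda>(\<sigma>, \<rho>). upoly A \<sigma> + upoly B \<rho>) r)
          = term_gf (A \<union> B) (?f r)"
        unfolding num[of "map (\<lambda>(\<sigma>, \<rho>). \<sigma> \<circ> \<rho>) r"] term_gf_def by (simp only: snd_conv)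
    qed
    finally have eq: "term_gf A t * term_gf B t' = (\<Sum>t\<leftarrow>map ?f (lattice_paths \<sigma>s \<rho>s). term_gf (A \<union> B) t)"
      by (simp add: comp_def)
    have "balanced (A \<union> B) (\<lambda>\<sigma>. \<forall>x\<in>A. \<sigma> x \<in> A) 1 (p + q - 1) (?f r)" if r: "r \<in> set (lattice_paths \<sigma>s \<rho>s)" for r
    proof -
      have len: "Suc (length r) = length \<sigma>s + length \<rho>s" by (rule lattice_paths_length[OF r])
      have "distinct r" using lattice_paths_distinct[OF r] t t' by (simp add: balanced_def td td')
      moreover have "set r \<subseteq> {\<sigma>. \<sigma> permutes A} \<times> {\<rho>. \<rho> permutes B}" using perm[OF r] by auto
      ultimately have d: "distinct (map (\<lambda>(\<sigma>, \<rho>). \<sigma> \<circ> \<rho>) r)"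
        using inj_on_subset[OF permutes_comp_inj[OF disj]] by (simp add: distinct_map)
      have "(\<sigma> \<circ> \<rho>) permutes (A \<union> B) \<and> (\<forall>x\<in>A. (\<sigma> \<circ> \<rho>) x \<in> A)" if "(\<sigma>, \<rho>) \<in> set r" for \<sigma> \<rho>
      proof
        have p: "\<sigma> permutes A" "\<rho> permutes B" using perm[OF r that] by auto
        then show "(\<sigma> \<circ> \<rho>) permutes (A \<union> B)"
          by (intro permutes_compose) (auto intro: permutes_subset)
        show "\<forall>x\<in>A. (\<sigma> \<circ> \<rho>) x \<in> A"
        proof
          fix x assume "x \<in> A"
          then have "\<rho> x = x" using p(2) disj by (auto intro!: permutes_not_in)
          then show "(\<sigma> \<circ> \<rho>) x \<in> A" using \<open>x \<in> A\<close> p(1) by (simp add: permutes_in_image)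
        qed
      qed
      then show ?thesis using len d t t' by (auto simp: balanced_def td td')
    qed
    then show ?thesis unfolding spanned_def eq by (intro exI[of _ "map ?f (lattice_paths \<sigma>s \<rho>s)"]) auto
  qed
  have "F * G = (\<Sum>t\<leftarrow>ts. \<Sum>t'\<leftarrow>ts'. term_gf A t * term_gf B t')"
    unfolding ts(2) ts'(2) by (simp add: sum_list_const_mult sum_list_mult_const)
  moreover have "spanned (A \<union> B) (\<lambda>\<sigma>. \<forall>x\<in>A. \<sigma> x \<in> A) 1 (p + q - 1) (\<Sum>t\<leftarrow>ts. \<Sum>t'\<leftarrow>ts'. term_gf A t * term_gf B t')"
    by (intro spanned_sum_list one) (use ts(1) ts'(1) in blast)+
  ultimately show ?thesis by simp
qed

text \<open>Variation of constants: solving the equation puts one more exponential in front of every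
  convolution. Its permutation has to be new in order to keep the permutations distinct.\<close>

lemma spanned_integrate:
  assumes F: "fps_deriv F = fps_const (upoly A \<sigma>) * F + G" "fps_nth F 0 = 0"
    and G: "spanned A (\<lambda>\<rho>. \<rho> \<noteq> \<sigma>) 1 l G" and \<sigma>: "\<sigma> permutes A"
  shows "spanned A (\<lambda>_. True) 2 (Suc l) F"
proof -
  obtain ts where ts: "\<forall>t\<in>set ts. balanced A (\<lambda>\<rho>. \<rho> \<noteq> \<sigma>) 1 l t" "G = (\<Sum>t\<leftarrow>ts. term_gf A t)"
    using G unfolding spanned_def by blast
  let ?f = "\<lambda>t. (fst t, fst (snd t), \<sigma> # snd (snd t))"
  let ?H = "\<Sum>t\<leftarrow>map ?f ts. term_gf A t"
  have "fps_deriv (\<Sum>t\<leftarrow>map ?f ts. term_gf A t) = fps_const (upoly A \<sigma>) * (\<Sum>t\<leftarrow>map ?f ts. term_gf A t)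
      + (\<Sum>t\<leftarrow>ts. term_gf A t)" for ts
    by (induction ts) (simp_all add: term_gf_def exp_conv_deriv numerator_def split_def algebra_simps)
  then have H: "fps_deriv ?H = fps_const (upoly A \<sigma>) * ?H + G" unfolding ts(2) .
  have nth0: "fps_nth (term_gf A (?f t)) 0 = 0" and bal: "balanced A (\<lambda>_. True) 2 (Suc l) (?f t)"
    if "balanced A (\<lambda>\<rho>. \<rho> \<noteq> \<sigma>) 1 l t" for t
    using that \<sigma> by (cases t; auto simp: balanced_def term_gf_def exp_conv_nth_0)+
  have "fps_nth (\<Sum>t\<leftarrow>map ?f ts. term_gf A t) 0 = 0" if "\<forall>t\<in>set ts. balanced A (\<lambda>\<rho>. \<rho> \<noteq> \<sigma>) 1 l t" for ts
    using that by (induction ts) (simp_all add: nth0)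
  then have "F = ?H" using fps_linear_ode_unique[OF F(1) H] F(2) ts(1) by simp
  moreover have "\<forall>t\<in>set (map ?f ts). balanced A (\<lambda>_. True) 2 (Suc l) t"
    using ts(1) bal by auto
  ultimately show ?thesis unfolding spanned_def by blast
qed

section \<open>Solving the differential equation\<close>

text \<open>The cyclic permutation sending each entry of the list to its predecessor.\<close>

definition back_cycle :: "nat list \<Rightarrow> nat \<Rightarrow> nat" where
  "back_cycle I = permutation_of_list (zip I (last I # butlast I))"

lemma back_cycle_permutes: "distinct I \<Longrightarrow> I \<noteq> [] \<Longrightarrow> back_cycle I permutes set I"
proof -
  assume I: "distinct I" "I \<noteq> []"
  have rot: "distinct (last I # butlast I)" "set (last I # butlast I) = set I"
    using I by (cases I rule: rev_cases; auto)+
  have "list_permutes (zip I (last I # butlast I)) (set I)"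
    unfolding list_permutes_def using I rot by simp
  then show ?thesis unfolding back_cycle_def by (rule permutation_of_list_permutes)
qed

lemma map_of_zip_append:
  "length xs = length ys \<Longrightarrow> k \<notin> set xs \<Longrightarrow> map_of (zip (xs @ k # xs') (ys @ y # ys')) k = Some y"
  by (induction xs ys rule: list_induct2) auto

lemma back_cycle_hd: "I \<noteq> [] \<Longrightarrow> back_cycle I (hd I) = last I"
  by (cases I) (simp_all add: back_cycle_def permutation_of_list_def)

lemma back_cycle_append:
  assumes "distinct (J @ k # K)" "J \<noteq> []"
  shows "back_cycle (J @ k # K) k = last J"
proof -
  have "last (J @ k # K) # butlast (J @ k # K) = (last (k # K) # butlast J) @ last J # butlast (k # K)"
    using assms(2) by (simp add: butlast_append)
  moreover have "length J = length (last (k # K) # butlast J)" using assms(2) by (cases J) auto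
  ultimately show ?thesis
    using assms map_of_zip_append[of J "last (k # K) # butlast J" k K "last J" "butlast (k # K)"]
    by (simp add: back_cycle_def permutation_of_list_def)
qed

lemma sum_breaks_zip:
  "(\<Sum>(a, b)\<leftarrow>zip I (butlast (i # I)). f a b) = (\<Sum>(J, K)\<leftarrow>breaks (i # I). if K = [] then 0 else f (hd K) (last J))"
  for f :: "nat \<Rightarrow> nat \<Rightarrow> 'a::comm_monoid_add"
proof (induction I arbitrary: i)
  case (Cons j I)
  have "(\<Sum>(J, K)\<leftarrow>breaks (i # j # I). if K = [] then 0 else f (hd K) (last J))
     = f j i + (\<Sum>(J, K)\<leftarrow>breaks (j # I). if K = [] then 0 else f (hd K) (last (i # J)))"
    by (simp add: comp_def split_def cong: if_cong)
  also have "(\<Sum>(J, K)\<leftarrow>breaks (j # I). if K = [] then 0 else f (hd K) (last (i # J)))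
     = (\<Sum>(J, K)\<leftarrow>breaks (j # I). if K = [] then 0 else f (hd K) (last J))"
    by (intro arg_cong[where f = sum_list] map_cong refl) (auto dest: breaks_eq)
  also have "\<dots> = (\<Sum>(a, b)\<leftarrow>zip I (butlast (j # I)). f a b)"
    unfolding Cons ..
  finally show ?case by simp
qed simp

text \<open>These are the variables extracted when a single excursion passes through all indices of \<open>I\<close>, the new
  index being visited at one of the places between two cyclically adjacent indices.\<close>

lemma upoly_back_cycle:
  assumes "distinct I" "I \<noteq> []"
  shows "upoly (set I) (back_cycle I) = var_poly (Z (hd I)) * var_poly (W (last I))
    + (\<Sum>(J, K)\<leftarrow>breaks I. if K = [] then 0 else var_poly (Z (hd K)) * var_poly (W (last J)))"
proof -
  let ?f = "\<lambda>a b. var_poly (Z a) * var_poly (W b)"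
  obtain i I' where I: "I = i # I'" using assms(2) by (cases I) auto
  have "upoly (set I) (back_cycle I) = (\<Sum>a\<leftarrow>I. ?f a (back_cycle I a))"
    unfolding upoly_def by (rule sum_list_distinct_conv_sum_set[symmetric, OF assms(1)])
  also have "map (\<lambda>a. ?f a (back_cycle I a)) I = map (\<lambda>(a, b). ?f a b) (zip I (last I # butlast I))"
  proof (rule nth_equalityI)
    fix r assume r: "r < length (map (\<lambda>a. ?f a (back_cycle I a)) I)"
    then have "back_cycle I (I ! r) = (last I # butlast I) ! r"
      using assms by (simp add: back_cycle_def permutation_of_list_def map_of_zip_nth)
    then show "map (\<lambda>a. ?f a (back_cycle I a)) I ! r = map (\<lambda>(a, b). ?f a b) (zip I (last I # butlast I)) ! r"
      using r by simp
  qed (use assms in simp)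
  also have "sum_list \<dots> = ?f (hd I) (last I) + (\<Sum>(a, b)\<leftarrow>zip I' (butlast I). ?f a b)"
    by (simp add: I)
  also have "(\<Sum>(a, b)\<leftarrow>zip I' (butlast I). ?f a b) = (\<Sum>(J, K)\<leftarrow>breaks I. if K = [] then 0 else ?f (hd K) (last J))"
    unfolding I by (rule sum_breaks_zip)
  finally show ?thesis .
qed

lemma moment_gf_nth_0: "fps_nth (moment_gf I) 0 = 0"
  using represents_moment_gf[of I] unfolding represents_def by (intro poly_mapping_eqI) simp

lemma sum_list_breaks_last:
  fixes g :: "nat list \<times> nat list \<Rightarrow> 'a::comm_monoid_add"
  shows "I \<noteq> [] \<Longrightarrow> (\<Sum>x\<leftarrow>breaks I. g x) = g (I, []) + (\<Sum>x\<leftarrow>breaks I. if snd x = [] then 0 else g x)"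
proof (induction I arbitrary: g)
  case (Cons i I)
  show ?case
  proof (cases "I = []")
    case False
    have "(\<Sum>x\<leftarrow>breaks I. g (i # fst x, snd x)) = g (i # I, []) + (\<Sum>x\<leftarrow>breaks I. if snd x
        = [] then 0 else g (i # fst x, snd x))"
      using Cons.IH[OF False, of "\<lambda>x. g (i # fst x, snd x)"] by simp
    then show ?thesis using False by (simp add: comp_def split_def ac_simps cong: if_cong)
  qed simp
qed simp

text \<open>Splitting off the first index: apart from starting the final excursion, it is skipped or forms an
  excursion of its own, which are combined into one factor, or it starts a longer excursion.\<close>

lemma chain_Cons:
  "chain c H (i # I) = (1 + loop_gf [i]) * chain c H I + H (i # I) + (\<Sum>(J, K)\<leftarrow>breaks I. loop_gf (i # J) * chain c H K)"
  by (simp add: chain.simps(2) comp_def split_def algebra_simps)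

lemma loops_gf_Nil: "loops_gf [] = 1" and exits_gf_Nil: "exits_gf J [] = 0"
  by (simp_all add: loops_gf_def exits_gf_def)

lemma loops_gf_Cons:
  "I \<noteq> [] \<Longrightarrow> loops_gf (i # I) = loop_gf (i # I) + ((1 + loop_gf [i]) * loops_gf I
     + (\<Sum>x\<leftarrow>breaks I. if snd x = [] then 0 else loop_gf (i # fst x) * loops_gf (snd x)))"
  using sum_list_breaks_last[of I "\<lambda>x. loop_gf (i # fst x) * loops_gf (snd x)"]
  by (simp add: loops_gf_def chain_Cons split_def algebra_simps)

text \<open>The summand of the differential equation with the indices of \<open>J\<close> passed before the first visit,
  including the variable of the \<open>Opr\<close> that enters the new index.\<close>

definition exit_term :: "nat list \<Rightarrow> nat list \<Rightarrow> polynomial fps" where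
  "exit_term J K = fps_const (var_poly (W (last J))) * exits_gf J K"

lemma exit_term_Nil: "exit_term J [] = 0"
  by (simp add: exit_term_def exits_gf_Nil)

lemma exit_term_Cons:
  "exit_term J (k # K) = fps_const (var_poly (Z k)) * (fps_const (var_poly (W (last J))) * moment_gf ((k # K) @ J))
     + ((1 + loop_gf [k]) * exit_term J K
     + (\<Sum>x\<leftarrow>breaks K. if snd x = [] then 0 else loop_gf (k # fst x) * exit_term J (snd x)))"
proof -
  have "(\<Sum>(J', K')\<leftarrow>breaks K. loop_gf (k # J') * exits_gf J K')
     = (\<Sum>x\<leftarrow>breaks K. if snd x = [] then 0 else loop_gf (k # fst x) * exits_gf J (snd x))"
    by (intro arg_cong[where f = sum_list] map_cong refl) (auto simp: exits_gf_Nil)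
  then have "exits_gf J (k # K) = (1 + loop_gf [k]) * exits_gf J K
      + fps_const (var_poly (Z k)) * moment_gf ((k # K) @ J)
    + (\<Sum>x\<leftarrow>breaks K. if snd x = [] then 0 else loop_gf (k # fst x) * exits_gf J (snd x))"
    unfolding exits_gf_def chain_Cons by simp
  moreover have "c * (\<Sum>x\<leftarrow>breaks K. if snd x = [] then 0 else loop_gf (k # fst x) * exits_gf J (snd x))
    = (\<Sum>x\<leftarrow>breaks K. if snd x = [] then 0 else loop_gf (k # fst x) * (c * exits_gf J (snd x)))" for c
    unfolding sum_list_const_mult[symmetric]
    by (intro arg_cong[where f = sum_list] map_cong refl) (simp add: ac_simps)
  ultimately show ?thesis unfolding exit_term_def by (simp add: algebra_simps)
qed

text \<open>For a single index the two alternatives of skipping it and of an excursion add up to one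
  exponential. This keeps exponentials of fewer than all variables out of the final formula.\<close>

lemma loop_gf_single: "spanned {i} (\<lambda>_. True) 1 1 (1 + loop_gf [i])"
proof -
  let ?u = "var_poly (Z i) * var_poly (W i)"
  have "fps_deriv (moment_gf [i]) = 1 + loop_gf [i]"
    using moment_gf_deriv[of "[i]"] by (simp add: loops_gf_def chain.simps(2) exits_gf_Nil)
  then have "fps_deriv (1 + loop_gf [i]) = fps_const ?u * (1 + loop_gf [i]) + 0"
    by (simp add: loop_gf_def algebra_simps flip: fps_const_mult)
  moreover have "fps_deriv (exp_conv [?u]) = fps_const ?u * exp_conv [?u] + 0" by (simp add: exp_conv_deriv)
  moreover have "fps_nth (1 + loop_gf [i]) 0 = fps_nth (exp_conv [?u]) 0"
    by (simp add: loop_gf_def moment_gf_nth_0 exp_conv_nth_0)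
  ultimately have "1 + loop_gf [i] = exp_conv [?u]" by (rule fps_linear_ode_unique)
  also have "\<dots> = term_gf {i} ([], [], [id])" by (simp add: term_gf_def numerator_def upoly_def)
  finally show ?thesis unfolding spanned_def
    by (intro exI[of _ "[([], [], [id])]"]) (simp add: balanced_def permutes_id)
qed

lemma spanned_loop_gf:
  assumes "spanned (set J) P 2 l (moment_gf J)" "J \<noteq> []"
  shows "spanned (set J) P 1 l (loop_gf J)"
  unfolding loop_gf_def using assms by (intro spanned_var_mult) (auto simp: numeral_2_eq_2)

text \<open>The part of the right-hand side in which at least two blocks occur: every permutation in it
  preserves a block that contains the first index but not \<open>x\<close>. In the applications \<open>x\<close> is the cyclic
  predecessor of \<open>k\<close>, so the permutation \<open>back_cycle\<close> is excluded.\<close>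

lemma spanned_rest:
  assumes "distinct (k # K)" "k \<notin> B" "set K \<inter> B = {}" "finite B"
    and x: "x \<in> B \<or> K \<noteq> [] \<and> x = last K" "x \<noteq> k"
    and loops: "\<And>J K'. K = J @ K' \<Longrightarrow> J \<noteq> [] \<Longrightarrow> K' \<noteq> []
        \<Longrightarrow> spanned (set (k # J)) (\<lambda>_. True) 2 (length (k # J)) (moment_gf (k # J))"
    and f: "spanned (set K \<union> B) (\<lambda>_. True) 1 (length K + b) (f K)"
      "\<And>J K'. K = J @ K' \<Longrightarrow> J \<noteq> [] \<Longrightarrow> K' \<noteq> [] \<Longrightarrow> spanned (set K' \<union> B) (\<lambda>_. True) 1 (length K' + b) (f K')"
  shows "spanned (set (k # K) \<union> B) (\<lambda>\<sigma>. \<sigma> k \<noteq> x) 1 (length K + b)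
    ((1 + loop_gf [k]) * f K + (\<Sum>y\<leftarrow>breaks K. if snd y = [] then 0 else loop_gf (k # fst y) * f (snd y)))"
proof (intro spanned_add spanned_sum_list)
  have "spanned ({k} \<union> (set K \<union> B)) (\<lambda>\<sigma>. \<forall>y\<in>{k}. \<sigma> y \<in> {k}) 1 (1 + (length K + b) - 1) ((1 + loop_gf [k]) * f K)"
    using assms(1-4) by (intro spanned_mult[where P = "\<lambda>_. True" and Q = "\<lambda>_. True"] loop_gf_single f(1)) auto
  then show "spanned (set (k # K) \<union> B) (\<lambda>\<sigma>. \<sigma> k \<noteq> x) 1 (length K + b) ((1 + loop_gf [k]) * f K)"
    using x by simp (erule spanned_mono; auto)
  fix y assume y: "y \<in> set (breaks K)"
  show "spanned (set (k # K) \<union> B) (\<lambda>\<sigma>. \<sigma> k \<noteq> x) 1 (length K + b) (if snd y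
      = [] then 0 else loop_gf (k # fst y) * f (snd y))"
  proof (cases "snd y = []")
    case False
    obtain J K' where JK: "y = (J, K')" by (cases y)
    then have K: "K = J @ K'" "J \<noteq> []" "K' \<noteq> []" using y False breaks_eq[of J K' K] by auto
    have "spanned (set (k # J) \<union> (set K' \<union> B)) (\<lambda>\<sigma>. \<forall>y\<in>set (k # J). \<sigma> y \<in> set (k # J)) 1
        (length (k # J) + (length K' + b) - 1) (loop_gf (k # J) * f K')"
      using assms(1-4) K loops[OF K] f(2)[OF K]
          by (intro spanned_mult[where P = "\<lambda>_. True" and Q = "\<lambda>_. True"] spanned_loop_gf) auto
    moreover have "set (k # J) \<union> (set K' \<union> B) = set (k # K) \<union> B" using K by auto
    moreover have "x \<notin> set (k # J)" using x K assms(1-3) by auto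
    ultimately show ?thesis using False K JK
      by simp (erule spanned_mono; auto)
  qed (simp add: spanned_zero)
qed

text \<open>Induction on the number of indices. In the differential equation the excursions through all indices
  at once contribute \<open>moment_gf I\<close> itself with the coefficient \<open>upoly (set I) (back_cycle I)\<close>, after a
  rotation of the indices. Everything else is a product over at least two blocks, known by
  induction, in which \<open>back_cycle I\<close> does not occur; merging blocks costs at least one exponential,
  which leaves room for the one added by integration.\<close>

theorem spanned_moment_gf:
  "distinct I \<Longrightarrow> 2 \<le> length I \<Longrightarrow> spanned (set I) (\<lambda>_. True) 2 (length I) (moment_gf I)"
proof (induction "length I" arbitrary: I rule: less_induct)
  case less
  have moment_gf: "spanned (set J) (\<lambda>_. True) 2 (length J) (moment_gf J)"
      if "distinct J" "2 \<le> length J" "length J < length I" for J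
    using less that by blast
  have loops: "spanned (set K) (\<lambda>_. True) 1 (length K) (loops_gf K)" if "distinct K" "K \<noteq> []" "length K < length I"
      for K
    using that
  proof (induction K rule: length_induct)
    case (1 K)
    then obtain k K' where K: "K = k # K'" by (cases K) auto
    show ?case
    proof (cases "K' = []")
      case True
      then show ?thesis using loop_gf_single[of k] by (simp add: K loops_gf_def chain.simps(2))
    next
      case False
      have IH: "spanned (set L) (\<lambda>_. True) 1 (length L) (loops_gf L)" if "K' = L' @ L" "L \<noteq> []" for L L'
        using 1 that K by auto
      have "spanned (set (k # K') \<union> {}) (\<lambda>\<sigma>. \<sigma> k \<noteq> last K') 1 (length K' + 0)
        ((1 + loop_gf [k]) * loops_gf K' + (\<Sum>y\<leftarrow>breaks K'.
            if snd y = [] then 0 else loop_gf (k # fst y) * loops_gf (snd y)))"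
        using 1 K False IH[of "[]" K'] IH last_in_set[OF False] by (intro spanned_rest moment_gf) (auto simp: Suc_le_eq)
      then have "spanned (set K) (\<lambda>_. True) 1 (length K) ((1 + loop_gf [k]) * loops_gf K' + (\<Sum>y\<leftarrow>breaks K'. if snd y
          = [] then 0 else loop_gf (k # fst y) * loops_gf (snd y)))"
        unfolding K Un_empty_right by (rule spanned_mono) auto
      moreover have "spanned (set K) (\<lambda>_. True) 1 (length K) (loop_gf K)"
        using 1 K False by (intro spanned_loop_gf moment_gf) (auto simp: Suc_le_eq)
      ultimately show ?thesis unfolding K loops_gf_Cons[OF False] by (rule spanned_add[rotated])
    qed
  qed
  have exits: "spanned (set K \<union> set J) (\<lambda>_. True) 1 (length K + length J) (exit_term J K)"
    if "distinct (J @ K)" "J \<noteq> []" "length J + length K < length I" for J K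
    using that
  proof (induction K rule: length_induct)
    case (1 K)
    show ?case
    proof (cases K)
      case Nil
      then show ?thesis by (simp add: exit_term_Nil spanned_zero)
    next
      case (Cons k K')
      have IH: "spanned (set L \<union> set J) (\<lambda>_. True) 1 (length L + length J) (exit_term J L)" if "K' = L' @ L" for L L'
      proof (rule 1(1)[rule_format])
        show "length L < length K" "distinct (J @ L)" "J \<noteq> []" "length J + length L < length I"
          using 1(2-4) that Cons by auto
      qed
      have "spanned (set (k # K') \<union> set J) (\<lambda>\<sigma>. \<sigma> k \<noteq> last J) 1 (length K' + length J)
        ((1 + loop_gf [k]) * exit_term J K' + (\<Sum>y\<leftarrow>breaks K'.
            if snd y = [] then 0 else loop_gf (k # fst y) * exit_term J (snd y)))"
        using 1 Cons IH[of "[]" K'] IH last_in_set[of J] by (intro spanned_rest moment_gf) (auto simp: Suc_le_eq)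
      then have "spanned (set K \<union> set J) (\<lambda>_. True) 1 (length K + length J) ((1 + loop_gf [k]) * exit_term J K'
          + (\<Sum>y\<leftarrow>breaks K'. if snd y = [] then 0 else loop_gf (k # fst y) * exit_term J (snd y)))"
        unfolding Cons by (rule spanned_mono) auto
      moreover have "spanned (set (K @ J)) (\<lambda>_. True) 2 (length (K @ J)) (moment_gf (K @ J))"
        using 1 Cons by (intro moment_gf) (auto simp: Suc_le_eq)
      then have "spanned (set K \<union> set J) (\<lambda>_. True) (Suc 1) (length K + length J) (moment_gf (K @ J))"
        by (simp add: numeral_2_eq_2)
      then have "spanned (set K \<union> set J) (\<lambda>_. True) 1 (length K + length J)
          (fps_const (var_poly (Z k)) * (fps_const (var_poly (W (last J))) * moment_gf (K @ J)))"
        by (rule spanned_var_mult) (use 1 Cons in auto)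
      ultimately show ?thesis unfolding Cons exit_term_Cons by (rule spanned_add[rotated])
    qed
  qed
  obtain n where n: "length I = Suc n" using less.prems by (cases "length I") auto
  obtain i I' where I: "I = i # I'" "I' \<noteq> []" using less.prems by (cases I) (auto simp: Suc_le_eq)
  have Ine: "I \<noteq> []" using I by simp
  let ?P = "\<lambda>\<sigma>. \<sigma> \<noteq> back_cycle I"
  \<comment> \<open>\<open>R0\<close> and \<open>R\<close> collect the contributions of at least two blocks, with the base point at the new
      index and elsewhere, respectively\<close>
  define R0 where "R0 = (1 + loop_gf [i]) * loops_gf I' + (\<Sum>y\<leftarrow>breaks I'. if snd y
      = [] then 0 else loop_gf (i # fst y) * loops_gf (snd y))"
  define R where "R J K = (1 + loop_gf [hd K]) * exit_term J (tl K)
     + (\<Sum>y\<leftarrow>breaks (tl K). if snd y = [] then 0 else loop_gf (hd K # fst y) * exit_term J (snd y))" for J K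
  define Q where "Q = R0 + (\<Sum>(J, K)\<leftarrow>breaks I. if K = [] then 0 else R J K)"
  have R0: "spanned (set I) ?P 1 n R0"
  proof -
    have loops': "spanned (set K \<union> {}) (\<lambda>_. True) 1 (length K + 0) (loops_gf K)"
      if "distinct K" "K \<noteq> []" "length K < length I" for K
      using loops[OF that] by simp
    have "spanned (set (i # I') \<union> {}) (\<lambda>\<sigma>. \<sigma> i \<noteq> last I') 1 (length I' + 0) R0"
      unfolding R0_def using less.prems I last_in_set[OF I(2)]
          by (intro spanned_rest moment_gf loops') (auto simp: Suc_le_eq)
    then have "spanned (set I) (\<lambda>\<sigma>. \<sigma> i \<noteq> last I') 1 n R0" using n I by simp
    then show ?thesis by (rule spanned_mono) (use back_cycle_hd[of I] I in auto)
  qed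
  have R: "spanned (set I) ?P 1 n (R J K)" if JK: "(J, K) \<in> set (breaks I)" "K \<noteq> []" for J K
  proof -
    have IJK: "I = J @ K" "J \<noteq> []" using breaks_eq[OF JK(1)] by auto
    obtain k K' where K: "K = k # K'" using JK(2) by (cases K) auto
    have "spanned (set (k # K') \<union> set J) (\<lambda>\<sigma>. \<sigma> k \<noteq> last J) 1 (length K' + length J) (R J K)"
      unfolding R_def K list.sel using less.prems IJK K last_in_set[OF IJK(2)]
          by (intro spanned_rest moment_gf exits) (auto simp: Suc_le_eq)
    then have "spanned (set I) (\<lambda>\<sigma>. \<sigma> k \<noteq> last J) 1 n (R J K)"
      using n IJK K by (simp add: Un_commute add.commute)
    then show ?thesis
      by (rule spanned_mono) (use back_cycle_append[of J k K'] less.prems IJK K in auto)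
  qed
  have Q: "spanned (set I) ?P 1 n Q"
    unfolding Q_def by (intro spanned_add R0 spanned_sum_list) (use R spanned_zero in auto)
  have "fps_deriv (moment_gf I) = loops_gf I + (\<Sum>(J, K)\<leftarrow>breaks I. exit_term J K)"
    unfolding exit_term_def by (rule moment_gf_deriv[OF less.prems(1)])
  also have "(\<Sum>(J, K)\<leftarrow>breaks I. exit_term J K)
     = (\<Sum>(J, K)\<leftarrow>breaks I. fps_const (if K = [] then 0 else var_poly (Z (hd K)) * var_poly (W (last J))) * moment_gf
         I + (if K = [] then 0 else R J K))"
  proof (intro arg_cong[where f = sum_list] map_cong refl)
    fix y assume y: "y \<in> set (breaks I)"
    obtain J K where JK: "y = (J, K)" by (cases y)
    have IJK: "I = J @ K" "J \<noteq> []" using breaks_eq[of J K I] y JK by auto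
    show "(case y of (J, K) \<Rightarrow> exit_term J K)
      = (case y of (J, K) \<Rightarrow> fps_const (if K = [] then 0 else var_poly (Z (hd K)) * var_poly (W (last J))) *
          moment_gf I + (if K = [] then 0 else R J K))"
    proof (cases K)
      case (Cons k K')
      \<comment> \<open>the block \<open>K @ J\<close> consists of all indices, in rotated order\<close>
      have "moment_gf (K @ J) = moment_gf I" using moment_gf_rotate[of J K] less.prems(1) IJK by simp
      then show ?thesis using Cons by (simp add: JK exit_term_Cons R_def mult.assoc flip: fps_const_mult cong: if_cong)
    qed (simp add: JK exit_term_Nil)
  qed
  also have "\<dots> = fps_const (\<Sum>(J, K)\<leftarrow>breaks I. if K
      = [] then 0 else var_poly (Z (hd K)) * var_poly (W (last J))) * moment_gf I
      + (\<Sum>(J, K)\<leftarrow>breaks I. if K = [] then 0 else R J K)"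
  proof -
    have "(\<Sum>(J, K)\<leftarrow>xs. fps_const (g J K) * G + h J K) = fps_const (\<Sum>(J, K)\<leftarrow>xs. g J K) * G + (\<Sum>(J, K)\<leftarrow>xs. h J K)"
      for g :: "nat list \<Rightarrow> nat list \<Rightarrow> polynomial" and h G xs
      by (induction xs) (auto simp: algebra_simps simp flip: fps_const_add)
    then show ?thesis .
  qed
  also have "loops_gf I = fps_const (var_poly (Z (hd I)) * var_poly (W (last I))) * moment_gf I + R0"
    unfolding I(1) loops_gf_Cons[OF I(2)] R0_def loop_gf_def[of "i # I'"] by (simp add: mult.assoc flip: fps_const_mult)
  finally have "fps_deriv (moment_gf I) = fps_const (upoly (set I) (back_cycle I)) * moment_gf I + Q"
    unfolding upoly_back_cycle[OF less.prems(1) Ine] Q_def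
    by (simp add: algebra_simps flip: fps_const_add)
  from spanned_integrate[OF this moment_gf_nth_0 Q back_cycle_permutes] show ?case
    using less.prems I n by simp
qed

section \<open>Expansions of rational functions\<close>

text \<open>Coefficientwise convergence in which each coefficient is eventually constant. It reduces identities
  between power series and rational functions to identities between polynomials.\<close>

definition approximates :: "(nat \<Rightarrow> polynomial) \<Rightarrow> series \<Rightarrow> bool" where
  "approximates K G \<longleftrightarrow> (\<forall>m. \<forall>\<^sub>F N in sequentially. lookup (K N) m = G m)"

lemma approximates_unique: "approximates K G \<Longrightarrow> approximates K G' \<Longrightarrow> G = G'"
proof
  fix m assume "approximates K G" "approximates K G'"
  then have "\<forall>\<^sub>F N in sequentially. lookup (K N) m = G m \<and> lookup (K N) m = G' m"
    unfolding approximates_def by (intro eventually_conj) auto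
  then show "G m = G' m" using eventually_happens by fastforce
qed

lemma approximates_const: "approximates (\<lambda>_. P) (lookup P)"
  by (simp add: approximates_def)

lemma approximates_add: "approximates K G \<Longrightarrow> approximates K' G' \<Longrightarrow> approximates (\<lambda>N. K N + K' N) (\<lambda>m. G m + G' m)"
  unfolding approximates_def
proof
  fix m assume "\<forall>m. \<forall>\<^sub>F N in sequentially. lookup (K N) m = G m" "\<forall>m. \<forall>\<^sub>F N in sequentially. lookup (K' N) m = G' m"
  then have "\<forall>\<^sub>F N in sequentially. lookup (K N) m = G m \<and> lookup (K' N) m = G' m"
    by (intro eventually_conj) auto
  then show "\<forall>\<^sub>F N in sequentially. lookup (K N + K' N) m = G m + G' m"
    by eventually_elim (simp add: lookup_add)
qed

lemma approximates_mult:
  assumes "approximates K G"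
  shows "approximates (\<lambda>N. Q * K N) (prod_fun (lookup Q) G)"
  unfolding approximates_def
proof
  fix k
  have "\<forall>\<^sub>F N in sequentially. \<forall>a\<in>keys Q. lookup (K N) (k - a) = G (k - a)"
    using assms unfolding approximates_def by (intro eventually_ball_finite) auto
  then show "\<forall>\<^sub>F N in sequentially. lookup (Q * K N) k = prod_fun (lookup Q) G k"
  proof eventually_elim
    case (elim N)
    then show ?case unfolding times_poly_mapping.rep_eq prod_fun_lookup
      by (intro sum.cong) auto
  qed
qed

lemma approximates_mult_poly: "approximates K (lookup P) \<Longrightarrow> approximates (\<lambda>N. Q * K N) (lookup (Q * P))"
  using approximates_mult[of K "lookup P" Q] by (simp add: times_poly_mapping.rep_eq)

lemma is_expansionI:
  assumes "lookup Q 0 \<noteq> 0" "approximates K G" "approximates (\<lambda>N. Q * K N) (lookup P)"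
  shows "is_expansion P Q G"
  unfolding is_expansion_def using assms approximates_unique[OF approximates_mult[OF assms(2), of Q] assms(3)] by simp

lemma expansionI:
  assumes "lookup Q 0 \<noteq> 0" "approximates K G" "approximates (\<lambda>N. Q * K N) (lookup P)"
  shows "expansion P Q = G"
  unfolding expansion_def using is_expansionI[OF assms] is_expansion_ex1[OF assms(1)] by (rule the1_equality[rotated])

definition quadratic :: "polynomial \<Rightarrow> bool" where
  "quadratic u \<longleftrightarrow> (\<forall>m. lookup u m \<noteq> 0 \<longrightarrow> total_degree m = 2)"

text \<open>Each coefficient of a power series receives contributions from only one \<open>hurwitz\<close> polynomial.\<close>

lemma hurwitz_homogeneous:
  assumes "\<forall>u\<in>set us. quadratic u" "lookup (hurwitz us n) m \<noteq> 0"
  shows "total_degree m + 2 * length us = 2 * n + 2"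
  using assms
proof (induction us n arbitrary: m rule: hurwitz.induct)
  case (2 u us)
  then show ?case by (auto simp: lookup_one when_def total_degree_def split: if_splits)
next
  case (3 u us n)
  show ?case
  proof (cases "lookup (hurwitz us n) m = 0")
    case True
    then have "m \<in> keys (u * hurwitz (u # us) n)" using 3(4) by (simp add: lookup_add in_keys_iff)
    then obtain a b where ab: "m = a + b" "a \<in> keys u" "b \<in> keys (hurwitz (u # us) n)"
      using keys_mult[of u "hurwitz (u # us) n"] by blast
    have "total_degree a = 2" using ab(2) 3(3) by (simp add: quadratic_def in_keys_iff)
    moreover have "total_degree b + 2 * length (u # us) = 2 * n + 2"
      using ab(3) 3(3) by (intro 3(1)) (auto simp: in_keys_iff)
    ultimately show ?thesis by (simp add: ab(1) total_degree_add)
  next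
    case False
    then show ?thesis using 3(2)[of m] 3(3) by simp
  qed
qed simp

definition hurwitz_sum :: "polynomial list \<Rightarrow> nat \<Rightarrow> polynomial" where
  "hurwitz_sum us N = (\<Sum>j\<le>N. hurwitz us j)"

lemma hurwitz_sum_step:
  "(1 - u) * hurwitz_sum (u # us) N = (if us = [] then 1 else hurwitz_sum us N) - hurwitz (u # us) (Suc N)"
proof -
  have "hurwitz_sum (u # us) (Suc N) = hurwitz (u # us) 0 + (u * hurwitz_sum (u # us) N + hurwitz_sum us N)"
    unfolding hurwitz_sum_def by (subst sum.atMost_Suc_shift) (simp add: sum.distrib sum_distrib_left)
  moreover have "hurwitz_sum (u # us) (Suc N) = hurwitz_sum (u # us) N + hurwitz (u # us) (Suc N)"
    by (simp add: hurwitz_sum_def)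
  moreover have "hurwitz_sum [] N = 0" by (simp add: hurwitz_sum_def)
  ultimately show ?thesis by (auto simp: algebra_simps)
qed

lemma approximates_hurwitz_zero:
  assumes "\<forall>u\<in>set us. quadratic u"
  shows "approximates (\<lambda>N. hurwitz us (Suc N)) (lookup 0)"
  unfolding approximates_def
proof
  fix m
  have "lookup (hurwitz us (Suc N)) m = 0" if "N \<ge> total_degree m + 2 * length us" for N
    using hurwitz_homogeneous[OF assms, of "Suc N" m] that by auto
  then show "\<forall>\<^sub>F N in sequentially. lookup (hurwitz us (Suc N)) m = lookup 0 m"
    by (intro eventually_sequentiallyI[of "total_degree m + 2 * length us"]) simp
qed

text \<open>Multiplication by \<open>1 - u\<close> telescopes the sum of the \<open>hurwitz\<close> polynomials down to the sum for the
  remaining arguments, up to an error of high degree.\<close>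

lemma approximates_inverse:
  assumes "us \<noteq> []" "\<forall>u\<in>set us. quadratic u"
  shows "approximates (\<lambda>N. (\<Prod>u\<leftarrow>us. 1 - u) * hurwitz_sum us N) (lookup 1)"
  using assms
proof (induction us)
  case (Cons u us)
  let ?P = "\<Prod>u\<leftarrow>us. 1 - u"
  have err: "approximates (\<lambda>N. (- ?P) * hurwitz (u # us) (Suc N)) (lookup ((- ?P) * 0))"
    by (rule approximates_mult_poly[OF approximates_hurwitz_zero]) (rule Cons.prems)
  have main: "approximates (\<lambda>N. ?P * (if us = [] then 1 else hurwitz_sum us N)) (lookup 1)"
    using Cons approximates_const[of 1] by (cases "us = []") auto
  have "approximates (\<lambda>N. ?P * (if us = [] then 1 else hurwitz_sum us N)
      + (- ?P) * hurwitz (u # us) (Suc N)) (\<lambda>m. lookup 1 m + lookup ((- ?P) * 0) m)"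
    by (rule approximates_add[OF main err])
  moreover have "(\<Prod>u\<leftarrow>u # us. 1 - u) * hurwitz_sum (u # us) N
     = ?P * (if us = [] then 1 else hurwitz_sum us N) + (- ?P) * hurwitz (u # us) (Suc N)" for N
  proof -
    have "(\<Prod>u\<leftarrow>u # us. 1 - u) * hurwitz_sum (u # us) N = ?P * ((1 - u) * hurwitz_sum (u # us) N)"
      by (simp add: ac_simps)
    then show ?thesis unfolding hurwitz_sum_step by (simp add: algebra_simps)
  qed
  ultimately show ?case by simp
qed simp

lemma quadratic_u_poly: "quadratic (u_poly n \<sigma>)"
  unfolding quadratic_def
proof (intro allI impI)
  fix m assume "lookup (u_poly n \<sigma>) m \<noteq> 0"
  then obtain i where "lookup (var_poly (Z i) * var_poly (W (\<sigma> i))) m \<noteq> 0"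
    unfolding u_poly_def lookup_sum by (meson sum.not_neutral_contains_not_neutral)
  then have "m = Poly_Mapping.single (Z i) 1 + Poly_Mapping.single (W (\<sigma> i)) 1"
    by (auto simp: var_poly_def mult_single lookup_single when_def split: if_splits)
  then show "total_degree m = 2" by (simp add: total_degree_add) (simp add: total_degree_def)
qed

lemma lookup_mult_zero: "lookup (P * Q) 0 = lookup P 0 * lookup Q 0" for P Q :: polynomial
proof -
  have "(\<exists>b. (0::monomial) = a + b) \<longleftrightarrow> a = 0" for a
  proof
    assume "\<exists>b. (0::monomial) = a + b"
    then obtain b where "0 = a + b" ..
    then have "0 = lookup a v + lookup b v" for v by (metis lookup_add lookup_zero)
    then show "a = 0" by (intro poly_mapping_eqI) (simp add: add_eq_0_iff_both_eq_0)
  qed auto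
  then have "lookup (P * Q) 0 = (\<Sum>a\<in>keys P. if a = 0 then lookup P a * lookup Q 0 else 0)"
    unfolding times_poly_mapping.rep_eq prod_fun_lookup by (intro sum.cong) auto
  then show ?thesis by (simp add: in_keys_iff)
qed

lemma lookup_prod_zero: "(\<And>u. u \<in> set us \<Longrightarrow> quadratic u) \<Longrightarrow> lookup (\<Prod>u\<leftarrow>us. 1 - u) 0 = 1"
proof (induction us)
  case (Cons u us)
  have "lookup u 0 = 0" using Cons(2)[of u] by (auto simp: quadratic_def total_degree_def)
  then show ?case using Cons by (simp add: lookup_mult_zero lookup_minus)
qed simp

text \<open>The partial sums of the expansion of a term.\<close>

definition term_sum :: "nat \<Rightarrow> ratterm \<Rightarrow> nat \<Rightarrow> polynomial" where
  "term_sum n t N = numerator t * hurwitz_sum (map (u_poly n) (snd (snd t))) N"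

lemma denominator_eq: "denominator n t = (\<Prod>u\<leftarrow>map (u_poly n) (snd (snd t)). 1 - u)"
  by (simp add: denominator_def split_def comp_def)

lemma denominator_term_sum:
  assumes "snd (snd t) \<noteq> []"
  shows "lookup (denominator n t) 0 \<noteq> 0" "approximates (\<lambda>N. denominator n t * term_sum n t N) (lookup (numerator t))"
proof -
  let ?us = "map (u_poly n) (snd (snd t))"
  have q: "\<forall>u\<in>set ?us. quadratic u" by (auto simp: quadratic_u_poly)
  show "lookup (denominator n t) 0 \<noteq> 0" unfolding denominator_eq using q by (subst lookup_prod_zero) auto
  have "approximates (\<lambda>N. numerator t * ((\<Prod>u\<leftarrow>?us. 1 - u) * hurwitz_sum ?us N)) (lookup (numerator t * 1))"
    using assms q by (intro approximates_mult_poly approximates_inverse) auto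
  then show "approximates (\<lambda>N. denominator n t * term_sum n t N) (lookup (numerator t))"
    unfolding denominator_eq term_sum_def by (simp add: ac_simps)
qed

lemma term_series_approximates:
  assumes "snd (snd t) \<noteq> []"
  shows "approximates (term_sum n t) (term_series n t)"
proof -
  let ?us = "map (u_poly n) (snd (snd t))"
  have q: "\<forall>u\<in>set ?us. quadratic u" by (auto simp: quadratic_u_poly)
  define f where "f j = numerator t * hurwitz ?us j" for j
  have "approximates (\<lambda>N. numerator t * hurwitz ?us (Suc N)) (lookup (numerator t * 0))"
    by (rule approximates_mult_poly[OF approximates_hurwitz_zero[OF q]])
  then have ev: "\<exists>N0. \<forall>N\<ge>N0. lookup (f (Suc N)) m = 0" for m
    by (simp add: approximates_def eventually_sequentially f_def)
  have sum: "term_sum n t N = (\<Sum>j\<le>N. f j)" for N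
    by (simp add: term_sum_def hurwitz_sum_def f_def sum_distrib_left)
  have "\<exists>c. \<forall>\<^sub>F N in sequentially. lookup (term_sum n t N) m = c" for m
  proof -
    obtain N0 where N0: "\<And>N. N \<ge> N0 \<Longrightarrow> lookup (f (Suc N)) m = 0" using ev by blast
    have "lookup (term_sum n t N) m = lookup (term_sum n t N0) m" if "N \<ge> N0" for N
      using that by (induction N rule: dec_induct) (simp_all add: sum lookup_add N0)
    then show ?thesis by (intro exI eventually_sequentiallyI[of N0])
  qed
  then obtain G where "\<And>m. \<forall>\<^sub>F N in sequentially. lookup (term_sum n t N) m = G m" by metis
  then have G: "approximates (term_sum n t) G" by (simp add: approximates_def)
  then show ?thesis
    unfolding term_series_def using expansionI[OF denominator_term_sum(1)[OF assms] G denominator_term_sum(2)[OF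
        assms]] by simp
qed

lemma approximates_sum_list:
  "(\<And>t. t \<in> set ts \<Longrightarrow> approximates (K t) (G t)) \<Longrightarrow> approximates (\<lambda>N. \<Sum>t\<leftarrow>ts. K t N) (\<lambda>m. \<Sum>t\<leftarrow>ts. G t m)"
  by (induction ts) (simp_all add: approximates_add, simp add: approximates_def)

subsection \<open>A common fraction for a sum of terms\<close>

lemma poly_vars_add: "poly_vars (P + Q) \<subseteq> poly_vars P \<union> poly_vars Q"
  using keys_add[of P Q] unfolding poly_vars_def by blast

lemma poly_vars_minus: "poly_vars (P - Q) \<subseteq> poly_vars P \<union> poly_vars Q"
  using keys_diff[of P Q] unfolding poly_vars_def by blast

lemma poly_vars_mult: "poly_vars (P * Q) \<subseteq> poly_vars P \<union> poly_vars Q"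
proof
  fix v assume "v \<in> poly_vars (P * Q)"
  then obtain m where m: "m \<in> keys (P * Q)" "v \<in> keys m" unfolding poly_vars_def by blast
  then obtain a b where "m = a + b" "a \<in> keys P" "b \<in> keys Q" using keys_mult[of P Q] by blast
  then show "v \<in> poly_vars P \<union> poly_vars Q" using m(2) keys_add[of a b] unfolding poly_vars_def by blast
qed

lemma poly_vars_one: "poly_vars 1 = {}" and poly_vars_zero: "poly_vars 0
    = {}" and poly_vars_var: "poly_vars (var_poly v) = {v}"
  by (simp_all add: poly_vars_def var_poly_def)

lemma poly_vars_prod_list: "(\<And>P. P \<in> set Ps \<Longrightarrow> poly_vars P \<subseteq> V) \<Longrightarrow> poly_vars (prod_list Ps) \<subseteq> V"
proof (induction Ps)
  case (Cons P Ps)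
  then show ?case using poly_vars_mult[of P "prod_list Ps"] by auto
qed (simp add: poly_vars_one)

lemma poly_vars_sum: "(\<And>i. i \<in> A \<Longrightarrow> poly_vars (f i) \<subseteq> V) \<Longrightarrow> poly_vars (sum f A) \<subseteq> V"
proof (induction A rule: infinite_finite_induct)
  case (insert i A)
  then show ?case using poly_vars_add[of "f i" "sum f A"] by auto
qed (simp_all add: poly_vars_zero)

lemma poly_vars_term:
  assumes "admissible n t"
  shows "poly_vars (numerator t) \<subseteq> vars_upto n" "poly_vars (denominator n t) \<subseteq> vars_upto n"
proof -
  obtain "is" js \<sigma>s where t: "t = (is, js, \<sigma>s)" by (cases t)
  have a: "set is \<subseteq> {1..n}" "set js \<subseteq> {1..n}" "\<forall>\<sigma>\<in>set \<sigma>s. \<sigma> permutes {1..n}"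
    using assms by (auto simp: admissible_def t)
  have "poly_vars (prod_list (map (\<lambda>i. var_poly (Z i)) is)) \<subseteq> vars_upto n"
    "poly_vars (prod_list (map (\<lambda>j. var_poly (W j)) js)) \<subseteq> vars_upto n"
    by (rule poly_vars_prod_list; use a in \<open>auto simp: poly_vars_var vars_upto_def\<close>)+
  then show "poly_vars (numerator t) \<subseteq> vars_upto n"
    unfolding numerator_def t using poly_vars_mult by fastforce
  have "poly_vars (1 - u_poly n \<sigma>) \<subseteq> vars_upto n" if \<sigma>: "\<sigma> permutes {1..n}" for \<sigma>
  proof -
    have "poly_vars (u_poly n \<sigma>) \<subseteq> vars_upto n"
      unfolding u_poly_def
    proof (rule poly_vars_sum)
      fix i assume "i \<in> {1..n}"
      then have "\<sigma> i \<in> {1..n}" using permutes_in_image[OF \<sigma>] by simp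
      then show "poly_vars (var_poly (Z i) * var_poly (W (\<sigma> i))) \<subseteq> vars_upto n"
        using poly_vars_mult[of "var_poly (Z i)" "var_poly (W (\<sigma> i))"] \<open>i \<in> {1..n}\<close>
        by (auto simp: poly_vars_var vars_upto_def)
    qed
    then show ?thesis using poly_vars_minus[of 1 "u_poly n \<sigma>"] by (simp add: poly_vars_one)
  qed
  then show "poly_vars (denominator n t) \<subseteq> vars_upto n"
    unfolding denominator_def t prod.case using a(3) by (intro poly_vars_prod_list) auto
qed

lemma rational_sum_of_terms:
  assumes "\<forall>t\<in>set ts. admissible n t"
  shows "is_rational n (\<lambda>m. \<Sum>t\<leftarrow>ts. term_series n t m)"
proof -
  have ne: "snd (snd t) \<noteq> []" if "admissible n t" for t
    using that by (auto simp: admissible_def)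
  have "\<exists>P Q. poly_vars P \<subseteq> vars_upto n \<and> poly_vars Q \<subseteq> vars_upto n \<and> lookup Q 0 \<noteq> 0 \<and>
    approximates (\<lambda>N. Q * (\<Sum>t\<leftarrow>ts. term_sum n t N)) (lookup P)"
    using assms
  proof (induction ts)
    case Nil
    then show ?case
      by (intro exI[of _ 0] exI[of _ 1]) (simp add: poly_vars_zero poly_vars_one approximates_def)
  next
    case (Cons t ts)
    then obtain P Q where PQ: "poly_vars P \<subseteq> vars_upto n" "poly_vars Q \<subseteq> vars_upto n" "lookup Q 0 \<noteq> 0"
      "approximates (\<lambda>N. Q * (\<Sum>t\<leftarrow>ts. term_sum n t N)) (lookup P)" by auto
    have t: "admissible n t" using Cons.prems by simp
    let ?d = "denominator n t" and ?p = "numerator t"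
    have "approximates (\<lambda>N. Q * (?d * term_sum n t N) + ?d * (Q * (\<Sum>t\<leftarrow>ts. term_sum n t N)))
       (\<lambda>m. lookup (Q * ?p) m + lookup (?d * P) m)"
      by (intro approximates_add approximates_mult_poly denominator_term_sum(2) ne t PQ(4))
    then have "approximates (\<lambda>N. (?d * Q) * (\<Sum>t\<leftarrow>t # ts. term_sum n t N)) (lookup (Q * ?p + ?d * P))"
      by (simp add: algebra_simps lookup_add[abs_def])
    moreover have "lookup (?d * Q) 0 \<noteq> 0"
      using PQ(3) denominator_term_sum(1)[OF ne[OF t]] by (simp add: lookup_mult_zero)
    moreover have "poly_vars (Q * ?p + ?d * P) \<subseteq> vars_upto n" "poly_vars (?d * Q) \<subseteq> vars_upto n"
      using PQ poly_vars_term[OF t] poly_vars_add[of "Q * ?p" "?d * P"] poly_vars_mult[of Q ?p]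
        poly_vars_mult[of ?d P] poly_vars_mult[of ?d Q] by blast+
    ultimately show ?case by blast
  qed
  then obtain P Q where PQ: "poly_vars P \<subseteq> vars_upto n" "poly_vars Q \<subseteq> vars_upto n" "lookup Q 0 \<noteq> 0"
    "approximates (\<lambda>N. Q * (\<Sum>t\<leftarrow>ts. term_sum n t N)) (lookup P)" by blast
  have "approximates (\<lambda>N. \<Sum>t\<leftarrow>ts. term_sum n t N) (\<lambda>m. \<Sum>t\<leftarrow>ts. term_series n t m)"
    using assms ne by (intro approximates_sum_list term_series_approximates) auto
  from is_expansionI[OF PQ(3) this PQ(4)] show ?thesis
    unfolding is_rational_def using PQ by blast
qed

section \<open>Rationality of the generating functions\<close>

lemma excess_block_word: "excess (block_word I m) = int (\<Sum>i\<leftarrow>I. lookup m (W i)) - int (\<Sum>i\<leftarrow>I. lookup m (Z i))"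
proof (induction I)
  case (Cons i I)
  have "excess (replicate k Adj) = - int k" "excess (replicate k Opr) = int k" for k
    by (induction k) simp_all
  then show ?case using Cons by simp
qed simp

lemma length_block_word_sum: "length (block_word I m) = (\<Sum>i\<leftarrow>I. lookup m (W i)) + (\<Sum>i\<leftarrow>I. lookup m (Z i))"
  by (induction I) simp_all

text \<open>The separate treatment of words with unequally many letters in the definition of the numbers is
  consistent with the recursion, by which these moments vanish anyway.\<close>

lemma F_series_mu:
  assumes "quasinilpotent_DT J T \<tau>"
  shows "F_series \<tau> T n m = (if keys m \<subseteq> vars_upto n then
    if even (total_degree m) then fact (total_degree m div 2 + 1) * mu (block_word [1..<Suc n] m) else 0 else 0)"
proof (cases "keys m \<subseteq> vars_upto n")
  case True
  let ?I = "[1..<Suc n]"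
  let ?z = "\<Sum>i\<leftarrow>?I. lookup m (Z i)" and ?w = "\<Sum>i\<leftarrow>?I. lookup m (W i)"
  have "vars_of ?I = vars_upto n" by (auto simp: vars_of_def vars_upto_def)
  then have deg: "total_degree m = ?w + ?z"
    using length_block_word_total_degree[of ?I m] True length_block_word_sum[of ?I m] by simp
  have word: "alternating_word (map (\<lambda>i. (lookup m (Z i), lookup m (W i))) ?I) = block_word ?I m"
    by (simp add: alternating_word_def block_word_def comp_def)
  have F: "F_series \<tau> T n m = (if ?z = ?w then fact (?z + 1) * mu (block_word ?I m) else 0)"
    unfolding F_series_def N_num_def Let_def word quasinilpotent_DT_moment[OF assms]
    using True by (simp add: comp_def del: upt_Suc)
  show ?thesis
  proof (cases "?z = ?w")
    case eq: True
    then show ?thesis unfolding F deg using True by (simp del: upt_Suc)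
  next
    case False
    then have "mu (block_word ?I m) = 0" by (intro mu_unbalanced) (simp add: excess_block_word del: upt_Suc)
    then show ?thesis unfolding F using False by (simp del: upt_Suc)
  qed
qed (simp add: F_series_def)

theorem theorem2p6:
  fixes J :: "'h::{real_inner, complete_space} \<Rightarrow> 'h"
    and T :: "'h \<Rightarrow> 'h"
    and \<tau> :: "('h \<Rightarrow> 'h) \<Rightarrow> complex"
    and n :: nat
  assumes "quasinilpotent_DT J T \<tau>"
    and "n \<ge> 2"
  shows "is_rational n (F_series \<tau> T n) \<and>
    (\<exists>ts :: ratterm list. (\<forall>t\<in>set ts. admissible n t) \<and>
       F_series \<tau> T n = (\<lambda>m. \<Sum>t\<leftarrow>ts. term_series n t m))"
proof -
  define I where "I = [1..<Suc n]"
  have I: "distinct I" "length I = n" "set I = {1..n}" by (auto simp: I_def)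
  have vars: "vars_of I = vars_upto n" by (auto simp: vars_of_def vars_upto_def I)
  obtain ts where ts: "\<forall>t\<in>set ts. balanced {1..n} (\<lambda>_. True) 2 n t" "moment_gf I = (\<Sum>t\<leftarrow>ts. term_gf {1..n} t)"
    using spanned_moment_gf[of I] I assms(2) unfolding spanned_def by auto
  have adm: "admissible n t" if "t \<in> set ts" for t
    using that ts(1) by (cases t) (auto simp: balanced_def admissible_def)
  have ne: "snd (snd t) \<noteq> []" if "t \<in> set ts" for t
    using that ts(1) by (cases t) (auto simp: balanced_def)
  have u: "upoly {Suc 0..n} = u_poly n" by (simp add: upoly_def u_poly_def fun_eq_iff)
  \<comment> \<open>the Laplace transform of the generating function, coefficient by coefficient\<close>
  have coef: "fact j * lookup (fps_nth (moment_gf I) j) m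
      = (\<Sum>t\<leftarrow>ts. lookup (numerator t * hurwitz (map (u_poly n) (snd (snd t))) j) m)" for j m
  proof -
    have scale: "lookup (P * (Poly_Mapping.single 0 c * Q)) m = c * lookup (P * Q) m" for P Q :: polynomial and c m
    proof -
      have "P * (Poly_Mapping.single 0 c * Q) = Poly_Mapping.single 0 c * (P * Q)" by (simp add: ac_simps)
      moreover have "lookup (Poly_Mapping.single 0 c * R) m = c * lookup R m" for R :: polynomial
        unfolding times_poly_mapping.rep_eq prod_fun_lookup by (cases "c = 0") auto
      ultimately show ?thesis by (simp only:)
    qed
    have "lookup (fps_nth (\<Sum>t\<leftarrow>ts. term_gf {1..n} t) j) m
       = (\<Sum>t\<leftarrow>ts. 1 / fact j * lookup (numerator t * hurwitz (map (u_poly n) (snd (snd t))) j) m)" for ts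
      by (induction ts) (simp_all add: lookup_add term_gf_def exp_conv_def scale u)
    then show ?thesis unfolding ts(2) by (simp only: sum_list_const_mult) simp
  qed
  have "approximates (\<lambda>N. \<Sum>t\<leftarrow>ts. term_sum n t N) (F_series \<tau> T n)"
    unfolding approximates_def
  proof
    fix m
    have total: "lookup (\<Sum>t\<leftarrow>ts. term_sum n t N) m = (\<Sum>j\<le>N. fact j * lookup (fps_nth (moment_gf I) j) m)" for N
    proof -
      have "lookup (\<Sum>t\<leftarrow>ts. term_sum n t N) m
        = (\<Sum>j\<le>N. \<Sum>t\<leftarrow>ts. lookup (numerator t * hurwitz (map (u_poly n) (snd (snd t))) j) m)" for ts
        by (induction ts) (simp_all add: lookup_add term_sum_def hurwitz_sum_def sum_distrib_left lookup_sum
            sum.distrib)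
      then show ?thesis by (simp add: coef)
    qed
    have nth: "fact j * lookup (fps_nth (moment_gf I) j) m = (if j = total_degree m div 2
        + 1 then F_series \<tau> T n m else 0)" for j
      using represents_moment_gf[of I] unfolding represents_def F_series_mu[OF assms(1)] vars I_def[symmetric]
      by auto
    show "\<forall>\<^sub>F N in sequentially. lookup (\<Sum>t\<leftarrow>ts. term_sum n t N) m = F_series \<tau> T n m"
      unfolding total nth by (rule eventually_sequentiallyI[of "total_degree m div 2 + 1"]) simp
  qed
  moreover have "approximates (\<lambda>N. \<Sum>t\<leftarrow>ts. term_sum n t N) (\<lambda>m. \<Sum>t\<leftarrow>ts. term_series n t m)"
    by (intro approximates_sum_list term_series_approximates ne)
  ultimately have F: "F_series \<tau> T n = (\<lambda>m. \<Sum>t\<leftarrow>ts. term_series n t m)"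
    by (rule approximates_unique)
  moreover have "is_rational n (\<lambda>m. \<Sum>t\<leftarrow>ts. term_series n t m)"
    using adm by (intro rational_sum_of_terms) auto
  ultimately show ?thesis using adm by (intro conjI exI[of _ ts]) simp_all
qed

end
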